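(* The restriction map $r_\infty:\mathrm{mHiggs}^{\mathrm{fr}}_G(\mathbb{CP}^1,D,\omega^\vee)\to G_1[[z^{-1}]]$ to a formal neighbourhood of infinity is the inclusion of a symplectic leaf for the group $G_1(\mathbb{CP}^1)$ of $G$-valued framed rational functions on $\mathbb{CP}^1$ under the Sklyanin Poisson structure.
   Context: $G$ is a reductive complex algebraic group with Lie algebra $\mathfrak g$, and $\kappa$ is a fixed non-degenerate invariant symmetric pairing on $\mathfrak g$, used to identify $\mathfrak g\cong\mathfrak g^*$. $D=\{z_1,\dots,z_k\}\subset\mathbb C$ is finite and $\omega^\vee$ assigns a dominant coweight $\omega^\vee_{z_i}$ to each $z_i$. **Moduli space.** $\mathrm{mHiggs}^{\mathrm{fr}}_G(\mathbb{CP}^1,D,\omega^\vee)$ parametrizes principal $G$-bundles $P$ on $\mathbb{CP}^1$ with an automorphism $g$ of $P|_{\mathbb{CP}^1\setminus D}$ of singularity type $\omega^\vee_{z_i}$ at $z_i$ and a framing at $\infty$ (a trivialization of $P_\infty$ in which $g(\infty)=1$). We work where $P$ is trivial; then the framing trivializes $P$ globally and the moduli space is the set of rational maps $g:\mathbb{CP}^1\to G$, regular away from $D$, with $g(\infty)=1$ and $g\in G[[z-z_i]]\,(z-z_i)^{-\omega^\vee_{z_i}}\,G[[z-z_i]]$ near each $z_i$. The map $r_\infty$ takes the Taylor expansion of $g$ at $\infty$. A tangent vector at $g$ is given locally on $\mathbb{CP}^1$ by pairs $(X^L,X^R)$ of holomorphic $\mathfrak g$-valued functions (vanishing at $\infty$),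 representing $\delta g=X^Lg+gX^R$, modulo $(X^L,X^R)\sim(X^L+\mathrm{Ad}_gY,X^R-Y)$. **Poisson group.** $G_1[[z^{-1}]]$ is the group of $G$-valued power series in $z^{-1}$ with constant term $1$, and $G_1(\mathbb{CP}^1)\subset G_1[[z^{-1}]]$ the subgroup of rational functions $\mathbb{CP}^1\to G$ with value $1$ at $\infty$. The Sklyanin Poisson structure $\pi$ is $$\{f_1,f_2\}(g)=\langle r,\nabla_Lf_1(g)\otimes\nabla_Lf_2(g)-\nabla_Rf_1(g)\otimes\nabla_Rf_2(g)\rangle,\qquad r=\frac{\Omega_{\mathrm{Cas}}}{z-w}=\Omega_{\mathrm{Cas}}\sum_{i\ge0}z^{-i-1}w^i,$$ with $\Omega_{\mathrm{Cas}}\in\mathfrak g^{\otimes2}$ the quadratic Casimir of $\kappa$, $\langle\cdot,\cdot\rangle$ the residue pairing, and $\nabla_L,\nabla_R$ the gradients along $g\mapsto e^{tX}g$ and $g\mapsto ge^{tX}$. For evaluation functions $\phi_u(g)=\phi(g(u))$, $\psi_v(g)=\psi(g(v))$ with $\phi,\psi\in\mathcal O(G)$ and $g$ regular at $u,v$, $$\{\phi_u,\psi_v\}(g)=\tfrac1{u-v}\big(\kappa(\nabla_L\phi(g(u)),\nabla_L\psi(g(v)))-\kappa(\nabla_R\phi(g(u)),\nabla_R\psi(g(v)))\big).$$ **Symplectic leaf.** This means, at the level of tangent spaces: for every $g$ in the moduli space, $T_g\,\mathrm{mHiggs}^{\mathrm{fr}}_G(\mathbb{CP}^1,D,\omega^\vee)$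 equals the image of $\pi:T^*_gG_1(\mathbb{CP}^1)\to T_gG_1(\mathbb{CP}^1)$ (the space of Hamiltonian vectors $\pi\,d\phi$ at $g$), so that $\pi$ induces a symplectic structure on the moduli space. *)

theory Defs
  imports
    "HOL-Complex_Analysis.Complex_Analysis"
    "HOL-Computational_Algebra.Computational_Algebra"
    "HOL-Computational_Algebra.Field_as_Ring"
    "HOL-Algebra.Solvable_Groups"
begin

section \<open>Matrices and polynomial expressions in the matrix entries\<close>

definition mscale :: "'r::times \<Rightarrow> 'r^'n^'m \<Rightarrow> 'r^'n^'m" where
  "mscale c A = (\<chi> i j. c * A $ i $ j)"

text \<open>
  Polynomials over the complex numbers in the entries of an \<open>n \<times> n\<close> matrix are only ever used
  through their values in commutative \<open>\<complex>\<close>-algebras, so they are represented by expressions.  The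
  first argument of \<open>pexpr_val\<close> is the structure map \<open>\<complex> \<rightarrow> R\<close> of the algebra.
\<close>

datatype 'n pexpr =
    PConst complex
  | PEntry 'n 'n
  | PAdd "'n pexpr" "'n pexpr"
  | PMult "'n pexpr" "'n pexpr"

primrec pexpr_val :: "(complex \<Rightarrow> 'r::comm_ring_1) \<Rightarrow> 'n::finite pexpr \<Rightarrow> 'r^'n^'n \<Rightarrow> 'r" where
  "pexpr_val \<iota> (PConst c) A = \<iota> c"
| "pexpr_val \<iota> (PEntry i j) A = A $ i $ j"
| "pexpr_val \<iota> (PAdd p q) A = pexpr_val \<iota> p A + pexpr_val \<iota> q A"
| "pexpr_val \<iota> (PMult p q) A = pexpr_val \<iota> p A * pexpr_val \<iota> q A"


section \<open>Reductive linear algebraic groups\<close>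

definition GL :: "(complex^'n::finite^'n) monoid" where
  "GL = \<lparr>carrier = {A. invertible A}, mult = (**), one = mat 1\<rparr>"

text \<open>Closedness is relative to \<open>GL\<close>.\<close>

definition zariski_closed :: "(complex^'n::finite^'n) set \<Rightarrow> bool" where
  "zariski_closed S \<longleftrightarrow> (\<exists>P. S = {A. invertible A \<and> (\<forall>p\<in>P. pexpr_val id p A = 0)})"

definition zariski_connected :: "(complex^'n::finite^'n) set \<Rightarrow> bool" where
  "zariski_connected S \<longleftrightarrow>
     \<not> (\<exists>S1 S2. zariski_closed S1 \<and> zariski_closed S2 \<and> S1 \<noteq> {} \<and> S2 \<noteq> {} \<and>
          S1 \<inter> S2 = {} \<and> S1 \<union> S2 = S)"

definition algebraic_group :: "(complex^'n::finite^'n) set \<Rightarrow> bool" where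
  "algebraic_group G \<longleftrightarrow> subgroup G GL \<and> zariski_closed G"

definition unipotent :: "complex^'n::finite^'n \<Rightarrow> bool" where
  "unipotent A \<longleftrightarrow> (\<exists>k. ((\<lambda>M. (A - mat 1) ** M) ^^ k) (mat 1) = 0)"

text \<open>
  Reductive means that the unipotent radical is trivial.  The group itself is not required to be
  connected.
\<close>

definition reductive_group :: "(complex^'n::finite^'n) set \<Rightarrow> bool" where
  "reductive_group G \<longleftrightarrow> algebraic_group G \<and>
     (\<forall>U. algebraic_group U \<and> U \<lhd> GL\<lparr>carrier := G\<rparr> \<and> zariski_connected U \<and>
          (\<forall>A\<in>U. unipotent A) \<longrightarrow> U = {mat 1})"

text \<open>
  The Lie algebra is the tangent space at the identity: those \<open>X\<close> for which \<open>1 + \<epsilon>X\<close> satisfies the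
  equations of \<open>G\<close> to first order in \<open>\<epsilon>\<close>.
\<close>

definition lie_algebra :: "(complex^'n::finite^'n) set \<Rightarrow> (complex^'n^'n) set" where
  "lie_algebra G =
     {X. \<forall>p. (\<forall>A\<in>G. pexpr_val id p A = 0) \<longrightarrow>
           ((\<lambda>t. pexpr_val id p (mat 1 + mscale t X)) has_field_derivative 0) (at 0)}"

definition Ad :: "complex^'n::finite^'n \<Rightarrow> complex^'n^'n \<Rightarrow> complex^'n^'n" where
  "Ad h X = h ** X ** matrix_inv h"

text \<open>The first argument is scalar multiplication by complex numbers.\<close>

definition bilinear_form_on ::
    "(complex \<Rightarrow> 'v \<Rightarrow> 'v) \<Rightarrow> 'v::ab_group_add set \<Rightarrow> ('v \<Rightarrow> 'v \<Rightarrow> complex) \<Rightarrow> bool" where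
  "bilinear_form_on sc V \<beta> \<longleftrightarrow>
     (\<forall>x\<in>V. \<forall>y\<in>V. \<forall>z\<in>V. \<beta> (x + y) z = \<beta> x z + \<beta> y z \<and> \<beta> z (x + y) = \<beta> z x + \<beta> z y) \<and>
     (\<forall>x\<in>V. \<forall>y\<in>V. \<forall>c. \<beta> (sc c x) y = c * \<beta> x y \<and> \<beta> x (sc c y) = c * \<beta> x y)"

definition nondegenerate_on :: "'v::zero set \<Rightarrow> ('v \<Rightarrow> 'v \<Rightarrow> complex) \<Rightarrow> bool" where
  "nondegenerate_on V \<beta> \<longleftrightarrow> (\<forall>x\<in>V. (\<forall>y\<in>V. \<beta> x y = 0) \<longrightarrow> x = 0)"

definition invariant_pairing ::
    "(complex^'n::finite^'n) set \<Rightarrow> (complex^'n^'n \<Rightarrow> complex^'n^'n \<Rightarrow> complex) \<Rightarrow> bool" where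
  "invariant_pairing G \<kappa> \<longleftrightarrow>
     bilinear_form_on mscale (lie_algebra G) \<kappa> \<and>
     (\<forall>X\<in>lie_algebra G. \<forall>Y\<in>lie_algebra G. \<kappa> X Y = \<kappa> Y X) \<and>
     (\<forall>h\<in>G. \<forall>X\<in>lie_algebra G. \<forall>Y\<in>lie_algebra G. \<kappa> (Ad h X) (Ad h Y) = \<kappa> X Y) \<and>
     nondegenerate_on (lie_algebra G) \<kappa>"


subsection \<open>Dominant coweights\<close>

definition algebraic_torus :: "(complex^'n::finite^'n) set \<Rightarrow> bool" where
  "algebraic_torus T \<longleftrightarrow> algebraic_group T \<and> zariski_connected T \<and>
     (\<exists>P::complex^'n^'n. invertible P \<and>
        (\<forall>A\<in>T. \<forall>i j. i \<noteq> j \<longrightarrow> (P ** A ** matrix_inv P) $ i $ j = 0))"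

definition maximal_torus :: "(complex^'n::finite^'n) set \<Rightarrow> (complex^'n^'n) set \<Rightarrow> bool" where
  "maximal_torus G T \<longleftrightarrow> algebraic_torus T \<and> T \<subseteq> G \<and>
     (\<forall>T'. algebraic_torus T' \<and> T \<subseteq> T' \<and> T' \<subseteq> G \<longrightarrow> T' = T)"

definition connected_solvable :: "(complex^'n::finite^'n) set \<Rightarrow> bool" where
  "connected_solvable B \<longleftrightarrow>
     algebraic_group B \<and> zariski_connected B \<and> solvable (GL\<lparr>carrier := B\<rparr>)"

definition borel_subgroup :: "(complex^'n::finite^'n) set \<Rightarrow> (complex^'n^'n) set \<Rightarrow> bool" where
  "borel_subgroup G B \<longleftrightarrow> connected_solvable B \<and> B \<subseteq> G \<and>
     (\<forall>B'. connected_solvable B' \<and> B \<subseteq> B' \<and> B' \<subseteq> G \<longrightarrow> B' = B)"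

text \<open>
  Coweights are the algebraic one-parameter subgroups \<open>\<complex>\<^sup>* \<rightarrow> T\<close>; the value at \<open>0\<close> is irrelevant.
\<close>

definition coweight :: "(complex^'n::finite^'n) set \<Rightarrow> (complex \<Rightarrow> complex^'n^'n) \<Rightarrow> bool" where
  "coweight T \<omega> \<longleftrightarrow>
     (\<forall>s. s \<noteq> 0 \<longrightarrow> \<omega> s \<in> T) \<and>
     (\<forall>s t. s \<noteq> 0 \<longrightarrow> t \<noteq> 0 \<longrightarrow> \<omega> (s * t) = \<omega> s ** \<omega> t) \<and>
     (\<forall>i j. \<exists>p k. \<forall>s. s \<noteq> 0 \<longrightarrow> \<omega> s $ i $ j = poly p s / s ^ k)"

definition root_space ::
    "(complex^'n::finite^'n) set \<Rightarrow> (complex^'n^'n) set \<Rightarrow> (complex^'n^'n \<Rightarrow> complex) \<Rightarrow>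
     (complex^'n^'n) set" where
  "root_space G T \<alpha> = {X \<in> lie_algebra G. \<forall>t\<in>T. Ad t X = mscale (\<alpha> t) X}"

text \<open>Only the values of \<open>\<alpha>\<close> on \<open>T\<close> matter.\<close>

definition is_root ::
    "(complex^'n::finite^'n) set \<Rightarrow> (complex^'n^'n) set \<Rightarrow> (complex^'n^'n \<Rightarrow> complex) \<Rightarrow> bool" where
  "is_root G T \<alpha> \<longleftrightarrow> (\<exists>t\<in>T. \<alpha> t \<noteq> 1) \<and> root_space G T \<alpha> \<noteq> {0}"

definition positive_root ::
    "(complex^'n::finite^'n) set \<Rightarrow> (complex^'n^'n) set \<Rightarrow> (complex^'n^'n) set \<Rightarrow>
     (complex^'n^'n \<Rightarrow> complex) \<Rightarrow> bool" where
  "positive_root G T B \<alpha> \<longleftrightarrow> is_root G T \<alpha> \<and> root_space G T \<alpha> \<subseteq> lie_algebra B"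

text \<open>The integer \<open>m\<close> below is the pairing of \<open>\<alpha>\<close> with \<open>\<omega>\<close>.\<close>

definition dominant_coweight ::
    "(complex^'n::finite^'n) set \<Rightarrow> (complex^'n^'n) set \<Rightarrow> (complex^'n^'n) set \<Rightarrow>
     (complex \<Rightarrow> complex^'n^'n) \<Rightarrow> bool" where
  "dominant_coweight G T B \<omega> \<longleftrightarrow> coweight T \<omega> \<and>
     (\<forall>\<alpha> m. positive_root G T B \<alpha> \<longrightarrow> (\<forall>s. s \<noteq> 0 \<longrightarrow> \<alpha> (\<omega> s) = s powi m) \<longrightarrow> m \<ge> 0)"


section \<open>Rational maps into \<open>G\<close>\<close>

text \<open>
  Elements of \<open>\<complex>(z)\<close> are formal fractions, evaluated through their reduced representation; the value
  at a pole is meaningless and never relied upon.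
\<close>

definition rat_eval :: "complex poly fract \<Rightarrow> complex \<Rightarrow> complex" where
  "rat_eval r z = poly (fst (quot_of_fract r)) z / poly (snd (quot_of_fract r)) z"

definition mat_eval :: "complex poly fract^'n^'m \<Rightarrow> complex \<Rightarrow> complex^'n^'m" where
  "mat_eval g z = (\<chi> i j. rat_eval (g $ i $ j) z)"

definition mat_poles :: "complex poly fract^'n^'m \<Rightarrow> complex set" where
  "mat_poles g = {z. \<exists>i j. poly (snd (quot_of_fract (g $ i $ j))) z = 0}"

definition rat_const :: "complex \<Rightarrow> complex poly fract" where
  "rat_const c = Fract [:c:] 1"

text \<open>
  Regularity as a map to \<open>G\<close>: besides having no pole, the matrix must not degenerate.
\<close>

definition regular_at ::
    "(complex^'n::finite^'n) set \<Rightarrow> complex poly fract^'n^'n \<Rightarrow> complex \<Rightarrow> bool" where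
  "regular_at G g z \<longleftrightarrow> z \<notin> mat_poles g \<and> mat_eval g z \<in> G"

definition G1_rational :: "(complex^'n::finite^'n) set \<Rightarrow> (complex poly fract^'n^'n) set" where
  "G1_rational G = {g. finite {z. \<not> regular_at G g z} \<and> (mat_eval g \<longlongrightarrow> mat 1) at_infinity}"

text \<open>The points of \<open>G\<close> over the power series ring in one variable.\<close>

definition G_series :: "(complex^'n::finite^'n) set \<Rightarrow> (complex fps^'n^'n) set" where
  "G_series G = {A. invertible A \<and>
     (\<forall>p. (\<forall>M\<in>G. pexpr_val id p M = 0) \<longrightarrow> pexpr_val fps_const p A = 0)}"

definition G1_series :: "(complex^'n::finite^'n) set \<Rightarrow> (complex fps^'n^'n) set" where
  "G1_series G = {A \<in> G_series G. (\<chi> i j. fps_nth (A $ i $ j) 0) = mat 1}"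

text \<open>The Laurent polynomial matrix \<open>t\<^bsup>-\<omega>\<^esup>\<close>, a point of \<open>G\<close> over \<open>\<complex>((t))\<close>.\<close>

definition coweight_neg_power :: "(complex \<Rightarrow> complex^'n^'n) \<Rightarrow> complex fls^'n^'n" where
  "coweight_neg_power \<omega> = (\<chi> i j. laurent_expansion (\<lambda>t. \<omega> (inverse t) $ i $ j) 0)"

definition series_to_laurent :: "complex fps^'n^'m \<Rightarrow> complex fls^'n^'m" where
  "series_to_laurent A = (\<chi> i j. fps_to_fls (A $ i $ j))"

definition singularity_type ::
    "(complex^'n::finite^'n) set \<Rightarrow> (complex \<Rightarrow> complex^'n^'n) \<Rightarrow> complex poly fract^'n^'n \<Rightarrow>
     complex \<Rightarrow> bool" where
  "singularity_type G \<omega> g a \<longleftrightarrow>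
     (\<exists>A\<in>G_series G. \<exists>B\<in>G_series G. \<forall>i j.
        (\<lambda>t. rat_eval (g $ i $ j) (a + t)) has_laurent_expansion
          (series_to_laurent A ** coweight_neg_power \<omega> ** series_to_laurent B) $ i $ j)"

definition mHiggs_fr ::
    "(complex^'n::finite^'n) set \<Rightarrow> complex set \<Rightarrow> (complex \<Rightarrow> complex \<Rightarrow> complex^'n^'n) \<Rightarrow>
     (complex poly fract^'n^'n) set" where
  "mHiggs_fr G D \<omega> =
     {g. (\<forall>z. z \<notin> D \<longrightarrow> regular_at G g z) \<and> (mat_eval g \<longlongrightarrow> mat 1) at_infinity \<and>
         (\<forall>z\<in>D. singularity_type G (\<omega> z) g z)}"

text \<open>The Taylor expansion at infinity is taken in the coordinate \<open>w = 1/z\<close>.\<close>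

definition r_infinity :: "complex poly fract^'n^'m \<Rightarrow> complex fps^'n^'m" where
  "r_infinity g = (\<chi> i j. fls_regpart (laurent_expansion (\<lambda>w. rat_eval (g $ i $ j) (1 / w)) 0))"


section \<open>Tangent spaces\<close>

text \<open>Tangent vectors at \<open>g\<close> are represented by their variations \<open>\<delta>g\<close>.\<close>

definition tangent_G1_rational ::
    "(complex^'n::finite^'n) set \<Rightarrow> complex poly fract^'n^'n \<Rightarrow> (complex poly fract^'n^'n) set" where
  "tangent_G1_rational G g =
     {\<delta>. (\<forall>z. regular_at G g z \<and> z \<notin> mat_poles \<delta> \<longrightarrow>
             mat_eval \<delta> z ** matrix_inv (mat_eval g z) \<in> lie_algebra G) \<and>
         (mat_eval \<delta> \<longlongrightarrow> 0) at_infinity}"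

definition lie_germ :: "(complex^'n::finite^'n) set \<Rightarrow> (complex \<Rightarrow> complex^'n^'n) \<Rightarrow> complex \<Rightarrow> bool" where
  "lie_germ G X p \<longleftrightarrow>
     (\<forall>i j. (\<lambda>z. X z $ i $ j) analytic_on {p}) \<and> (\<forall>\<^sub>F z in nhds p. X z \<in> lie_algebra G)"

text \<open>
  Two pairs \<open>(X\<^sup>L, X\<^sup>R)\<close> represent the same variation exactly if they are equivalent, so passing to
  \<open>\<delta>g\<close> is the same as passing to equivalence classes of pairs.
\<close>

lemma same_variation_iff:
  fixes h :: "complex^'n::finite^'n"
  assumes "invertible h"
  shows "XL ** h + h ** XR = XL' ** h + h ** XR' \<longleftrightarrow> (\<exists>Y. XL' = XL + Ad h Y \<and> XR' = XR - Y)"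
    (is "?lhs \<longleftrightarrow> ?rhs")
proof -
  have distr: "(A + B) ** C = A ** C + B ** C" for A B C :: "complex^'n^'n"
    by (simp add: vec_eq_iff matrix_matrix_mult_def distrib_right sum.distrib)
  have inv: "h ** matrix_inv h = mat 1" "matrix_inv h ** h = mat 1"
    using someI_ex[OF assms[unfolded invertible_def]] by (auto simp: matrix_inv_def)
  show ?thesis
  proof
    assume lhs: ?lhs
    have "h ** XR = h ** (XR - XR') + h ** XR'"
      by (simp flip: matrix_add_ldistrib)
    with lhs have "XL' ** h = XL ** h + h ** (XR - XR')"
      by (simp add: algebra_simps)
    then have "(XL' ** h) ** matrix_inv h = (XL ** h + h ** (XR - XR')) ** matrix_inv h"
      by simp
    then have "XL' = XL + Ad h (XR - XR')"
      by (simp add: Ad_def inv distr matrix_mul_assoc [symmetric, of _ h])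
    then show ?rhs
      by (intro exI[of _ "XR - XR'"]) simp
  next
    assume ?rhs
    then obtain Y where Y: "XL' = XL + Ad h Y" "XR' = XR - Y"
      by blast
    have "Ad h Y ** h = h ** Y"
      by (simp add: Ad_def inv matrix_mul_assoc [symmetric, of _ _ h])
    moreover have "h ** XR = h ** Y + h ** (XR - Y)"
      by (simp flip: matrix_add_ldistrib)
    ultimately show ?lhs
      by (simp add: Y distr add.assoc)
  qed
qed

text \<open>
  The tangent space depends on \<open>D\<close> and \<open>\<omega>\<close> only through \<open>g\<close>.  The last conjunct is the condition at
  infinity, in the coordinate \<open>w = 1/z\<close>.
\<close>

definition tangent_mHiggs ::
    "(complex^'n::finite^'n) set \<Rightarrow> complex poly fract^'n^'n \<Rightarrow> (complex poly fract^'n^'n) set" where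
  "tangent_mHiggs G g =
     {\<delta>. (\<forall>p. \<exists>XL XR. lie_germ G XL p \<and> lie_germ G XR p \<and>
             (\<forall>\<^sub>F z in at p. mat_eval \<delta> z = XL z ** mat_eval g z + mat_eval g z ** XR z)) \<and>
         (\<exists>XL XR. lie_germ G XL 0 \<and> lie_germ G XR 0 \<and> XL 0 = 0 \<and> XR 0 = 0 \<and>
             (\<forall>\<^sub>F w in at 0. mat_eval \<delta> (1 / w) =
                XL w ** mat_eval g (1 / w) + mat_eval g (1 / w) ** XR w))}"


section \<open>The Sklyanin Poisson structure\<close>

text \<open>
  Regular functions on \<open>G\<close> are the restrictions of regular functions on \<open>GL\<close>, i.e. of polynomials in
  the entries and the inverse determinant; derivatives along \<open>G\<close> do not depend on the extension.
\<close>

definition regular_functions :: "(complex^'n::finite^'n \<Rightarrow> complex) set" where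
  "regular_functions = {\<lambda>A. pexpr_val id p A / det A ^ k | p k. True}"

definition fun_deriv ::
    "(complex^'n::finite^'n \<Rightarrow> complex) \<Rightarrow> complex^'n^'n \<Rightarrow> complex^'n^'n \<Rightarrow> complex" where
  "fun_deriv \<phi> h V = deriv (\<lambda>t. \<phi> (h + mscale t V)) 0"

text \<open>
  The curves \<open>e\<^bsup>tX\<^esup>h\<close> and \<open>he\<^bsup>tX\<^esup>\<close> have velocities \<open>Xh\<close> and \<open>hX\<close> at \<open>t = 0\<close>.
\<close>

definition grad_left ::
    "(complex^'n::finite^'n) set \<Rightarrow> (complex^'n^'n \<Rightarrow> complex^'n^'n \<Rightarrow> complex) \<Rightarrow>
     (complex^'n^'n \<Rightarrow> complex) \<Rightarrow> complex^'n^'n \<Rightarrow> complex^'n^'n" where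
  "grad_left G \<kappa> \<phi> h =
     (THE A. A \<in> lie_algebra G \<and> (\<forall>X\<in>lie_algebra G. \<kappa> A X = fun_deriv \<phi> h (X ** h)))"

definition grad_right ::
    "(complex^'n::finite^'n) set \<Rightarrow> (complex^'n^'n \<Rightarrow> complex^'n^'n \<Rightarrow> complex) \<Rightarrow>
     (complex^'n^'n \<Rightarrow> complex) \<Rightarrow> complex^'n^'n \<Rightarrow> complex^'n^'n" where
  "grad_right G \<kappa> \<phi> h =
     (THE A. A \<in> lie_algebra G \<and> (\<forall>X\<in>lie_algebra G. \<kappa> A X = fun_deriv \<phi> h (h ** X)))"

text \<open>
  The bracket at \<open>g\<close> of the evaluation functions \<open>g \<mapsto> \<phi>(g(u))\<close> and \<open>g \<mapsto> \<psi>(g(v))\<close>, for \<open>u \<noteq> v\<close>: the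
  gradients are concentrated at \<open>u\<close> and \<open>v\<close>, where the kernel \<open>r\<close> is \<open>1/(u - v)\<close> times the Casimir
  element.
\<close>

definition sklyanin_bracket ::
    "(complex^'n::finite^'n) set \<Rightarrow> (complex^'n^'n \<Rightarrow> complex^'n^'n \<Rightarrow> complex) \<Rightarrow>
     complex poly fract^'n^'n \<Rightarrow> (complex^'n^'n \<Rightarrow> complex) \<Rightarrow> complex \<Rightarrow>
     (complex^'n^'n \<Rightarrow> complex) \<Rightarrow> complex \<Rightarrow> complex" where
  "sklyanin_bracket G \<kappa> g \<phi> u \<psi> v =
     (\<kappa> (grad_left G \<kappa> \<phi> (mat_eval g u)) (grad_left G \<kappa> \<psi> (mat_eval g v)) -
      \<kappa> (grad_right G \<kappa> \<phi> (mat_eval g u)) (grad_right G \<kappa> \<psi> (mat_eval g v))) / (u - v)"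

text \<open>
  A pair \<open>(U, \<phi>)\<close> stands for the function \<open>f(g) = (\<Sum>u\<in>U. \<phi> u (g(u)))\<close>, defined where \<open>g\<close> is regular at
  the points of \<open>U\<close>.  By the Leibniz rule the differentials at \<open>g\<close> of arbitrary polynomials in
  evaluation functions are already attained by such sums, so the differentials of these \<open>f\<close> make up
  the cotangent space at \<open>g\<close>.
\<close>

type_synonym 'n observable = "complex set \<times> (complex \<Rightarrow> complex^'n^'n \<Rightarrow> complex)"

definition observables ::
    "(complex^'n::finite^'n) set \<Rightarrow> complex poly fract^'n^'n \<Rightarrow> 'n observable set" where
  "observables G g =
     {(U, \<phi>). finite U \<and> (\<forall>u\<in>U. regular_at G g u \<and> \<phi> u \<in> regular_functions)}"

definition differential ::
    "complex poly fract^'n::finite^'n \<Rightarrow> 'n observable \<Rightarrow> complex poly fract^'n^'n \<Rightarrow> complex" where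
  "differential g f \<delta> = (\<Sum>u\<in>fst f. fun_deriv (snd f u) (mat_eval g u) (mat_eval \<delta> u))"

text \<open>
  \<open>X = \<pi> df\<close> at \<open>g\<close>, i.e. \<open>d\<psi>\<^sub>v(X) = {f, \<psi>\<^sub>v}(g)\<close> for the evaluation functions \<open>\<psi>\<^sub>v\<close>.  The finitely many
  \<open>v\<close> excluded here are immaterial because \<open>X\<close> is rational.
\<close>

definition hamiltonian_vector ::
    "(complex^'n::finite^'n) set \<Rightarrow> (complex^'n^'n \<Rightarrow> complex^'n^'n \<Rightarrow> complex) \<Rightarrow>
     complex poly fract^'n^'n \<Rightarrow> 'n observable \<Rightarrow> complex poly fract^'n^'n \<Rightarrow> bool" where
  "hamiltonian_vector G \<kappa> g f X \<longleftrightarrow> X \<in> tangent_G1_rational G g \<and>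
     (\<forall>\<psi>\<in>regular_functions. \<forall>v. regular_at G g v \<and> v \<notin> mat_poles X \<and> v \<notin> fst f \<longrightarrow>
        fun_deriv \<psi> (mat_eval g v) (mat_eval X v) =
          (\<Sum>u\<in>fst f. sklyanin_bracket G \<kappa> g (snd f u) u \<psi> v))"

definition poisson_image ::
    "(complex^'n::finite^'n) set \<Rightarrow> (complex^'n^'n \<Rightarrow> complex^'n^'n \<Rightarrow> complex) \<Rightarrow>
     complex poly fract^'n^'n \<Rightarrow> (complex poly fract^'n^'n) set" where
  "poisson_image G \<kappa> g = {X. \<exists>f\<in>observables G g. hamiltonian_vector G \<kappa> g f X}"

definition symplectic_form_on ::
    "(complex poly fract^'n^'n) set \<Rightarrow>
     (complex poly fract^'n^'n \<Rightarrow> complex poly fract^'n^'n \<Rightarrow> complex) \<Rightarrow> bool" where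
  "symplectic_form_on V \<sigma> \<longleftrightarrow>
     bilinear_form_on (\<lambda>c. mscale (rat_const c)) V \<sigma> \<and> (\<forall>x\<in>V. \<sigma> x x = 0) \<and> nondegenerate_on V \<sigma>"

end

theory Submission
  imports Defs
begin

text \<open>
  Fix \<open>g\<close>.  An observable with left gradients \<open>\<alpha>(u)\<close> at finitely many regular points \<open>u\<close> and right gradients
  \<open>\<beta>(u)\<close>, where \<open>\<alpha>(u) = Ad g(u) \<beta>(u)\<close>, has the Hamiltonian vector \<open>(\<Sum>u. (\<alpha>(u) g - g \<beta>(u)) / (u - z))\<close>.
  It is tangent to the moduli space, because \<open>X\<^sup>L = (\<Sum>u. \<alpha>(u) / (u - z))\<close> and \<open>X\<^sup>R = - (\<Sum>u. \<beta>(u) / (u - z))\<close>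
  are holomorphic near the poles of \<open>g\<close>, and at a point \<open>u\<close> the numerator vanishes.

  For the converse, tangent vectors have bounded denominators, hence are determined by their values at
  sufficiently many regular points.  By duality it is enough that a covector killed by the Poisson structure
  also annihilates every tangent vector \<open>\<delta>\<close>.  This is the residue theorem for \<open>\<kappa>(X\<^sup>L, \<delta> g\<^sup>-\<^sup>1)\<close>: its residues
  sum to the value of the covector on \<open>\<delta>\<close>, it is \<open>O(1/z\<^sup>2)\<close> at infinity, and the poles of \<open>g\<close> do not
  contribute.  The same fact shows that the symplectic form is well defined.  To stay away from derivatives of
  \<open>g\<close>, skew-symmetry is only used for covectors with disjoint supports.
\<close>

section \<open>Rational functions of one variable\<close>

text \<open>The obstacle is finiteness. Covectors may have any finite support, so they form an
  infinite-dimensional space, while the duality argument needs finitely many functionals. Bounded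
  denominators supply them: a tangent vector with more than N zeros at regular points is 0, where N
  is the degree of a common denominator of g. Hence evaluation on a set U of more than N regular
  points is injective on tangent vectors, and covectors supported on U already reach all of them.
  Two disjoint sets U and U' of this kind are fixed. The value of a Hamiltonian vector at a point of
  its own support is a limit involving the derivative of g. At all other points it is given directly
  by the kernel, and skew-symmetry reduces to the symmetry of \<kappa> and the sign change of 1/(u -
  v). The symplectic form sends (Y, X) to the value on Y of any covector with Hamiltonian vector X.
  It is alternating because X has one such covector on U and another on U'; it is nondegenerate
  because covectors at single points separate tangent vectors.\<close>

definition is_pole_of :: "complex poly fract \<Rightarrow> complex \<Rightarrow> bool" where
  "is_pole_of r z \<longleftrightarrow> poly (snd (quot_of_fract r)) z = 0"

text \<open>The reduced denominator divides every denominator of the same fraction, so one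
  representation with a nonvanishing denominator is enough to exclude a pole and to compute the
  value.\<close>

lemma rat_eval_Fract:
  assumes "poly q z \<noteq> 0"
  shows "\<not> is_pole_of (Fract p q) z" "rat_eval (Fract p q) z = poly p z / poly q z"
proof -
  define a b where "a = fst (quot_of_fract (Fract p q))" and "b = snd (quot_of_fract (Fract p q))"
  have "q \<noteq> 0"
    using assms by auto
  moreover have "Fract a b = Fract p q" "b \<noteq> 0"
    by (simp_all add: a_def b_def Fract_quot_of_fract)
  ultimately have eq: "p * b = a * q"
    by (simp add: eq_fract)
  have "coprime a b"
    by (simp add: a_def b_def coprime_quot_of_fract)
  then have "b dvd q"
    using eq by (metis coprime_commute coprime_dvd_mult_right_iff dvd_triv_right)
  then have b: "poly b z \<noteq> 0"
    using assms by (auto simp: dvd_def)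
  then show "\<not> is_pole_of (Fract p q) z"
    by (simp add: b_def is_pole_of_def)
  have "poly p z * poly b z = poly a z * poly q z"
    using eq by (metis poly_mult)
  then show "rat_eval (Fract p q) z = poly p z / poly q z"
    using b assms by (simp add: rat_eval_def a_def b_def field_simps)
qed

lemma rat_eval_const [simp]: "rat_eval (rat_const c) z = c" "\<not> is_pole_of (rat_const c) z"
  using rat_eval_Fract[of 1 z "[:c:]"] by (simp_all add: rat_const_def)

lemma fract_cases_at:
  assumes "\<not> is_pole_of r z"
  obtains p q where "r = Fract p q" "poly q z \<noteq> 0" "q \<noteq> 0"
  using assms that[of "fst (quot_of_fract r)" "snd (quot_of_fract r)"]
  by (auto simp: Fract_quot_of_fract is_pole_of_def)

lemma rat_eval_add:
  assumes "\<not> is_pole_of r z" "\<not> is_pole_of s z"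
  shows "\<not> is_pole_of (r + s) z" "rat_eval (r + s) z = rat_eval r z + rat_eval s z"
proof -
  obtain p q where r: "r = Fract p q" "poly q z \<noteq> 0" "q \<noteq> 0" using assms(1) by (rule fract_cases_at)
  obtain p' q' where s: "s = Fract p' q'" "poly q' z \<noteq> 0" "q' \<noteq> 0" using assms(2) by (rule fract_cases_at)
  have rs: "r + s = Fract (p * q' + p' * q) (q * q')"
    unfolding r(1) s(1) using r(3) s(3) by (rule add_fract)
  have nz: "poly (q * q') z \<noteq> 0"
    using r(2) s(2) by simp
  show "\<not> is_pole_of (r + s) z"
    unfolding rs by (rule rat_eval_Fract(1)[OF nz])
  show "rat_eval (r + s) z = rat_eval r z + rat_eval s z"
    unfolding rs rat_eval_Fract(2)[OF nz] unfolding r(1) s(1) rat_eval_Fract(2)[OF r(2)] rat_eval_Fract(2)[OF s(2)]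
    using r(2) s(2) by (simp add: add_frac_eq)
qed

lemma rat_eval_mult:
  assumes "\<not> is_pole_of r z" "\<not> is_pole_of s z"
  shows "\<not> is_pole_of (r * s) z" "rat_eval (r * s) z = rat_eval r z * rat_eval s z"
proof -
  obtain p q where r: "r = Fract p q" "poly q z \<noteq> 0" using assms(1) by (rule fract_cases_at)
  obtain p' q' where s: "s = Fract p' q'" "poly q' z \<noteq> 0" using assms(2) by (rule fract_cases_at)
  have rs: "r * s = Fract (p * p') (q * q')"
    unfolding r(1) s(1) by (rule mult_fract)
  have nz: "poly (q * q') z \<noteq> 0"
    using r(2) s(2) by simp
  show "\<not> is_pole_of (r * s) z"
    unfolding rs by (rule rat_eval_Fract(1)[OF nz])
  show "rat_eval (r * s) z = rat_eval r z * rat_eval s z"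
    unfolding rs rat_eval_Fract(2)[OF nz] unfolding r(1) s(1) rat_eval_Fract(2)[OF r(2)] rat_eval_Fract(2)[OF s(2)]
    by simp
qed

lemma rat_const_0: "rat_const 0 = 0" and rat_const_1: "rat_const 1 = 1"
  by (simp_all add: rat_const_def Zero_fract_def One_fract_def pCons_one)

lemma rat_const_uminus: "rat_const (- c) = - rat_const c"
  by (simp add: rat_const_def)

lemma rat_eval_0 [simp]: "rat_eval 0 z = 0" "\<not> is_pole_of 0 z"
  using rat_eval_const[of 0] unfolding rat_const_0 by blast+

lemma rat_eval_uminus:
  assumes "\<not> is_pole_of r z"
  shows "\<not> is_pole_of (- r) z" "rat_eval (- r) z = - rat_eval r z"
proof -
  obtain p q where "r = Fract p q" "poly q z \<noteq> 0" using assms(1) by (rule fract_cases_at)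
  then show "\<not> is_pole_of (- r) z" "rat_eval (- r) z = - rat_eval r z"
    by (simp_all add: rat_eval_Fract)
qed

lemma rat_eval_diff:
  assumes "\<not> is_pole_of r z" "\<not> is_pole_of s z"
  shows "\<not> is_pole_of (r - s) z" "rat_eval (r - s) z = rat_eval r z - rat_eval s z"
proof -
  have e: "r - s = r + - s"
    by (rule diff_conv_add_uminus)
  note np = rat_eval_uminus(1)[OF assms(2)]
  show "\<not> is_pole_of (r - s) z"
    unfolding e by (rule rat_eval_add(1)[OF assms(1) np])
  show "rat_eval (r - s) z = rat_eval r z - rat_eval s z"
    unfolding e rat_eval_add(2)[OF assms(1) np] rat_eval_uminus(2)[OF assms(2)]
    by (rule diff_conv_add_uminus[symmetric])
qed

lemma rat_eval_sum:
  assumes "\<And>i. i \<in> I \<Longrightarrow> \<not> is_pole_of (f i) z"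
  shows "\<not> is_pole_of (\<Sum>i\<in>I. f i) z \<and> rat_eval (\<Sum>i\<in>I. f i) z = (\<Sum>i\<in>I. rat_eval (f i) z)"
  using assms by (induction I rule: infinite_finite_induct) (auto simp: rat_eval_add)

lemma finite_poles: "finite {z. is_pole_of r z}"
  unfolding is_pole_of_def by (rule poly_roots_finite) simp

lemma eventually_not_pole_at: "\<forall>\<^sub>F z in at p. \<not> is_pole_of r z"
proof -
  have "finite ({z. is_pole_of r z} - {p})"
    using finite_poles by simp
  then have "\<forall>\<^sub>F z in nhds p. z \<in> - ({z. is_pole_of r z} - {p})"
    by (intro eventually_nhds_in_open open_Compl finite_imp_closed) auto
  then show ?thesis
    unfolding eventually_at_filter by eventually_elim auto
qed

lemma analytic_rat_eval:
  assumes "\<not> is_pole_of r p"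
  shows "rat_eval r analytic_on {p}"
proof -
  have "poly a analytic_on {p}" for a :: "complex poly"
    unfolding poly_altdef[abs_def] by (intro analytic_intros)
  then have "(\<lambda>z. poly (fst (quot_of_fract r)) z / poly (snd (quot_of_fract r)) z) analytic_on {p}"
    using assms by (intro analytic_intros) (auto simp: is_pole_of_def)
  then show ?thesis
    by (simp add: rat_eval_def[abs_def])
qed

text \<open>Only finitely many points of \<open>S\<close> are poles. Discarding them leaves
  infinitely many roots of the cross-multiplied difference, so junk values at poles do no
  harm.\<close>

lemma rat_eqI_infinite:
  assumes "infinite S" "\<And>z. z \<in> S \<Longrightarrow> rat_eval r z = rat_eval s z"
  shows "r = s"
proof -
  define a b c d where "a = fst (quot_of_fract r)" "b = snd (quot_of_fract r)"
    "c = fst (quot_of_fract s)" "d = snd (quot_of_fract s)"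
  note defs = this
  have nz: "b \<noteq> 0" "d \<noteq> 0"
    by (simp_all add: defs)
  have "infinite (S - ({z. poly b z = 0} \<union> {z. poly d z = 0}))"
    using assms(1) nz by (intro Diff_infinite_finite finite_UnI poly_roots_finite)
  moreover have "S - ({z. poly b z = 0} \<union> {z. poly d z = 0}) \<subseteq> {z. poly (a * d - c * b) z = 0}"
  proof
    fix z assume z: "z \<in> S - ({z. poly b z = 0} \<union> {z. poly d z = 0})"
    then have "poly a z / poly b z = poly c z / poly d z"
      using assms(2)[of z] by (simp add: rat_eval_def defs)
    then show "z \<in> {z. poly (a * d - c * b) z = 0}"
      using z by (simp add: field_simps)
  qed
  ultimately have "infinite {z. poly (a * d - c * b) z = 0}"
    by (metis finite_subset)
  then have "a * d - c * b = 0"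
    using poly_roots_finite by blast
  then have "Fract a b = Fract c d"
    using nz by (simp add: eq_fract)
  then show ?thesis
    by (simp add: defs Fract_quot_of_fract)
qed

text \<open>At a pole, multiplying by the reduced denominator and passing to the limit makes the
  numerator vanish too, against coprimality. Regularity of tangent vectors is obtained in this way
  from limits of local expressions.\<close>

lemma rat_limit_imp_not_pole:
  assumes "(rat_eval r \<longlongrightarrow> l) (at p)"
  shows "\<not> is_pole_of r p" "rat_eval r p = l"
proof -
  define a b where "a = fst (quot_of_fract r)" and "b = snd (quot_of_fract r)"
  show np: "\<not> is_pole_of r p"
  proof
    assume 0: "is_pole_of r p"
    have "((\<lambda>z. rat_eval r z * poly b z) \<longlongrightarrow> l * poly b p) (at p)"
      by (intro tendsto_intros assms)
    moreover have "\<forall>\<^sub>F z in at p. rat_eval r z * poly b z = poly a z"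
      using eventually_not_pole_at[of r p] by eventually_elim (simp add: rat_eval_def a_def b_def is_pole_of_def)
    ultimately have "((\<lambda>z. poly a z) \<longlongrightarrow> l * poly b p) (at p)"
      by (rule Lim_transform_eventually)
    moreover have "((\<lambda>z. poly a z) \<longlongrightarrow> poly a p) (at p)"
      by (intro tendsto_intros)
    ultimately have "poly a p = l * poly b p"
      using tendsto_unique trivial_limit_at by blast
    then have "poly a p = 0" "poly b p = 0"
      using 0 by (simp_all add: b_def is_pole_of_def)
    moreover have "coprime a b"
      by (simp add: a_def b_def coprime_quot_of_fract)
    ultimately show False
      by (metis coprime_poly_0)
  qed
  have "(rat_eval r \<longlongrightarrow> rat_eval r p) (at p)"
    using analytic_at_imp_isCont[OF analytic_rat_eval[OF np]] by (simp add: isCont_def)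
  then show "rat_eval r p = l"
    using assms tendsto_unique trivial_limit_at by blast
qed

text \<open>\<open>E\<close> may have arbitrary values at isolated points. Liouville's theorem is
  therefore applied to a repaired function \<open>E'\<close>, and the conclusion speaks of punctured
  neighbourhoods only.\<close>

lemma Liouville_punctured:
  fixes E :: "complex \<Rightarrow> complex"
  assumes ext: "\<And>p. \<exists>F. F analytic_on {p} \<and> (\<forall>\<^sub>F z in at p. E z = F z)"
    and lim: "(E \<longlongrightarrow> 0) at_infinity"
  shows "\<forall>\<^sub>F z in at p. E z = 0"
proof -
  \<comment> \<open>The limit depends on \<open>E\<close> alone, so the local extensions need not be
    glued by hand.\<close>
  define E' where "E' z = Lim (at z) E" for z
  have E'_lim: "(E \<longlongrightarrow> E' p) (at p)"
    and E'_eq: "F analytic_on {p} \<Longrightarrow> \<forall>\<^sub>F z in at p. E z = F z \<Longrightarrow> \<forall>\<^sub>F z in nhds p. E' z = F z" for p F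
  proof -
    have L: "(E \<longlongrightarrow> F p) (at p)" if "F analytic_on {p}" "\<forall>\<^sub>F z in at p. E z = F z" for F p
      using analytic_at_imp_isCont[OF that(1)] that(2) by (simp add: isCont_def tendsto_cong)
    have L': "E' p = F p" if "F analytic_on {p}" "\<forall>\<^sub>F z in at p. E z = F z" for F p
      using tendsto_Lim[OF _ L[OF that]] by (simp add: E'_def)
    obtain F0 where "F0 analytic_on {p}" "\<forall>\<^sub>F z in at p. E z = F0 z"
      using ext by blast
    from L[OF this] L'[OF this] show "(E \<longlongrightarrow> E' p) (at p)"
      by simp
    assume F: "F analytic_on {p}" "\<forall>\<^sub>F z in at p. E z = F z"
    have "\<forall>\<^sub>F z in nhds p. z \<noteq> p \<longrightarrow> E z = F z"
      using F(2) by (simp add: eventually_at_filter)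
    \<comment> \<open>An open punctured neighbourhood of \<open>p\<close> on which \<open>E\<close>
      and \<open>F\<close> agree is a neighbourhood of each of its points, so \<open>E'\<close> and
      \<open>F\<close> agree at those points.\<close>
    then have "\<forall>\<^sub>F z in nhds p. \<forall>\<^sub>F y in nhds z. y \<noteq> p \<longrightarrow> E y = F y"
      by (simp add: eventually_eventually)
    moreover have "\<forall>\<^sub>F z in nhds p. F analytic_on {z}"
    proof -
      obtain s where s: "open s" "p \<in> s" "F holomorphic_on s"
        using F(1) by (auto simp: analytic_at)
      then have "\<forall>\<^sub>F z in nhds p. z \<in> s"
        by (simp add: eventually_nhds_in_open)
      then show ?thesis
        by eventually_elim (use s in \<open>auto simp: analytic_at\<close>)
    qed
    ultimately show "\<forall>\<^sub>F z in nhds p. E' z = F z"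
    proof eventually_elim
      case (elim z)
      show ?case
      proof (cases "z = p")
        case True
        then show ?thesis using L'[OF F] by simp
      next
        case False
        then have "\<forall>\<^sub>F y in nhds z. y \<noteq> p"
          using t1_space_nhds by blast
        with elim(1) have "\<forall>\<^sub>F y in nhds z. E y = F y"
          by eventually_elim auto
        then have "\<forall>\<^sub>F y in at z. E y = F y"
          by (auto simp: eventually_at_filter elim: eventually_mono)
        then show ?thesis
          using L' elim(2) by blast
      qed
    qed
  qed
  have "E' analytic_on {p}" for p
  proof -
    obtain F where F: "F analytic_on {p}" "\<forall>\<^sub>F z in at p. E z = F z"
      using ext by blast
    then show ?thesis
      using analytic_at_cong[OF E'_eq[OF F] refl] by simp
  qed
  then have "E' holomorphic_on UNIV"
    using analytic_imp_holomorphic analytic_on_analytic_at by blast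
  moreover have "(E' \<longlongrightarrow> 0) at_infinity"
  proof (rule tendstoI)
    fix e :: real assume "e > 0"
    \<comment> \<open>Half of \<open>e\<close>, because passing from \<open>E\<close> to its limits
      preserves only the weak inequality.\<close>
    then have "\<forall>\<^sub>F z in at_infinity. dist (E z) 0 < e / 2"
      using tendstoD[OF lim, of "e/2"] by simp
    then obtain b where b: "\<And>z. norm z \<ge> b \<Longrightarrow> norm (E z) < e / 2"
      by (auto simp: eventually_at_infinity)
    have "norm (E' z) < e" if "norm z \<ge> b + 1" for z
    proof -
      have "open {y::complex. b < norm y}"
        by (intro open_Collect_less continuous_intros)
      then have "\<forall>\<^sub>F y in nhds z. norm y > b"
        using eventually_nhds_in_open[of "{y. b < norm y}" z] that by simp
      then have "\<forall>\<^sub>F y in at z. norm (E y) \<le> e / 2"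
        unfolding eventually_at_filter by eventually_elim (use b in \<open>force intro: less_imp_le\<close>)
      then have "norm (E' z) \<le> e / 2"
        by (rule tendsto_upperbound[OF tendsto_norm[OF E'_lim]]) simp
      then show ?thesis using \<open>e > 0\<close> by simp
    qed
    then show "\<forall>\<^sub>F z in at_infinity. dist (E' z) 0 < e"
      by (auto simp: eventually_at_infinity)
  qed
  ultimately have 0: "E' z = 0" for z
    by (rule Liouville_weak_0)
  obtain F where F: "F analytic_on {p}" "\<forall>\<^sub>F z in at p. E z = F z"
    using ext by blast
  have "\<forall>\<^sub>F z in at p. E' z = F z"
    using E'_eq[OF F] by (auto simp: eventually_at_filter elim: eventually_mono)
  with F(2) show ?thesis
    by eventually_elim (simp add: 0)
qed

text \<open>
  A rational function that becomes a polynomial after multiplication by \<open>q\<close> and vanishes at infinity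
  has a numerator of degree less than that of \<open>q\<close>.
\<close>
lemma rat_eq_0_if_many_zeros:
  assumes q: "q \<noteq> 0" and U: "finite U" "degree q < card U"
    and loc: "\<And>p. \<exists>l. ((\<lambda>z. poly q z * rat_eval r z) \<longlongrightarrow> l) (at p)"
    and lim: "(rat_eval r \<longlongrightarrow> 0) at_infinity"
    and zero: "\<And>u. u \<in> U \<Longrightarrow> \<not> is_pole_of r u \<and> rat_eval r u = 0"
  shows "r = 0"
proof -
  define s where "s = Fract q 1 * r"
  have Q: "rat_eval (Fract q 1) z = poly q z" "\<not> is_pole_of (Fract q 1) z" for z
    using rat_eval_Fract[of 1 z q] by simp_all
  have s_eval: "rat_eval s z = poly q z * rat_eval r z" if "\<not> is_pole_of r z" for z
    using that by (simp add: s_def rat_eval_mult Q)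
  have np: "\<not> is_pole_of s p" for p
  proof -
    obtain l where l: "((\<lambda>z. poly q z * rat_eval r z) \<longlongrightarrow> l) (at p)"
      using loc by blast
    have "\<forall>\<^sub>F z in at p. poly q z * rat_eval r z = rat_eval s z"
      using eventually_not_pole_at[of r p] by eventually_elim (simp add: s_eval)
    with l have "(rat_eval s \<longlongrightarrow> l) (at p)"
      by (rule Lim_transform_eventually)
    then show ?thesis
      by (rule rat_limit_imp_not_pole)
  qed
  define P where "P = fst (quot_of_fract s)"
  define b where "b = snd (quot_of_fract s)"
  have "constant (poly b)"
    using fundamental_theorem_of_algebra[of b] np by (auto simp: b_def is_pole_of_def)
  then have "degree b = 0"
    by (simp add: constant_degree)
  then obtain c where c: "b = [:c:]"
    by (rule degree_eq_zeroE)
  then have "c \<noteq> 0"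
    using np[of 0] by (auto simp: b_def is_pole_of_def)
  have s_P: "rat_eval s z = poly P z / c" for z
    by (simp add: rat_eval_def P_def b_def[symmetric] c)
  show ?thesis
  proof (rule ccontr)
    assume "r \<noteq> 0"
    have "Fract q 1 \<noteq> 0"
    proof
      assume "Fract q 1 = 0"
      then have "poly q z = 0" for z
        using Q(1)[of z] by simp
      then show False
        using q poly_all_0_iff_0 by blast
    qed
    then have "s \<noteq> 0"
      using \<open>r \<noteq> 0\<close> by (simp add: s_def)
    have "P \<noteq> 0"
    proof
      assume "P = 0"
      then have "rat_eval s z = rat_eval 0 z" for z
        by (simp add: s_P)
      then have "s = 0"
        using rat_eqI_infinite[of UNIV s 0] by (simp add: infinite_UNIV_char_0)
      then show False using \<open>s \<noteq> 0\<close> by simp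
    qed
    have "U \<subseteq> {z. poly P z = 0}"
    proof
      fix u assume "u \<in> U"
      then have "rat_eval s u = 0"
        using zero[of u] by (simp add: s_eval)
      then show "u \<in> {z. poly P z = 0}"
        using \<open>c \<noteq> 0\<close> by (simp add: s_P)
    qed
    then have "card U \<le> card {z. poly P z = 0}"
      using \<open>P \<noteq> 0\<close> by (intro card_mono poly_roots_finite)
    also have "\<dots> \<le> degree P"
      using \<open>P \<noteq> 0\<close> by (rule card_poly_roots_bound)
    finally have "card U \<le> degree P" .
    with U have "degree q < degree P"
      by simp
    \<comment> \<open>The function q r / P is the constant 1 / c off a finite set, but with this
      degree comparison it would tend to 0.\<close>
    then have "((\<lambda>z. poly q z / poly P z) \<longlongrightarrow> 0) at_infinity"
      by (rule poly_divide_tendsto_0_at_infinity)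
    then have "((\<lambda>z. poly q z / poly P z * rat_eval r z) \<longlongrightarrow> 0 * 0) at_infinity"
      by (intro tendsto_mult lim)
    moreover have "\<forall>\<^sub>F z in at_infinity. poly q z / poly P z * rat_eval r z = 1 / c"
    proof -
      have "finite ({z. is_pole_of r z} \<union> {z. poly P z = 0})"
        using finite_poles[of r] poly_roots_finite[OF \<open>P \<noteq> 0\<close>] by simp
      then have "bounded ({z. is_pole_of r z} \<union> {z. poly P z = 0})"
        by (rule finite_imp_bounded)
      then obtain B where B: "\<And>z. z \<in> {z. is_pole_of r z} \<union> {z. poly P z = 0} \<Longrightarrow> norm z \<le> B"
        by (auto simp: bounded_iff)
      have "poly q z / poly P z * rat_eval r z = 1 / c" if "norm z \<ge> B + 1" for z
      proof -
        have z: "\<not> is_pole_of r z" "poly P z \<noteq> 0"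
          using B[of z] that by auto
        have "poly q z * rat_eval r z = poly P z / c"
          using s_eval[OF z(1)] s_P by simp
        then show ?thesis using z(2) by simp
      qed
      then show ?thesis by (auto simp: eventually_at_infinity)
    qed
    ultimately have "((\<lambda>z::complex. 1 / c) \<longlongrightarrow> 0) at_infinity"
      using Lim_transform_eventually by fastforce
    then have "1 / c = 0"
      using tendsto_unique[OF _ tendsto_const] trivial_limit_at_infinity by blast
    then show False using \<open>c \<noteq> 0\<close> by simp
  qed
qed

section \<open>Directional derivatives and the Lie algebra\<close>

text \<open>Induction: restrict to the kernel of one \<open>f k\<close>, then correct by a multiple
  of it. Linearity enters only through the values of \<open>h\<close> and \<open>f\<close>, so
  \<open>S\<close> needs no vector space structure. This covers covectors, which are functions whose
  values off the support are irrelevant.\<close>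

lemma functional_combination:
  fixes f :: "'i \<Rightarrow> 'v \<Rightarrow> 'a::field"
  assumes "finite I"
    and "\<And>x y c. x \<in> S \<Longrightarrow> y \<in> S \<Longrightarrow>
           \<exists>z\<in>S. h z = h x + c * h y \<and> (\<forall>i\<in>I. f i z = f i x + c * f i y)"
    and "\<And>x. x \<in> S \<Longrightarrow> (\<And>i. i \<in> I \<Longrightarrow> f i x = 0) \<Longrightarrow> h x = 0"
  shows "\<exists>a. \<forall>x\<in>S. h x = (\<Sum>i\<in>I. a i * f i x)"
  using assms
proof (induction I arbitrary: S rule: finite_induct)
  case empty
  then show ?case by auto
next
  case (insert k I)
  note comb = insert.prems(1) and ker = insert.prems(2)
  define S' where "S' = {x\<in>S. f k x = 0}"
  have "\<exists>a. \<forall>x\<in>S'. h x = (\<Sum>i\<in>I. a i * f i x)"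
  proof (rule insert.IH)
    fix x y c assume "x \<in> S'" "y \<in> S'"
    then show "\<exists>z\<in>S'. h z = h x + c * h y \<and> (\<forall>i\<in>I. f i z = f i x + c * f i y)"
      using comb[of x y c] by (auto simp: S'_def)
  next
    fix x assume "x \<in> S'" "\<And>i. i \<in> I \<Longrightarrow> f i x = 0"
    then show "h x = 0"
      using ker[of x] by (auto simp: S'_def)
  qed
  then obtain a where a: "\<And>x. x \<in> S' \<Longrightarrow> h x = (\<Sum>i\<in>I. a i * f i x)"
    by blast
  show ?case
  proof (cases "\<exists>y\<in>S. f k y \<noteq> 0")
    case False
    then have "h x = (\<Sum>i\<in>insert k I. a i * f i x)" if "x \<in> S" for x
      using a[of x] that insert.hyps by (simp add: S'_def)
    then show ?thesis by blast
  next
    case True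
    then obtain y where y: "y \<in> S" "f k y \<noteq> 0" by blast
    \<comment> \<open>The coefficient of \<open>f k\<close> is forced by the value of
      \<open>h\<close> at \<open>y\<close>.\<close>
    define b where "b = (h y - (\<Sum>i\<in>I. a i * f i y)) / f k y"
    have "h x = (\<Sum>i\<in>insert k I. (a(k := b)) i * f i x)" if x: "x \<in> S" for x
    proof -
      \<comment> \<open>Chosen so that x + c y lies in the kernel of \<open>f k\<close>.\<close>
      define c where "c = - f k x / f k y"
      obtain z where z: "z \<in> S" "h z = h x + c * h y"
          "\<And>i. i \<in> insert k I \<Longrightarrow> f i z = f i x + c * f i y"
        using comb[OF x y(1), of c] by blast
      have "f k z = 0"
        using z(3)[of k] y by (simp add: c_def)
      then have "h z = (\<Sum>i\<in>I. a i * f i z)"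
        using z(1) by (intro a) (simp add: S'_def)
      also have "\<dots> = (\<Sum>i\<in>I. a i * f i x) + c * (\<Sum>i\<in>I. a i * f i y)"
        by (simp add: z(3) algebra_simps sum.distrib sum_distrib_left)
      finally have "h x = (\<Sum>i\<in>I. a i * f i x) - c * (h y - (\<Sum>i\<in>I. a i * f i y))"
        using z(2) by (simp add: algebra_simps)
      also have "\<dots> = (\<Sum>i\<in>I. a i * f i x) + b * f k x"
        using y by (simp add: b_def c_def)
      also have "(\<Sum>i\<in>I. a i * f i x) = (\<Sum>i\<in>I. (a(k := b)) i * f i x)"
        using insert.hyps by (intro sum.cong) auto
      finally show ?thesis
        using insert.hyps by (simp add: add.commute)
    qed
    then show ?thesis by blast
  qed
qed

section \<open>Matrix identities\<close>

lemma matrix_add_rdistrib: "(A + B) ** C = A ** C + B ** (C :: 'a::semiring_1^'n^'m)"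
  by (simp add: vec_eq_iff matrix_matrix_mult_def distrib_right sum.distrib)

lemma matrix_diff_rdistrib: "(A - B) ** C = A ** C - B ** (C :: 'a::ring_1^'n^'m)"
  by (simp add: vec_eq_iff matrix_matrix_mult_def left_diff_distrib sum_subtractf)

lemma matrix_mult_0_left [simp]: "0 ** (A :: 'a::semiring_1^'n^'m) = 0"
  and matrix_mult_0_right [simp]: "(A :: 'a::semiring_1^'n^'m) ** 0 = 0"
  by (simp_all add: vec_eq_iff matrix_matrix_mult_def)

lemma matrix_mult_uminus: "(- A) ** B = - (A ** B)" "A ** (- B) = - (A ** (B :: 'a::ring_1^'n^'m))"
  by (simp_all add: vec_eq_iff matrix_matrix_mult_def sum_negf)

lemma matrix_sum_rdistrib: "(\<Sum>i\<in>I. f i) ** C = (\<Sum>i\<in>I. f i ** (C :: 'a::semiring_1^'n^'m))"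
  by (induction I rule: infinite_finite_induct) (simp_all add: matrix_add_rdistrib)

lemma matrix_sum_ldistrib: "C ** (\<Sum>i\<in>I. f i) = (\<Sum>i\<in>I. C ** (f i :: 'a::semiring_1^'n^'m))"
  by (induction I rule: infinite_finite_induct) (simp_all add: matrix_add_ldistrib)

lemma mscale_matrix_mult_left: "mscale c A ** B = mscale c (A ** (B :: 'a::comm_semiring_1^'n^'m))"
  and mscale_matrix_mult_right: "A ** mscale c B = mscale c (A ** (B :: 'a::comm_semiring_1^'n^'m))"
  by (simp_all add: vec_eq_iff matrix_matrix_mult_def mscale_def sum_distrib_left ac_simps)

lemma mscale_simps [simp]:
  "mscale 0 A = (0 :: 'a::comm_ring_1^'n^'m)" "mscale 1 A = A" "mscale c 0 = (0 :: 'a^'n^'m)"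
  "mscale c (mscale d A) = mscale (c * d) A" "mscale (- c) A = - mscale c A" "mscale c (- A) = - mscale c A"
  "(mscale c A) $ i $ j = c * A $ i $ j"
  by (simp_all add: vec_eq_iff mscale_def ac_simps)

lemma mscale_add: "mscale c (A + B) = mscale c A + mscale c (B :: 'a::comm_ring_1^'n^'m)"
  "mscale (c + d) A = mscale c A + mscale d A"
  by (simp_all add: vec_eq_iff algebra_simps)

lemma mscale_diff: "mscale c (A - B) = mscale c A - mscale c (B :: 'a::comm_ring_1^'n^'m)"
  by (simp add: vec_eq_iff algebra_simps)

lemma matrix_inv_cancel:
  assumes "invertible (A :: 'a::semiring_1^'n^'n)"
  shows "A ** matrix_inv A = mat 1" "matrix_inv A ** A = mat 1"
  using someI_ex[OF assms[unfolded invertible_def]] by (auto simp: matrix_inv_def)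

lemma matrix_inv_cancel_assoc:
  assumes "invertible (A :: 'a::semiring_1^'n^'n)"
  shows "X ** A ** matrix_inv A = X" "X ** matrix_inv A ** A = X"
    "A ** (matrix_inv A ** X) = X" "matrix_inv A ** (A ** X) = X"
  using matrix_inv_cancel[OF assms]
  by (simp_all add: matrix_mul_assoc[of X, symmetric] matrix_mul_assoc)

lemma matrix_inv_unique:
  assumes "A ** B = mat 1" "B ** (A :: 'a::semiring_1^'n^'n) = mat 1"
  shows "matrix_inv A = B"
proof -
  have "invertible A"
    using assms by (auto simp: invertible_def)
  then have "matrix_inv A ** (A ** B) = B"
    by (rule matrix_inv_cancel_assoc)
  then show ?thesis
    by (simp add: assms)
qed

text \<open>The trace form tr(K^T V), without conjugation: \<open>K\<close> encodes a complex-linear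
  functional, whose limits and analyticity reduce to those of the entries of
  \<open>V\<close>.\<close>

definition frob :: "complex^'n::finite^'n \<Rightarrow> complex^'n^'n \<Rightarrow> complex" where
  "frob K V = (\<Sum>i\<in>UNIV. \<Sum>j\<in>UNIV. K $ i $ j * V $ i $ j)"

lemma frob_add_left: "frob (K + L) V = frob K V + frob L V"
  and frob_add_right: "frob K (V + W) = frob K V + frob K W"
  and frob_mscale_left: "frob (mscale c K) V = c * frob K V"
  and frob_mscale_right: "frob K (mscale c V) = c * frob K V"
  by (simp_all add: frob_def algebra_simps sum.distrib sum_distrib_left)

lemma frob_0 [simp]: "frob 0 V = 0" "frob K 0 = 0"
  by (simp_all add: frob_def)

lemma frob_unit: "frob (\<chi> k l. if k = i \<and> l = j then 1 else 0) V = V $ i $ j"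
proof -
  have "frob (\<chi> k l. if k = i \<and> l = j then 1 else 0) V =
      (\<Sum>k\<in>UNIV. \<Sum>l\<in>UNIV. if l = j then (if k = i then V $ k $ l else 0) else 0)"
    unfolding frob_def by (intro sum.cong refl) auto
  then show ?thesis by (simp add: sum.delta)
qed

lemma continuous_on_frob: "continuous_on UNIV (frob K)"
  unfolding frob_def by (intro continuous_intros)

lemma analytic_frob:
  fixes X :: "complex \<Rightarrow> complex^'n::finite^'n"
  assumes "\<And>i j. (\<lambda>z. X z $ i $ j) analytic_on S"
  shows "(\<lambda>z. frob K (X z)) analytic_on S"
  unfolding frob_def using assms by (intro analytic_intros)

text \<open>One matrix \<open>K\<close> serves all directions, which records that the derivative is
  linear in the direction. The definition of \<open>fun_deriv\<close> alone does not give
  this.\<close>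

definition dir_derivs :: "(complex^'n::finite^'n \<Rightarrow> complex) \<Rightarrow> complex^'n^'n \<Rightarrow> complex^'n^'n \<Rightarrow> bool" where
  "dir_derivs \<phi> h K \<longleftrightarrow> (\<forall>V. ((\<lambda>t. \<phi> (h + mscale t V)) has_field_derivative frob K V) (at 0))"

lemma dir_derivs_const: "dir_derivs (\<lambda>A. c) h 0"
  by (simp add: dir_derivs_def)

lemma dir_derivs_entry: "dir_derivs (\<lambda>A. A $ i $ j) h (\<chi> k l. if k = i \<and> l = j then 1 else 0)"
  unfolding dir_derivs_def frob_unit by (auto intro!: derivative_eq_intros)

lemma dir_derivs_add:
  "dir_derivs \<phi> h K \<Longrightarrow> dir_derivs \<psi> h L \<Longrightarrow> dir_derivs (\<lambda>A. \<phi> A + \<psi> A) h (K + L)"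
  unfolding dir_derivs_def frob_add_left by (auto intro!: derivative_intros)

lemma dir_derivs_mult:
  assumes "dir_derivs \<phi> h K" "dir_derivs \<psi> h L"
  shows "dir_derivs (\<lambda>A. \<phi> A * \<psi> A) h (mscale (\<psi> h) K + mscale (\<phi> h) L)"
  unfolding dir_derivs_def frob_add_left frob_mscale_left
proof
  fix V
  have "((\<lambda>t. \<phi> (h + mscale t V)) has_field_derivative frob K V) (at 0)"
    "((\<lambda>t. \<psi> (h + mscale t V)) has_field_derivative frob L V) (at 0)"
    using assms by (simp_all add: dir_derivs_def)
  from DERIV_mult[OF this]
  show "((\<lambda>t. \<phi> (h + mscale t V) * \<psi> (h + mscale t V)) has_field_derivative
      \<psi> h * frob K V + \<phi> h * frob L V) (at 0)"
    by (simp add: algebra_simps)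
qed

lemma dir_derivs_divide:
  assumes "dir_derivs \<phi> h K" "dir_derivs \<psi> h L" "\<psi> h \<noteq> 0"
  shows "dir_derivs (\<lambda>A. \<phi> A / \<psi> A) h (mscale (1 / \<psi> h) K + mscale (- \<phi> h / (\<psi> h * \<psi> h)) L)"
  unfolding dir_derivs_def frob_add_left frob_mscale_left
proof
  fix V
  have d: "((\<lambda>t. \<phi> (h + mscale t V)) has_field_derivative frob K V) (at 0)"
    "((\<lambda>t. \<psi> (h + mscale t V)) has_field_derivative frob L V) (at 0)"
    using assms by (simp_all add: dir_derivs_def)
  show "((\<lambda>t. \<phi> (h + mscale t V) / \<psi> (h + mscale t V)) has_field_derivative
      1 / \<psi> h * frob K V + - \<phi> h / (\<psi> h * \<psi> h) * frob L V) (at 0)"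
    using DERIV_divide[OF d] assms(3) by (simp add: field_simps)
qed

lemma dir_derivs_sum_ex:
  assumes "\<And>i. i \<in> I \<Longrightarrow> \<exists>K. dir_derivs (\<phi> i) h K"
  shows "\<exists>K. dir_derivs (\<lambda>A. \<Sum>i\<in>I. \<phi> i A) h K"
  using assms
proof (induction I rule: infinite_finite_induct)
  case (insert x F)
  then obtain K L where "dir_derivs (\<phi> x) h K" "dir_derivs (\<lambda>A. \<Sum>i\<in>F. \<phi> i A) h L"
    by blast
  from dir_derivs_add[OF this] show ?case
    using insert.hyps by (simp, blast)
qed (auto intro: dir_derivs_const)

lemma dir_derivs_prod_ex:
  assumes "\<And>i. i \<in> I \<Longrightarrow> \<exists>K. dir_derivs (\<phi> i) h K"
  shows "\<exists>K. dir_derivs (\<lambda>A. \<Prod>i\<in>I. \<phi> i A) h K"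
  using assms
proof (induction I rule: infinite_finite_induct)
  case (insert x F)
  then obtain K L where "dir_derivs (\<phi> x) h K" "dir_derivs (\<lambda>A. \<Prod>i\<in>F. \<phi> i A) h L"
    by blast
  from dir_derivs_mult[OF this] show ?case
    using insert.hyps by (simp, blast)
qed (auto intro: dir_derivs_const)

lemma dir_derivs_pexpr: "\<exists>K. dir_derivs (pexpr_val id p) h K"
  by (induction p) (auto intro: dir_derivs_const dir_derivs_entry dir_derivs_add dir_derivs_mult)

lemma dir_derivs_det: "\<exists>K. dir_derivs det (h :: complex^'n::finite^'n) K"
proof -
  have "\<exists>K. dir_derivs (\<lambda>A. of_int (sign p) * (\<Prod>i\<in>UNIV. A $ i $ p i)) h K" for p :: "'n \<Rightarrow> 'n"
  proof -
    have "\<exists>K. dir_derivs (\<lambda>A :: complex^'n^'n. A $ i $ p i) h K" for i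
      by (rule exI, rule dir_derivs_entry)
    then obtain K where "dir_derivs (\<lambda>A. \<Prod>i\<in>UNIV. A $ i $ p i) h K"
      using dir_derivs_prod_ex[of UNIV "\<lambda>i A. A $ i $ p i" h] by blast
    from dir_derivs_mult[OF dir_derivs_const this] show ?thesis
      by (rule exI)
  qed
  then show ?thesis
    unfolding det_def[abs_def] by (intro dir_derivs_sum_ex) auto
qed

lemma dir_derivs_regular:
  assumes "\<phi> \<in> regular_functions" "invertible h"
  shows "\<exists>K. dir_derivs \<phi> h K"
proof -
  obtain p k where \<phi>: "\<phi> = (\<lambda>A. pexpr_val id p A / det A ^ k)"
    using assms(1) by (auto simp: regular_functions_def)
  \<comment> \<open>The power of the determinant is written as a product with constant factor, so
    that the product rule covers it.\<close>
  obtain K L where "dir_derivs (pexpr_val id p) h K" "dir_derivs (\<lambda>A. \<Prod>i\<in>{..<k}. det A) h L"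
    using dir_derivs_pexpr dir_derivs_prod_ex[of "{..<k}" "\<lambda>_. det" h] dir_derivs_det by blast
  then have "dir_derivs (pexpr_val id p) h K" "dir_derivs (\<lambda>A. det A ^ k) h L"
    by simp_all
  moreover have "det h ^ k \<noteq> 0"
    using assms(2) by (simp add: invertible_det_nz)
  ultimately show ?thesis
    unfolding \<phi> using dir_derivs_divide by blast
qed

lemma fun_deriv_eq_frob: "dir_derivs \<phi> h K \<Longrightarrow> fun_deriv \<phi> h V = frob K V"
  unfolding dir_derivs_def fun_deriv_def by (blast intro: DERIV_imp_deriv)

section \<open>Polynomial functions of the matrix entries, closed under substitution\<close>

definition polyfun :: "(complex^'n::finite^'n \<Rightarrow> complex) \<Rightarrow> bool" where
  "polyfun f \<longleftrightarrow> (\<exists>p. f = pexpr_val id p)"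

lemma polyfun_const: "polyfun (\<lambda>A. c)"
  unfolding polyfun_def by (rule exI[of _ "PConst c"]) auto

lemma polyfun_entry: "polyfun (\<lambda>A. A $ i $ j)"
  unfolding polyfun_def by (rule exI[of _ "PEntry i j"]) auto

lemma polyfun_add:
  assumes "polyfun f" "polyfun g"
  shows "polyfun (\<lambda>A. f A + g A)"
proof -
  obtain p q where "f = pexpr_val id p" "g = pexpr_val id q"
    using assms by (auto simp: polyfun_def)
  then show ?thesis
    unfolding polyfun_def by (intro exI[of _ "PAdd p q"]) auto
qed

lemma polyfun_mult:
  assumes "polyfun f" "polyfun g"
  shows "polyfun (\<lambda>A. f A * g A)"
proof -
  obtain p q where "f = pexpr_val id p" "g = pexpr_val id q"
    using assms by (auto simp: polyfun_def)
  then show ?thesis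
    unfolding polyfun_def by (intro exI[of _ "PMult p q"]) auto
qed

lemma polyfun_sum: "(\<And>i. i \<in> I \<Longrightarrow> polyfun (f i)) \<Longrightarrow> polyfun (\<lambda>A. \<Sum>i\<in>I. f i A)"
  by (induction I rule: infinite_finite_induct) (auto intro: polyfun_const polyfun_add)

lemma polyfun_compose:
  fixes F :: "complex^'n::finite^'n \<Rightarrow> complex^'n^'n"
  assumes "\<And>i j. polyfun (\<lambda>A. F A $ i $ j)"
  shows "polyfun (\<lambda>A. pexpr_val id p (F A))"
  by (induction p) (auto intro: polyfun_const polyfun_add polyfun_mult assms)

lemma polyfun_regular:
  assumes "polyfun f"
  shows "f \<in> regular_functions"
proof -
  obtain p where "f = (\<lambda>A. pexpr_val id p A / det A ^ 0)"
    using assms by (auto simp: polyfun_def)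
  then show ?thesis
    unfolding regular_functions_def by blast
qed

text \<open>\<open>\<K>\<close> collects the gradients at the identity of the equations of
  \<open>G\<close>. A common kernel of linear functionals is both a subspace and closed, and both
  facts are drawn from this description.\<close>

lemma lie_algebra_eq_frob:
  "\<exists>\<K>. lie_algebra G = {X. \<forall>K\<in>\<K>. frob K X = 0}"
proof -
  define \<K> where "\<K> = {K. \<exists>p. (\<forall>A\<in>G. pexpr_val id p A = 0) \<and> dir_derivs (pexpr_val id p) (mat 1) K}"
  have "X \<in> lie_algebra G \<longleftrightarrow> (\<forall>K\<in>\<K>. frob K X = 0)" for X
  proof
    assume X: "X \<in> lie_algebra G"
    show "\<forall>K\<in>\<K>. frob K X = 0"
    proof
      fix K assume "K \<in> \<K>"
      then obtain p where p: "\<forall>A\<in>G. pexpr_val id p A = 0" "dir_derivs (pexpr_val id p) (mat 1) K"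
        by (auto simp: \<K>_def)
      have "((\<lambda>t. pexpr_val id p (mat 1 + mscale t X)) has_field_derivative 0) (at 0)"
        using X p(1) by (auto simp: lie_algebra_def)
      moreover have "((\<lambda>t. pexpr_val id p (mat 1 + mscale t X)) has_field_derivative frob K X) (at 0)"
        using p(2) by (auto simp: dir_derivs_def)
      ultimately show "frob K X = 0"
        using DERIV_unique by blast
    qed
  next
    assume 0: "\<forall>K\<in>\<K>. frob K X = 0"
    show "X \<in> lie_algebra G"
      unfolding lie_algebra_def
    proof (intro CollectI allI impI)
      fix p assume p: "\<forall>A\<in>G. pexpr_val id p A = 0"
      obtain K where K: "dir_derivs (pexpr_val id p) (mat 1) K"
        using dir_derivs_pexpr by blast
      then have "frob K X = 0"
        using 0 p by (auto simp: \<K>_def)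
      then show "((\<lambda>t. pexpr_val id p (mat 1 + mscale t X)) has_field_derivative 0) (at 0)"
        using K by (metis dir_derivs_def)
    qed
  qed
  then show ?thesis by blast
qed

lemma lie_algebra_0 [simp]: "0 \<in> lie_algebra G"
  and lie_algebra_add: "X \<in> lie_algebra G \<Longrightarrow> Y \<in> lie_algebra G \<Longrightarrow> X + Y \<in> lie_algebra G"
  and lie_algebra_mscale: "X \<in> lie_algebra G \<Longrightarrow> mscale c X \<in> lie_algebra G"
  using lie_algebra_eq_frob[of G] by (auto simp: frob_add_right frob_mscale_right)

lemma lie_algebra_uminus: "X \<in> lie_algebra G \<Longrightarrow> - X \<in> lie_algebra G"
  using lie_algebra_mscale[of X G "-1"] by simp

lemma lie_algebra_diff: "X \<in> lie_algebra G \<Longrightarrow> Y \<in> lie_algebra G \<Longrightarrow> X - Y \<in> lie_algebra G"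
  using lie_algebra_add[of X G "- Y"] lie_algebra_uminus[of Y G] by simp

lemma lie_algebra_sum: "(\<And>i. i \<in> I \<Longrightarrow> f i \<in> lie_algebra G) \<Longrightarrow> (\<Sum>i\<in>I. f i) \<in> lie_algebra G"
  by (induction I rule: infinite_finite_induct) (auto intro: lie_algebra_add)

lemma closed_lie_algebra: "closed (lie_algebra G)"
proof -
  obtain \<K> where "lie_algebra G = {X. \<forall>K\<in>\<K>. frob K X = 0}"
    using lie_algebra_eq_frob by blast
  then have "lie_algebra G = (\<Inter>K\<in>\<K>. {X. frob K X = 0})"
    by auto
  moreover have "closed {X. frob K X = 0}" for K :: "complex^'n^'n"
    by (rule closed_Collect_eq[OF continuous_on_frob continuous_on_const])
  ultimately show ?thesis by auto
qed

text \<open>Spanning is meant over the reals, in the Euclidean space of matrices. That suffices for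
  tests with the complex-linear \<kappa>.\<close>

lemma lie_algebra_finite_spanning:
  obtains Bs where "finite Bs" "Bs \<subseteq> lie_algebra G" "lie_algebra G \<subseteq> span Bs"
proof -
  obtain Bs where "Bs \<subseteq> lie_algebra G" "independent Bs" "lie_algebra G \<subseteq> span Bs"
    using maximal_independent_subset by blast
  then show ?thesis
    using that independent_bound[of Bs] by blast
qed

lemma scaleR_eq_mscale: "r *\<^sub>R A = mscale (of_real r) (A :: complex^'n^'m)"
  by (simp add: vec_eq_iff scaleR_conv_of_real[where 'a = complex])

section \<open>Invariant pairings and gradients\<close>

locale invariant_group =
  fixes G :: "(complex^'n::finite^'n) set"
    and \<kappa> :: "complex^'n^'n \<Rightarrow> complex^'n^'n \<Rightarrow> complex"
  assumes algebraic: "algebraic_group G" and pairing: "invariant_pairing G \<kappa>"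
begin

abbreviation lie :: "(complex^'n^'n) set" where "lie \<equiv> lie_algebra G"

lemma subgroup_G: "subgroup G GL"
  using algebraic by (simp add: algebraic_group_def)

lemma invertible_G: "h \<in> G \<Longrightarrow> invertible h"
  using subgroup.subset[OF subgroup_G] by (auto simp: GL_def)

lemma one_G: "mat 1 \<in> G"
  using subgroup.one_closed[OF subgroup_G] by (simp add: GL_def)

lemma mult_G: "h \<in> G \<Longrightarrow> k \<in> G \<Longrightarrow> h ** k \<in> G"
  using subgroup.m_closed[OF subgroup_G] by (simp add: GL_def)

lemma inv_G:
  assumes "h \<in> G"
  shows "matrix_inv h \<in> G"
proof -
  note h = matrix_inv_cancel[OF invertible_G[OF assms]]
  have "m_inv GL h = matrix_inv h"
    unfolding m_inv_def
  proof (rule the_equality)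
    show "matrix_inv h \<in> carrier GL \<and> h \<otimes>\<^bsub>GL\<^esub> matrix_inv h = \<one>\<^bsub>GL\<^esub> \<and> matrix_inv h \<otimes>\<^bsub>GL\<^esub> h = \<one>\<^bsub>GL\<^esub>"
      using h by (auto simp: GL_def invertible_def)
  next
    fix y assume "y \<in> carrier GL \<and> h \<otimes>\<^bsub>GL\<^esub> y = \<one>\<^bsub>GL\<^esub> \<and> y \<otimes>\<^bsub>GL\<^esub> h = \<one>\<^bsub>GL\<^esub>"
    then show "y = matrix_inv h"
      using matrix_inv_unique[of h y] by (simp add: GL_def)
  qed
  then show ?thesis
    using subgroup.m_inv_closed[OF subgroup_G assms] by simp
qed

lemma matrix_inv_inv: "h \<in> G \<Longrightarrow> matrix_inv (matrix_inv h) = h"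
  by (intro matrix_inv_unique matrix_inv_cancel invertible_G)

lemma Ad_mult: "h \<in> G \<Longrightarrow> Ad h X ** h = h ** X"
  by (simp add: Ad_def matrix_inv_cancel_assoc invertible_G)

lemma Ad_inv_cancel:
  assumes "h \<in> G"
  shows "Ad h (Ad (matrix_inv h) X) = X" "Ad (matrix_inv h) (Ad h X) = X"
  using assms unfolding Ad_def matrix_inv_inv[OF assms]
  by (simp_all add: matrix_mul_assoc matrix_inv_cancel_assoc matrix_inv_cancel invertible_G)

lemma mult_Ad_inv: "h \<in> G \<Longrightarrow> h ** Ad (matrix_inv h) X = X ** h"
  using Ad_mult[of h "Ad (matrix_inv h) X"] by (simp add: Ad_inv_cancel)

lemma Ad_add: "Ad h (X + Y) = Ad h X + Ad h Y"
  by (simp add: Ad_def matrix_add_ldistrib matrix_add_rdistrib)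

lemma Ad_mscale: "Ad h (mscale c X) = mscale c (Ad h X)"
  by (simp add: Ad_def mscale_matrix_mult_left mscale_matrix_mult_right)

lemma Ad_lie:
  assumes h: "h \<in> G" and X: "X \<in> lie"
  shows "Ad h X \<in> lie"
  unfolding lie_algebra_def
proof (intro CollectI allI impI)
  fix p assume p: "\<forall>A\<in>G. pexpr_val id p A = 0"
  define F where "F A = h ** A ** matrix_inv h" for A :: "complex^'n^'n"
  have "polyfun (\<lambda>A. F A $ i $ j)" for i j
    unfolding F_def matrix_matrix_mult_def
    by (simp, intro polyfun_sum polyfun_mult polyfun_const polyfun_entry)
  then have "polyfun (\<lambda>A. pexpr_val id p (F A))"
    by (rule polyfun_compose)
  then obtain q where q: "\<And>A. pexpr_val id p (F A) = pexpr_val id q A"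
    by (metis polyfun_def)
  have "\<forall>A\<in>G. pexpr_val id q A = 0"
    using p h unfolding q[symmetric] F_def by (simp add: mult_G inv_G)
  then have "((\<lambda>t. pexpr_val id q (mat 1 + mscale t X)) has_field_derivative 0) (at 0)"
    using X by (auto simp: lie_algebra_def)
  moreover have "F (mat 1 + mscale t X) = mat 1 + mscale t (Ad h X)" for t
    by (simp add: F_def Ad_def matrix_add_ldistrib matrix_add_rdistrib mscale_matrix_mult_left
        mscale_matrix_mult_right matrix_inv_cancel invertible_G h)
  ultimately show "((\<lambda>t. pexpr_val id p (mat 1 + mscale t (Ad h X))) has_field_derivative 0) (at 0)"
    by (simp flip: q)
qed

lemma kappa_add:
  assumes "X \<in> lie" "Y \<in> lie" "Z \<in> lie"
  shows "\<kappa> (X + Y) Z = \<kappa> X Z + \<kappa> Y Z" "\<kappa> Z (X + Y) = \<kappa> Z X + \<kappa> Z Y"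
  using pairing assms unfolding invariant_pairing_def bilinear_form_on_def by blast+

lemma kappa_mscale:
  assumes "X \<in> lie" "Y \<in> lie"
  shows "\<kappa> (mscale c X) Y = c * \<kappa> X Y" "\<kappa> X (mscale c Y) = c * \<kappa> X Y"
  using pairing assms unfolding invariant_pairing_def bilinear_form_on_def by blast+

lemma kappa_sym: "X \<in> lie \<Longrightarrow> Y \<in> lie \<Longrightarrow> \<kappa> X Y = \<kappa> Y X"
  using pairing unfolding invariant_pairing_def by blast

lemma kappa_Ad: "h \<in> G \<Longrightarrow> X \<in> lie \<Longrightarrow> Y \<in> lie \<Longrightarrow> \<kappa> (Ad h X) (Ad h Y) = \<kappa> X Y"
  using pairing unfolding invariant_pairing_def by blast

lemma kappa_Ad_right:
  assumes "h \<in> G" "X \<in> lie" "Y \<in> lie"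
  shows "\<kappa> X (Ad h Y) = \<kappa> (Ad (matrix_inv h) X) Y"
  using kappa_Ad[OF assms(1) Ad_lie[OF inv_G[OF assms(1)] assms(2)] assms(3)]
  by (simp add: Ad_inv_cancel assms)

lemma kappa_nondeg: "X \<in> lie \<Longrightarrow> (\<And>Y. Y \<in> lie \<Longrightarrow> \<kappa> X Y = 0) \<Longrightarrow> X = 0"
  using pairing unfolding invariant_pairing_def nondegenerate_on_def by blast

lemma kappa_0: "X \<in> lie \<Longrightarrow> \<kappa> 0 X = 0" "X \<in> lie \<Longrightarrow> \<kappa> X 0 = 0"
  using kappa_mscale[of X X 0] kappa_mscale(1)[of 0 X 0] kappa_mscale(2)[of X 0 0] by simp_all

lemma kappa_uminus: "X \<in> lie \<Longrightarrow> Y \<in> lie \<Longrightarrow> \<kappa> (- X) Y = - \<kappa> X Y"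
  "X \<in> lie \<Longrightarrow> Y \<in> lie \<Longrightarrow> \<kappa> X (- Y) = - \<kappa> X Y"
  using kappa_mscale[of X Y "-1"] by simp_all

lemma kappa_diff:
  assumes "X \<in> lie" "Y \<in> lie" "Z \<in> lie"
  shows "\<kappa> (X - Y) Z = \<kappa> X Z - \<kappa> Y Z" "\<kappa> Z (X - Y) = \<kappa> Z X - \<kappa> Z Y"
  using kappa_add[OF assms(1) lie_algebra_uminus[OF assms(2)] assms(3)]
    kappa_uminus[OF assms(2,3)] kappa_uminus[OF assms(3,2)] by simp_all

lemma kappa_sum_left: "(\<And>i. i \<in> I \<Longrightarrow> f i \<in> lie) \<Longrightarrow> Z \<in> lie \<Longrightarrow> \<kappa> (\<Sum>i\<in>I. f i) Z = (\<Sum>i\<in>I. \<kappa> (f i) Z)"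
  by (induction I rule: infinite_finite_induct) (simp_all add: kappa_0 kappa_add lie_algebra_sum)

lemma kappa_sum_right: "(\<And>i. i \<in> I \<Longrightarrow> f i \<in> lie) \<Longrightarrow> Z \<in> lie \<Longrightarrow> \<kappa> Z (\<Sum>i\<in>I. f i) = (\<Sum>i\<in>I. \<kappa> Z (f i))"
  by (induction I rule: infinite_finite_induct) (simp_all add: kappa_0 kappa_add lie_algebra_sum)

lemma lie_comb: "X \<in> lie \<Longrightarrow> Y \<in> lie \<Longrightarrow> X + mscale c Y \<in> lie"
  by (intro lie_algebra_add lie_algebra_mscale)

text \<open>The matrix entries are finitely many functionals with common kernel 0, so every other
  functional is a combination of them.\<close>

lemma linear_functional_frob:
  assumes "\<And>X Y c. X \<in> lie \<Longrightarrow> Y \<in> lie \<Longrightarrow> l (X + mscale c Y) = l X + c * l Y"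
  shows "\<exists>K. \<forall>X\<in>lie. l X = frob K X"
proof -
  define e :: "'n \<times> 'n \<Rightarrow> complex^'n^'n \<Rightarrow> complex" where "e ij X = X $ fst ij $ snd ij" for ij X
  have "\<exists>a. \<forall>X\<in>lie. l X = (\<Sum>ij\<in>UNIV. a ij * e ij X)"
  proof (rule functional_combination)
    fix X Y c assume XY: "X \<in> lie" "Y \<in> lie"
    show "\<exists>Z\<in>lie. l Z = l X + c * l Y \<and> (\<forall>ij\<in>UNIV. e ij Z = e ij X + c * e ij Y)"
      using XY by (intro bexI[of _ "X + mscale c Y"]) (auto simp: assms lie_comb e_def)
  next
    fix X assume X: "X \<in> lie" "\<And>ij. ij \<in> UNIV \<Longrightarrow> e ij X = 0"
    have "X = 0"
      unfolding vec_eq_iff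
    proof (intro allI)
      fix i j
      show "X $ i $ j = 0 $ i $ j"
        using X(2)[of "(i, j)"] by (simp add: e_def)
    qed
    then show "l X = 0"
      \<comment> \<open>For X = Y = 0 and c = -1 linearity reads l 0 = l 0 - l 0.\<close>
      using assms[of 0 0 "-1"] by simp
  qed simp
  then obtain a where a: "\<And>X. X \<in> lie \<Longrightarrow> l X = (\<Sum>ij\<in>UNIV. a ij * e ij X)"
    by blast
  have "l X = frob (\<chi> i j. a (i, j)) X" if "X \<in> lie" for X
    unfolding a[OF that] frob_def UNIV_Times_UNIV[symmetric] sum.cartesian_product
    by (simp add: case_prod_beta e_def)
  then show ?thesis by blast
qed

text \<open>Nothing is known about \<kappa> off the Lie algebra. Replacing \<kappa>(A, .) by a
  functional on all matrices makes continuity and analyticity available.\<close>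

lemma kappa_frob:
  assumes "A \<in> lie"
  obtains K where "\<And>X. X \<in> lie \<Longrightarrow> \<kappa> A X = frob K X"
proof -
  have "\<exists>K. \<forall>X\<in>lie. \<kappa> A X = frob K X"
    by (rule linear_functional_frob) (simp add: kappa_add kappa_mscale lie_algebra_mscale assms)
  then show ?thesis using that by blast
qed

text \<open>Vanishing on a spanning set propagates to the span, where nondegeneracy applies.
  Finiteness is what lets \<open>functional_combination\<close> be used.\<close>

lemma kappa_separates_finite:
  obtains Bs where "finite Bs" "Bs \<subseteq> lie" "\<And>X. X \<in> lie \<Longrightarrow> (\<And>b. b \<in> Bs \<Longrightarrow> \<kappa> b X = 0) \<Longrightarrow> X = 0"
proof -
  obtain Bs where Bs: "finite Bs" "Bs \<subseteq> lie" "lie \<subseteq> span Bs"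
    using lie_algebra_finite_spanning by blast
  have "X = 0" if X: "X \<in> lie" and 0: "\<And>b. b \<in> Bs \<Longrightarrow> \<kappa> b X = 0" for X
  proof (rule kappa_nondeg[OF X])
    fix Y assume "Y \<in> lie"
    then have "Y \<in> span Bs"
      using Bs by blast
    moreover have "subspace {Y \<in> lie. \<kappa> Y X = 0}"
      using X by (auto simp: subspace_def kappa_0 kappa_add lie_algebra_add scaleR_eq_mscale
          kappa_mscale lie_algebra_mscale)
    then have "span Bs \<subseteq> {Y \<in> lie. \<kappa> Y X = 0}"
      using Bs 0 by (intro span_minimal) auto
    ultimately show "\<kappa> X Y = 0"
      using X kappa_sym[of X Y] by auto
  qed
  then show ?thesis
    using that Bs by blast
qed

text \<open>The functionals \<kappa>(b, .) for \<open>b\<close> in a finite separating set have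
  common kernel 0, so \<open>l\<close> is a combination of them. This is where gradients come
  from.\<close>

lemma kappa_represent:
  assumes "\<And>X Y c. X \<in> lie \<Longrightarrow> Y \<in> lie \<Longrightarrow> l (X + mscale c Y) = l X + c * l Y"
  shows "\<exists>A\<in>lie. \<forall>X\<in>lie. \<kappa> A X = l X"
proof -
  obtain Bs where Bs: "finite Bs" "Bs \<subseteq> lie" "\<And>X. X \<in> lie \<Longrightarrow> (\<And>b. b \<in> Bs \<Longrightarrow> \<kappa> b X = 0) \<Longrightarrow> X = 0"
    using kappa_separates_finite by blast
  have "\<exists>a. \<forall>X\<in>lie. l X = (\<Sum>b\<in>Bs. a b * \<kappa> b X)"
  proof (rule functional_combination[OF Bs(1)])
    fix X Y c assume XY: "X \<in> lie" "Y \<in> lie"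
    then have "\<forall>b\<in>Bs. \<kappa> b (X + mscale c Y) = \<kappa> b X + c * \<kappa> b Y"
      using Bs(2) by (auto simp: kappa_add kappa_mscale lie_algebra_mscale subset_iff)
    then show "\<exists>Z\<in>lie. l Z = l X + c * l Y \<and> (\<forall>b\<in>Bs. \<kappa> b Z = \<kappa> b X + c * \<kappa> b Y)"
      using XY by (intro bexI[of _ "X + mscale c Y"]) (auto simp: assms lie_comb)
  next
    fix X assume "X \<in> lie" "\<And>b. b \<in> Bs \<Longrightarrow> \<kappa> b X = 0"
    then have "X = 0" by (rule Bs(3))
    then show "l X = 0"
      using assms[of 0 0 "-1"] by simp
  qed
  then obtain a where a: "\<And>X. X \<in> lie \<Longrightarrow> l X = (\<Sum>b\<in>Bs. a b * \<kappa> b X)"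
    by blast
  have mem: "mscale (a b) b \<in> lie" if "b \<in> Bs" for b
    using that Bs(2) by (auto intro: lie_algebra_mscale)
  have "\<kappa> (\<Sum>b\<in>Bs. mscale (a b) b) X = l X" if "X \<in> lie" for X
    using that Bs(2) a[OF that]
    by (auto simp: kappa_sum_left mem kappa_mscale subset_iff intro!: sum.cong)
  then show ?thesis
    using lie_algebra_sum[of Bs "\<lambda>b. mscale (a b) b" G] mem by blast
qed

section \<open>Left and right gradients\<close>

lemma grad_left_unique:
  assumes "A \<in> lie" "\<And>X. X \<in> lie \<Longrightarrow> \<kappa> A X = fun_deriv \<phi> h (X ** h)"
  shows "grad_left G \<kappa> \<phi> h = A"
  unfolding grad_left_def
proof (rule the_equality)
  fix B assume B: "B \<in> lie \<and> (\<forall>X\<in>lie. \<kappa> B X = fun_deriv \<phi> h (X ** h))"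
  then have "B - A = 0"
    using assms by (intro kappa_nondeg) (auto simp: lie_algebra_diff kappa_diff)
  then show "B = A" by simp
qed (use assms in blast)

lemma grad_right_unique:
  assumes "A \<in> lie" "\<And>X. X \<in> lie \<Longrightarrow> \<kappa> A X = fun_deriv \<phi> h (h ** X)"
  shows "grad_right G \<kappa> \<phi> h = A"
  unfolding grad_right_def
proof (rule the_equality)
  fix B assume B: "B \<in> lie \<and> (\<forall>X\<in>lie. \<kappa> B X = fun_deriv \<phi> h (h ** X))"
  then have "B - A = 0"
    using assms by (intro kappa_nondeg) (auto simp: lie_algebra_diff kappa_diff)
  then show "B = A" by simp
qed (use assms in blast)

lemma grad_left:
  assumes "\<phi> \<in> regular_functions" "h \<in> G"
  shows "grad_left G \<kappa> \<phi> h \<in> lie"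
    and "X \<in> lie \<Longrightarrow> \<kappa> (grad_left G \<kappa> \<phi> h) X = fun_deriv \<phi> h (X ** h)"
proof -
  obtain K where K: "dir_derivs \<phi> h K"
    using dir_derivs_regular assms invertible_G by blast
  have "\<exists>A\<in>lie. \<forall>X\<in>lie. \<kappa> A X = fun_deriv \<phi> h (X ** h)"
    by (rule kappa_represent)
      (simp add: fun_deriv_eq_frob[OF K] matrix_add_rdistrib mscale_matrix_mult_left frob_add_right frob_mscale_right)
  then obtain A where A: "A \<in> lie" "\<And>X. X \<in> lie \<Longrightarrow> \<kappa> A X = fun_deriv \<phi> h (X ** h)"
    by blast
  note e = grad_left_unique[OF A]
  show "grad_left G \<kappa> \<phi> h \<in> lie"
    and "X \<in> lie \<Longrightarrow> \<kappa> (grad_left G \<kappa> \<phi> h) X = fun_deriv \<phi> h (X ** h)"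
    by (simp_all add: e A)
qed

text \<open>Since h X = (Ad h X) h, the right gradient is the left one under the adjoint of Ad h,
  and by invariance of \<kappa> that adjoint is Ad of the inverse.\<close>

lemma grad_right:
  assumes "\<phi> \<in> regular_functions" "h \<in> G"
  shows "grad_right G \<kappa> \<phi> h = Ad (matrix_inv h) (grad_left G \<kappa> \<phi> h)"
proof (rule grad_right_unique)
  note gl = grad_left[OF assms]
  show "Ad (matrix_inv h) (grad_left G \<kappa> \<phi> h) \<in> lie"
    by (intro Ad_lie inv_G gl assms)
  fix X assume X: "X \<in> lie"
  then show "\<kappa> (Ad (matrix_inv h) (grad_left G \<kappa> \<phi> h)) X = fun_deriv \<phi> h (h ** X)"
    using gl(2)[OF Ad_lie[OF assms(2) X]]
    by (simp add: kappa_Ad_right[symmetric] gl(1) assms(2) Ad_mult)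
qed

lemma grad_left_surj:
  assumes "A \<in> lie" "h \<in> G"
  obtains \<phi> where "\<phi> \<in> regular_functions" "grad_left G \<kappa> \<phi> h = A"
proof -
  obtain K where K: "\<And>X. X \<in> lie \<Longrightarrow> \<kappa> A X = frob K X"
    using kappa_frob[OF assms(1)] by blast
  \<comment> \<open>Linear in \<open>M\<close> and equal to \<open>frob K X\<close> at M = X h, so
    its derivative along X h is \<kappa> A X.\<close>
  define \<phi> where "\<phi> M = frob K (M ** matrix_inv h)" for M :: "complex^'n^'n"
  have "polyfun \<phi>"
    unfolding \<phi>_def frob_def matrix_matrix_mult_def
    by (simp, intro polyfun_sum polyfun_mult polyfun_const polyfun_entry)
  then have "\<phi> \<in> regular_functions"
    by (rule polyfun_regular)
  moreover have "grad_left G \<kappa> \<phi> h = A"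
  proof (rule grad_left_unique[OF assms(1)])
    fix X assume X: "X \<in> lie"
    have "\<phi> (h + mscale t (X ** h)) = frob K (mat 1) + t * frob K X" for t
      by (simp add: \<phi>_def matrix_add_rdistrib mscale_matrix_mult_left frob_add_right frob_mscale_right
          matrix_inv_cancel matrix_inv_cancel_assoc invertible_G assms)
    then have "fun_deriv \<phi> h (X ** h) = deriv (\<lambda>t. frob K (mat 1) + t * frob K X) 0"
      by (simp add: fun_deriv_def)
    also have "\<dots> = frob K X"
      by (rule DERIV_imp_deriv) (auto intro!: derivative_eq_intros)
    finally show "\<kappa> A X = fun_deriv \<phi> h (X ** h)"
      by (simp add: K X)
  qed
  ultimately show ?thesis by (rule that)
qed

end

section \<open>Rational matrices and expansions at infinity\<close>

lemma mat_eval_nth [simp]: "mat_eval g z $ i $ j = rat_eval (g $ i $ j) z"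
  by (simp add: mat_eval_def)

lemma mat_poles_iff: "z \<in> mat_poles g \<longleftrightarrow> (\<exists>i j. is_pole_of (g $ i $ j) z)"
  by (simp add: mat_poles_def is_pole_of_def)

lemma finite_mat_poles: "finite (mat_poles (g :: complex poly fract^'n::finite^'m::finite))"
proof -
  have "mat_poles g = (\<Union>i. \<Union>j. {z. is_pole_of (g $ i $ j) z})"
    unfolding set_eq_iff mat_poles_iff by simp
  then show ?thesis
    using finite_poles by simp
qed

lemma mat_eval_add:
  fixes g h :: "complex poly fract^'n^'m"
  assumes "z \<notin> mat_poles g" "z \<notin> mat_poles h"
  shows "z \<notin> mat_poles (g + h)" "mat_eval (g + h) z = mat_eval g z + mat_eval h z"
  using assms by (auto simp: mat_poles_iff vec_eq_iff rat_eval_add)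

lemma mat_eval_diff:
  fixes g h :: "complex poly fract^'n^'m"
  assumes "z \<notin> mat_poles g" "z \<notin> mat_poles h"
  shows "z \<notin> mat_poles (g - h)" "mat_eval (g - h) z = mat_eval g z - mat_eval h z"
  using assms by (auto simp: mat_poles_iff vec_eq_iff rat_eval_diff)

lemma mat_eval_mult:
  fixes g h :: "complex poly fract^'n::finite^'n"
  assumes "z \<notin> mat_poles g" "z \<notin> mat_poles h"
  shows "z \<notin> mat_poles (g ** h)" "mat_eval (g ** h) z = mat_eval g z ** mat_eval h z"
proof -
  have np: "\<not> is_pole_of (g $ i $ k * h $ k $ j) z"
    "rat_eval (g $ i $ k * h $ k $ j) z = rat_eval (g $ i $ k) z * rat_eval (h $ k $ j) z" for i j k
    using assms by (auto simp: mat_poles_iff rat_eval_mult)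
  have "\<not> is_pole_of ((g ** h) $ i $ j) z \<and>
      rat_eval ((g ** h) $ i $ j) z = (\<Sum>k\<in>UNIV. rat_eval (g $ i $ k * h $ k $ j) z)" for i j
    using rat_eval_sum[of UNIV "\<lambda>k. g $ i $ k * h $ k $ j" z] np
    by (simp add: matrix_matrix_mult_def)
  then show "z \<notin> mat_poles (g ** h)" "mat_eval (g ** h) z = mat_eval g z ** mat_eval h z"
    unfolding vec_eq_iff by (auto simp: mat_poles_iff np matrix_matrix_mult_def)
qed

lemma mat_eval_mscale:
  fixes g :: "complex poly fract^'n^'m"
  assumes "\<not> is_pole_of r z" "z \<notin> mat_poles g"
  shows "z \<notin> mat_poles (mscale r g)" "mat_eval (mscale r g) z = mscale (rat_eval r z) (mat_eval g z)"
  using assms by (auto simp: mat_poles_iff vec_eq_iff rat_eval_mult)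

lemma mat_eval_0 [simp]: "mat_eval 0 z = 0" "z \<notin> mat_poles 0"
  by (simp_all add: vec_eq_iff mat_poles_iff)

lemma mat_eval_sum:
  fixes f :: "'i \<Rightarrow> complex poly fract^'n^'m"
  assumes "\<And>i. i \<in> I \<Longrightarrow> z \<notin> mat_poles (f i)"
  shows "z \<notin> mat_poles (\<Sum>i\<in>I. f i) \<and> mat_eval (\<Sum>i\<in>I. f i) z = (\<Sum>i\<in>I. mat_eval (f i) z)"
  using assms by (induction I rule: infinite_finite_induct) (auto simp: mat_eval_add)

definition const_mat :: "complex^'n^'m \<Rightarrow> complex poly fract^'n^'m" where
  "const_mat A = (\<chi> i j. rat_const (A $ i $ j))"

lemma mat_eval_const_mat [simp]: "mat_eval (const_mat A) z = A" "z \<notin> mat_poles (const_mat A)"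
  by (simp_all add: const_mat_def vec_eq_iff mat_poles_iff)

lemma mat_eqI_infinite:
  assumes "infinite S" "\<And>z. z \<in> S \<Longrightarrow> mat_eval g z = mat_eval h z"
  shows "g = h"
  unfolding vec_eq_iff
proof (intro allI)
  fix i j
  show "g $ i $ j = h $ i $ j"
    by (rule rat_eqI_infinite[OF assms(1)]) (use assms(2) in \<open>auto simp: vec_eq_iff\<close>)
qed

lemma eventually_not_in_finite: "finite S \<Longrightarrow> \<forall>\<^sub>F z in at (p::complex). z \<notin> S"
proof -
  assume "finite S"
  then have "\<forall>\<^sub>F z in nhds p. z \<in> - (S - {p})"
    by (intro eventually_nhds_in_open open_Compl finite_imp_closed) auto
  then show ?thesis
    unfolding eventually_at_filter by eventually_elim auto
qed

lemma eventually_at_infinity_not_in_finite: "finite S \<Longrightarrow> \<forall>\<^sub>F z in at_infinity. z \<notin> (S :: complex set)"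
proof -
  assume "finite S"
  then obtain B where B: "\<And>z. z \<in> S \<Longrightarrow> norm z \<le> B"
    using finite_imp_bounded bounded_iff by metis
  have "z \<notin> S" if "norm z \<ge> B + 1" for z
    using B[of z] that by auto
  then show ?thesis
    by (auto simp: eventually_at_infinity)
qed

lemma infinite_if_eventually_at_infinity:
  assumes "\<forall>\<^sub>F z in at_infinity. P (z :: complex)"
  shows "infinite {z. P z}"
proof
  assume "finite {z. P z}"
  from eventually_conj[OF assms eventually_at_infinity_not_in_finite[OF this]]
  have "\<forall>\<^sub>F z::complex in at_infinity. False"
    by (rule eventually_mono) auto
  then show False
    using trivial_limit_at_infinity[where 'a = complex] by (simp add: eventually_False)
qed

section \<open>Limits and analyticity of matrix-valued functions\<close>

lemma analytic_mat_eval: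
  assumes "p \<notin> mat_poles g"
  shows "(\<lambda>z. mat_eval g z $ i $ j) analytic_on {p}"
  using assms analytic_rat_eval by (simp add: mat_poles_iff)

lemma tendsto_mat_if_analytic:
  fixes X :: "complex \<Rightarrow> complex^'n::finite^'m::finite"
  assumes "\<And>i j. (\<lambda>z. X z $ i $ j) analytic_on {p}"
  shows "(X \<longlongrightarrow> X p) (at p)"
  using analytic_at_imp_isCont[OF assms] by (intro vec_tendstoI) (simp add: isCont_def)

lemma mat_limit_imp_not_pole:
  fixes g :: "complex poly fract^'n::finite^'m::finite"
  assumes "(mat_eval g \<longlongrightarrow> L) (at p)"
  shows "p \<notin> mat_poles g" "mat_eval g p = L"
proof -
  have l: "(rat_eval (g $ i $ j) \<longlongrightarrow> L $ i $ j) (at p)" for i j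
    using tendsto_vec_nth[OF tendsto_vec_nth[OF assms]] by simp
  show "p \<notin> mat_poles g" "mat_eval g p = L"
    using rat_limit_imp_not_pole[OF l] by (simp_all add: mat_poles_iff vec_eq_iff)
qed

lemma tendsto_matrix_mult [tendsto_intros]:
  fixes X Y :: "'b \<Rightarrow> complex^'n::finite^'n"
  assumes "(X \<longlongrightarrow> A) F" "(Y \<longlongrightarrow> B) F"
  shows "((\<lambda>z. X z ** Y z) \<longlongrightarrow> A ** B) F"
  unfolding matrix_matrix_mult_def by (intro vec_tendstoI) (simp, intro tendsto_intros assms)

lemma tendsto_frob:
  assumes "(X \<longlongrightarrow> A) F"
  shows "((\<lambda>z. frob K (X z)) \<longlongrightarrow> frob K A) F"
  unfolding frob_def by (intro tendsto_intros assms)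

text \<open>Serves to show that the inverse of an analytic matrix function is analytic.\<close>

lemma matrix_inv_cramer:
  fixes A :: "complex^'n::finite^'n"
  assumes "invertible A"
  shows "matrix_inv A $ k $ j = det (\<chi> i l. if l = k then axis j 1 $ i else A $ i $ l) / det A"
proof -
  have "A *v (matrix_inv A *v axis j 1) = axis j 1"
    by (simp add: matrix_vector_mul_assoc matrix_inv_cancel assms)
  then have "matrix_inv A *v axis j 1 = (\<chi> k. det (\<chi> i l. if l = k then axis j 1 $ i else A $ i $ l) / det A)"
    using assms by (subst (asm) cramer) (simp_all add: invertible_det_nz)
  then have "(matrix_inv A *v axis j 1) $ k = det (\<chi> i l. if l = k then axis j 1 $ i else A $ i $ l) / det A"
    by simp
  moreover have "(matrix_inv A *v axis j 1) $ k = matrix_inv A $ k $ j"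
    unfolding matrix_vector_mult_def axis_def by (simp add: if_distrib[of "(*) _"] cong: if_cong)
  ultimately show ?thesis
    by (rule trans[OF sym, rotated])
qed

lemma analytic_det:
  fixes M :: "complex \<Rightarrow> complex^'n::finite^'n"
  assumes "\<And>i j. (\<lambda>z. M z $ i $ j) analytic_on S"
  shows "(\<lambda>z. det (M z)) analytic_on S"
  unfolding det_def using assms by (intro analytic_intros)

lemma eventually_invertible:
  fixes M :: "complex \<Rightarrow> complex^'n::finite^'n"
  assumes "\<And>i j. (\<lambda>z. M z $ i $ j) analytic_on {p}" "invertible (M p)"
  shows "\<forall>\<^sub>F z in nhds p. invertible (M z)"
proof -
  have "isCont (\<lambda>z. det (M z)) p"
    by (intro analytic_at_imp_isCont analytic_det assms(1))
  then have "\<forall>\<^sub>F z in nhds p. det (M z) \<noteq> 0"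
    using tendsto_at_iff_tendsto_nhds[of "\<lambda>z. det (M z)" p] unfolding isCont_def
    by (intro tendsto_imp_eventually_ne[where c = "det (M p)"]) (use assms(2) in \<open>simp_all add: invertible_det_nz\<close>)
  then show ?thesis
    by (simp add: invertible_det_nz)
qed

lemma analytic_matrix_inv:
  fixes M :: "complex \<Rightarrow> complex^'n::finite^'n"
  assumes "\<And>i j. (\<lambda>z. M z $ i $ j) analytic_on {p}" "invertible (M p)"
  shows "(\<lambda>z. matrix_inv (M z) $ i $ j) analytic_on {p}"
proof -
  have "(\<lambda>z. (\<chi> k l. if l = i then axis j 1 $ k else M z $ k $ l) $ a $ b) analytic_on {p}" for a b
    using assms(1) by (cases "b = i") (simp_all add: analytic_on_const)
  then have "(\<lambda>z. det (\<chi> k l. if l = i then axis j 1 $ k else M z $ k $ l) / det (M z)) analytic_on {p}"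
    using assms by (intro analytic_on_divide analytic_det) (auto simp: invertible_det_nz)
  moreover have "\<forall>\<^sub>F z in nhds p. det (\<chi> k l. if l = i then axis j 1 $ k else M z $ k $ l) / det (M z)
      = matrix_inv (M z) $ i $ j"
    using eventually_invertible[OF assms] by eventually_elim (simp add: matrix_inv_cramer)
  from analytic_at_cong[OF this refl] calculation show ?thesis
    by simp
qed

lemma analytic_matrix_mult:
  fixes X Y :: "complex \<Rightarrow> complex^'n::finite^'n"
  assumes "\<And>i j. (\<lambda>z. X z $ i $ j) analytic_on S" "\<And>i j. (\<lambda>z. Y z $ i $ j) analytic_on S"
  shows "(\<lambda>z. (X z ** Y z) $ i $ j) analytic_on S"
  unfolding matrix_matrix_mult_def using assms by simp (intro analytic_intros)

section \<open>Expansions at infinity\<close>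

lemma tendsto_at_infinity_inverse:
  assumes "(f \<longlongrightarrow> l) (at_infinity :: complex filter)"
  shows "((\<lambda>w. f (1 / w)) \<longlongrightarrow> l) (at 0)"
proof -
  have "filterlim (\<lambda>w::complex. 1 / w) at_infinity (at 0)"
    using filterlim_inverse_at_infinity[where 'a = complex]
    by (simp add: inverse_eq_divide[abs_def])
  then show ?thesis
    using assms filterlim_compose by blast
qed

text \<open>The poles of \<open>r\<close> are bounded by some B, so r(1/w) is holomorphic for 0 <
  |w| < 1/B, and the finite limit removes the singularity at 0.\<close>

lemma analytic_at_infinity:
  assumes "(rat_eval r \<longlongrightarrow> l) at_infinity"
  shows "(\<lambda>w. if w = 0 then l else rat_eval r (1 / w)) analytic_on {0}" (is "?F analytic_on _")
proof -
  obtain B where B: "B > 0" "\<And>z. is_pole_of r z \<Longrightarrow> norm z \<le> B"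
    using finite_imp_bounded[OF finite_poles[of r]] by (auto simp: bounded_pos)
  define S where "S = ball (0::complex) (1 / B)"
  have "?F holomorphic_on S"
  proof (rule no_isolated_singularity'[where K = "{0}"])
    fix z :: complex assume "z \<in> {0}"
    moreover have "(?F \<longlongrightarrow> l) (at 0)"
      using tendsto_at_infinity_inverse[OF assms]
      by (rule Lim_transform_eventually) (simp add: eventually_at_filter)
    ultimately show "(?F \<longlongrightarrow> ?F z) (at z within S)"
      by (auto intro: tendsto_within_subset)
  next
    have "(rat_eval r \<circ> (\<lambda>w. 1 / w)) analytic_on (S - {0})"
    proof (rule analytic_on_compose)
      show "(\<lambda>w. 1 / w) analytic_on (S - {0})"
        by (intro analytic_intros) auto
      have "\<not> is_pole_of r (1 / w)" if "w \<in> S - {0}" for w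
      proof -
        have "norm (1 / w) > B"
          using that B(1) by (simp add: S_def norm_divide field_simps)
        then show ?thesis
          using B(2)[of "1 / w"] by auto
      qed
      then show "rat_eval r analytic_on (\<lambda>w. 1 / w) ` (S - {0})"
        using analytic_rat_eval by (subst analytic_on_analytic_at) blast
    qed
    then have "(\<lambda>w. rat_eval r (1 / w)) holomorphic_on (S - {0})"
      by (simp add: o_def analytic_imp_holomorphic)
    then show "?F holomorphic_on S - {0}"
      by (rule holomorphic_transform) auto
  qed (simp_all add: S_def)
  then show ?thesis
    unfolding analytic_at using B(1) by (intro exI[of _ S]) (auto simp: S_def)
qed

text \<open>The finite limit makes the Laurent expansion at w = 0 a power series, so
  \<open>fls_regpart\<close> in \<open>r_infinity\<close> discards nothing.\<close>

lemma infinity_expansion: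
  assumes "(rat_eval r \<longlongrightarrow> l) at_infinity"
  shows "(\<lambda>w. if w = 0 then l else rat_eval r (1 / w)) has_fps_expansion
    fls_regpart (laurent_expansion (\<lambda>w. rat_eval r (1 / w)) 0)"
proof -
  obtain P where P: "(\<lambda>w. if w = 0 then l else rat_eval r (1 / w)) has_fps_expansion P"
    using analytic_at_imp_has_fps_expansion_0[OF analytic_at_infinity[OF assms]] by blast
  have "(\<lambda>w. rat_eval r (1 / w)) has_laurent_expansion fps_to_fls P
    \<longleftrightarrow> (\<lambda>w. if w = 0 then l else rat_eval r (1 / w)) has_laurent_expansion fps_to_fls P"
    by (rule has_laurent_expansion_cong) (simp_all add: eventually_at_filter)
  then have "(\<lambda>w. rat_eval r (1 / w)) has_laurent_expansion fps_to_fls P"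
    using has_laurent_expansion_fps[OF P] by simp
  then have "laurent_expansion (\<lambda>w. rat_eval r (1 / w)) 0 = fps_to_fls P"
    by (rule laurent_expansion_0_eqI)
  then show ?thesis
    using P by simp
qed

lemma has_fps_expansion_unique:
  fixes f :: "complex \<Rightarrow> complex"
  assumes "f has_fps_expansion P" "f has_fps_expansion Q"
  shows "P = Q"
proof -
  have "fps_to_fls P = fps_to_fls Q"
    by (rule has_laurent_expansion_unique[OF assms[THEN has_laurent_expansion_fps]])
  then show ?thesis
    by (metis fls_regpart_fps_trivial)
qed

text \<open>Turns identities that hold near 0 into identities of power series.\<close>

lemma has_fps_expansion_const_unique:
  fixes f :: "complex \<Rightarrow> complex"
  assumes "f has_fps_expansion P" "\<forall>\<^sub>F w in nhds 0. f w = c"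
  shows "P = fps_const c"
proof -
  have "(\<lambda>w. c) has_fps_expansion P \<longleftrightarrow> f has_fps_expansion P"
    by (rule has_fps_expansion_cong) (use assms(2) in \<open>auto elim: eventually_mono\<close>)
  then show ?thesis
    using has_fps_expansion_unique assms(1) has_fps_expansion_const by blast
qed

lemma has_fps_expansion_pexpr:
  fixes M :: "complex \<Rightarrow> complex^'n::finite^'n" and A :: "complex fps^'n^'n"
  assumes "\<And>i j. (\<lambda>w. M w $ i $ j) has_fps_expansion A $ i $ j"
  shows "(\<lambda>w. pexpr_val id p (M w)) has_fps_expansion pexpr_val fps_const p A"
  by (induction p) (auto intro: assms fps_expansion_intros)

context invariant_group
begin

text \<open>The equations of \<open>G\<close>, and those between a matrix and its inverse, hold for
  the functions near 0 and hence for their expansions. The inverse has an expansion because it is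
  analytic.\<close>

lemma expansion_in_G_series:
  fixes M :: "complex \<Rightarrow> complex^'n^'n" and A :: "complex fps^'n^'n"
  assumes M: "\<And>i j. (\<lambda>w. M w $ i $ j) has_fps_expansion A $ i $ j"
    and ev: "\<forall>\<^sub>F w in nhds 0. M w \<in> G"
  shows "A \<in> G_series G"
proof -
  have "M 0 \<in> G"
    using eventually_nhds_x_imp_x[OF ev] .
  then have "(\<lambda>w. matrix_inv (M w) $ i $ j) analytic_on {0}" for i j
    by (intro analytic_matrix_inv has_fps_expansion_imp_analytic_0[OF M] invertible_G)
  then have "\<exists>P. (\<lambda>w. matrix_inv (M w) $ i $ j) has_fps_expansion P" for i j
    using analytic_at_imp_has_fps_expansion_0 by blast
  then obtain Q where Q: "\<And>i j. (\<lambda>w. matrix_inv (M w) $ i $ j) has_fps_expansion Q i j"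
    by metis
  define B where "B = (\<chi> i j. Q i j)"
  have const: "fps_const (mat 1 $ i $ j) = mat 1 $ i $ j" for i j :: 'n
    by (simp add: mat_def)
  have "(A ** B) $ i $ j = fps_const ((mat 1 :: complex^'n^'n) $ i $ j)" for i j
  proof (rule has_fps_expansion_const_unique)
    show "(\<lambda>w. \<Sum>k\<in>UNIV. M w $ i $ k * matrix_inv (M w) $ k $ j) has_fps_expansion (A ** B) $ i $ j"
      unfolding matrix_matrix_mult_def B_def by (simp, intro fps_expansion_intros M Q)
    show "\<forall>\<^sub>F w in nhds 0. (\<Sum>k\<in>UNIV. M w $ i $ k * matrix_inv (M w) $ k $ j) = mat 1 $ i $ j"
      using ev
    proof eventually_elim
      case (elim w)
      have "(M w ** matrix_inv (M w)) $ i $ j = mat 1 $ i $ j"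
        using matrix_inv_cancel[OF invertible_G[OF elim]] by simp
      then show ?case by (simp add: matrix_matrix_mult_def)
    qed
  qed
  moreover have "(B ** A) $ i $ j = fps_const ((mat 1 :: complex^'n^'n) $ i $ j)" for i j
  proof (rule has_fps_expansion_const_unique)
    show "(\<lambda>w. \<Sum>k\<in>UNIV. matrix_inv (M w) $ i $ k * M w $ k $ j) has_fps_expansion (B ** A) $ i $ j"
      unfolding matrix_matrix_mult_def B_def by (simp, intro fps_expansion_intros M Q)
    show "\<forall>\<^sub>F w in nhds 0. (\<Sum>k\<in>UNIV. matrix_inv (M w) $ i $ k * M w $ k $ j) = mat 1 $ i $ j"
      using ev
    proof eventually_elim
      case (elim w)
      have "(matrix_inv (M w) ** M w) $ i $ j = mat 1 $ i $ j"
        using matrix_inv_cancel[OF invertible_G[OF elim]] by simp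
      then show ?case by (simp add: matrix_matrix_mult_def)
    qed
  qed
  ultimately have "A ** B = mat 1" "B ** A = mat 1"
    by (simp_all add: vec_eq_iff const)
  then have "invertible A"
    by (auto simp: invertible_def)
  moreover have "pexpr_val fps_const p A = 0" if p: "\<forall>N\<in>G. pexpr_val id p N = 0" for p
  proof -
    have "pexpr_val fps_const p A = fps_const 0"
    proof (rule has_fps_expansion_const_unique)
      show "(\<lambda>w. pexpr_val id p (M w)) has_fps_expansion pexpr_val fps_const p A"
        by (rule has_fps_expansion_pexpr[OF M])
      show "\<forall>\<^sub>F w in nhds 0. pexpr_val id p (M w) = 0"
        using ev by eventually_elim (use p in auto)
    qed
    then show ?thesis by simp
  qed
  ultimately show ?thesis
    by (simp add: G_series_def)
qed

end

lemma r_infinity_nth: "r_infinity g $ i $ j = fls_regpart (laurent_expansion (\<lambda>w. rat_eval (g $ i $ j) (1 / w)) 0)"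
  by (simp add: r_infinity_def)

text \<open>Both expansions converge, so equal series give equal values near infinity, which are
  infinitely many coincidences of rational functions.\<close>

lemma r_infinity_eq_imp_eq:
  fixes g h :: "complex poly fract^'n::finite^'n"
  assumes g: "(mat_eval g \<longlongrightarrow> A) at_infinity" and h: "(mat_eval h \<longlongrightarrow> A) at_infinity"
    and eq: "r_infinity g = r_infinity h"
  shows "g = h"
  unfolding vec_eq_iff
proof (intro allI)
  fix i j
  define P where "P = r_infinity g $ i $ j"
  have lim: "(rat_eval (g $ i $ j) \<longlongrightarrow> A $ i $ j) at_infinity" "(rat_eval (h $ i $ j) \<longlongrightarrow> A $ i $ j) at_infinity"
    using tendsto_vec_nth[OF tendsto_vec_nth[OF g]] tendsto_vec_nth[OF tendsto_vec_nth[OF h]] by simp_all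
  have "P = r_infinity h $ i $ j"
    by (simp add: P_def eq)
  then have "(\<lambda>w. if w = 0 then A $ i $ j else rat_eval (g $ i $ j) (1 / w)) has_fps_expansion P"
    "(\<lambda>w. if w = 0 then A $ i $ j else rat_eval (h $ i $ j) (1 / w)) has_fps_expansion P"
    using infinity_expansion[OF lim(1)] infinity_expansion[OF lim(2)]
    unfolding P_def r_infinity_nth by simp_all
  then have "\<forall>\<^sub>F w in nhds 0. eval_fps P w = (if w = 0 then A $ i $ j else rat_eval (g $ i $ j) (1 / w))"
    "\<forall>\<^sub>F w in nhds 0. eval_fps P w = (if w = 0 then A $ i $ j else rat_eval (h $ i $ j) (1 / w))"
    by (simp_all add: has_fps_expansion_def)
  then have "\<forall>\<^sub>F w in at 0. rat_eval (g $ i $ j) (1 / w) = rat_eval (h $ i $ j) (1 / w)"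
    unfolding eventually_at_filter by eventually_elim auto
  then have "\<forall>\<^sub>F z in at_infinity. rat_eval (g $ i $ j) z = rat_eval (h $ i $ j) z"
    by (simp add: at_to_infinity eventually_filtermap inverse_eq_divide)
  then show "g $ i $ j = h $ i $ j"
    by (intro rat_eqI_infinite[OF infinite_if_eventually_at_infinity]) auto
qed

section \<open>Hamiltonian vectors and tangent vectors\<close>

text \<open>The denominator is p - z, not z - p, to match the kernel 1 / (u - z); hence the sign in
  the witness.\<close>

lemma analytic_difference_quotient:
  fixes f :: "complex \<Rightarrow> complex"
  assumes "f analytic_on {p}"
  obtains F where "F analytic_on {p}" "\<And>z. z \<noteq> p \<Longrightarrow> F z = (f z - f p) / (p - z)"
proof
  have "(\<lambda>z. if z = p then deriv f p else f z / (z - p) - f p / (z - p)) analytic_on {p}"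
    by (rule pole_theorem_analytic[OF assms]) (auto intro!: exI[of _ 1])
  then show "(\<lambda>z. - (if z = p then deriv f p else f z / (z - p) - f p / (z - p))) analytic_on {p}"
    by (rule analytic_on_neg)
  show "- (if z = p then deriv f p else f z / (z - p) - f p / (z - p)) = (f z - f p) / (p - z)"
    if "z \<noteq> p" for z
    using that by (simp add: divide_simps) (simp add: algebra_simps)
qed

text \<open>The Sklyanin kernel 1 / (u - v) with its second variable left free:
  \<open>[:u, -1:]\<close> is u - z.\<close>

definition kernel_fract :: "complex \<Rightarrow> complex poly fract" where
  "kernel_fract u = Fract 1 [:u, -1:]"

lemma rat_eval_kernel:
  assumes "z \<noteq> u"
  shows "\<not> is_pole_of (kernel_fract u) z" "rat_eval (kernel_fract u) z = 1 / (u - z)"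
  using rat_eval_Fract[of "[:u, -1:]" z 1] assms by (simp_all add: kernel_fract_def)

lemma lie_germ_comb:
  assumes "lie_germ G X p" "lie_germ G Y p"
  shows "lie_germ G (\<lambda>z. X z + mscale c (Y z)) p"
proof -
  have "(\<lambda>z. (X z + mscale c (Y z)) $ i $ j) analytic_on {p}" for i j
    using assms by (simp add: lie_germ_def analytic_intros)
  moreover have "\<forall>\<^sub>F z in nhds p. X z + mscale c (Y z) \<in> lie_algebra G"
  proof -
    have "\<forall>\<^sub>F z in nhds p. X z \<in> lie_algebra G" "\<forall>\<^sub>F z in nhds p. Y z \<in> lie_algebra G"
      using assms by (auto simp: lie_germ_def)
    then show ?thesis
      by eventually_elim (intro lie_algebra_add lie_algebra_mscale)
  qed
  ultimately show ?thesis by (simp add: lie_germ_def)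
qed

lemma lie_germ_sum:
  fixes c :: "'i \<Rightarrow> complex \<Rightarrow> complex"
  assumes "\<And>i. i \<in> I \<Longrightarrow> c i analytic_on {p}" "\<And>i. i \<in> I \<Longrightarrow> A i \<in> lie_algebra G"
  shows "lie_germ G (\<lambda>z. \<Sum>i\<in>I. mscale (c i z) (A i)) p"
proof -
  have "(\<lambda>z. (\<Sum>i\<in>I. mscale (c i z) (A i)) $ a $ b) analytic_on {p}" for a b
    using assms(1) by (simp add: sum_component) (intro analytic_intros)
  moreover have "(\<Sum>i\<in>I. mscale (c i z) (A i)) \<in> lie_algebra G" for z
    by (intro lie_algebra_sum lie_algebra_mscale assms)
  ultimately show ?thesis by (simp add: lie_germ_def)
qed

lemma lie_germ_tendsto: "lie_germ G X p \<Longrightarrow> (X \<longlongrightarrow> X p) (at p)"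
  by (rule tendsto_mat_if_analytic) (simp add: lie_germ_def)

lemma lie_germ_value: "lie_germ G X p \<Longrightarrow> X p \<in> lie_algebra G"
  unfolding lie_germ_def by (blast dest: eventually_nhds_x_imp_x)

locale framed_map = invariant_group G \<kappa>
  for G :: "(complex^'n::finite^'n) set"
    and \<kappa> :: "complex^'n^'n \<Rightarrow> complex^'n^'n \<Rightarrow> complex" +
  fixes g :: "complex poly fract^'n^'n"
  assumes g_rational: "g \<in> G1_rational G"
begin

abbreviation reg :: "complex \<Rightarrow> bool" where "reg \<equiv> regular_at G g"
abbreviation gv :: "complex \<Rightarrow> complex^'n^'n" where "gv \<equiv> mat_eval g"
abbreviation gi :: "complex \<Rightarrow> complex^'n^'n" where "gi z \<equiv> matrix_inv (mat_eval g z)"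
text \<open>In the final theorem the same letter names the maximal torus.\<close>

abbreviation T :: "(complex poly fract^'n^'n) set" where "T \<equiv> tangent_mHiggs G g"

lemma finite_not_reg: "finite {z. \<not> reg z}"
  and g_lim: "(gv \<longlongrightarrow> mat 1) at_infinity"
  using g_rational by (auto simp: G1_rational_def)

lemma reg_G: "reg z \<Longrightarrow> gv z \<in> G"
  and reg_not_pole: "reg z \<Longrightarrow> z \<notin> mat_poles g"
  by (auto simp: regular_at_def)

lemma reg_inv: "reg z \<Longrightarrow> invertible (gv z)"
  using reg_G invertible_G by blast

lemma eventually_reg: "\<forall>\<^sub>F z in at p. reg z"
  using eventually_not_in_finite[OF finite_not_reg, of p] by simp

lemma eventually_reg_at_infinity: "\<forall>\<^sub>F z in at_infinity. reg z"
  using eventually_at_infinity_not_in_finite[OF finite_not_reg] by simp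

lemma eventually_reg_nhds:
  assumes "reg p"
  shows "\<forall>\<^sub>F z in nhds p. reg z"
  using eventually_reg[of p] assms unfolding eventually_at_filter
  by (auto elim!: eventually_mono)

text \<open>Encodes the covector that sends \<delta> to the sum over \<open>W\<close> of
  \<kappa>(\<alpha> u, \<delta>(u) g(u)^-1). Values of \<alpha> off \<open>W\<close> carry no
  meaning.\<close>

definition cotangent :: "complex set \<Rightarrow> (complex \<Rightarrow> complex^'n^'n) \<Rightarrow> bool" where
  "cotangent W \<alpha> \<longleftrightarrow> finite W \<and> (\<forall>u\<in>W. reg u \<and> \<alpha> u \<in> lie)"

abbreviation right :: "(complex \<Rightarrow> complex^'n^'n) \<Rightarrow> complex \<Rightarrow> complex^'n^'n" where
  "right \<alpha> u \<equiv> Ad (gi u) (\<alpha> u)"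

lemma cotangentD:
  assumes "cotangent W \<alpha>" "u \<in> W"
  shows "reg u" "\<alpha> u \<in> lie" "right \<alpha> u \<in> lie"
  using assms by (auto simp: cotangent_def intro: Ad_lie inv_G reg_G)

definition ham :: "complex set \<Rightarrow> (complex \<Rightarrow> complex^'n^'n) \<Rightarrow> complex poly fract^'n^'n" where
  "ham W \<alpha> = (\<Sum>u\<in>W. mscale (kernel_fract u)
     (const_mat (\<alpha> u) ** g - g ** const_mat (right \<alpha> u)))"

lemma ham_eval:
  assumes "z \<notin> mat_poles g" "z \<notin> W"
  shows "z \<notin> mat_poles (ham W \<alpha>)"
    and "mat_eval (ham W \<alpha>) z = (\<Sum>u\<in>W. mscale (1 / (u - z)) (\<alpha> u ** gv z - gv z ** right \<alpha> u))"
proof -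
  define N where "N u = const_mat (\<alpha> u) ** g - g ** const_mat (right \<alpha> u)" for u
  have N: "z \<notin> mat_poles (N u)" "mat_eval (N u) z = \<alpha> u ** gv z - gv z ** right \<alpha> u" for u
    using assms(1) by (simp_all add: N_def mat_eval_diff mat_eval_mult)
  have K: "\<not> is_pole_of (kernel_fract u) z" "rat_eval (kernel_fract u) z = 1 / (u - z)" if "u \<in> W" for u
    using rat_eval_kernel[of z u] that assms(2) by auto
  have S: "z \<notin> mat_poles (mscale (kernel_fract u) (N u))"
    "mat_eval (mscale (kernel_fract u) (N u)) z = mscale (1 / (u - z)) (\<alpha> u ** gv z - gv z ** right \<alpha> u)"
    if "u \<in> W" for u
    using mat_eval_mscale[OF K(1)[OF that] N(1)] by (simp_all add: N(2) K(2)[OF that])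
  have "z \<notin> mat_poles (ham W \<alpha>) \<and>
      mat_eval (ham W \<alpha>) z = (\<Sum>u\<in>W. mat_eval (mscale (kernel_fract u) (N u)) z)"
    unfolding ham_def N_def[symmetric] by (rule mat_eval_sum) (rule S(1))
  then show "z \<notin> mat_poles (ham W \<alpha>)"
    and "mat_eval (ham W \<alpha>) z = (\<Sum>u\<in>W. mscale (1 / (u - z)) (\<alpha> u ** gv z - gv z ** right \<alpha> u))"
    using S(2) by auto
qed

lemma ham_eval_left:
  assumes "reg z" "z \<notin> W"
  shows "mat_eval (ham W \<alpha>) z ** gi z = (\<Sum>u\<in>W. mscale (1 / (u - z)) (\<alpha> u - Ad (gv z) (right \<alpha> u)))"
  unfolding ham_eval(2)[OF reg_not_pole[OF assms(1)] assms(2)]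
  by (simp add: matrix_sum_rdistrib mscale_matrix_mult_left matrix_diff_rdistrib
      matrix_inv_cancel_assoc reg_inv assms(1) Ad_def)

lemma eval_left_mult: "reg z \<Longrightarrow> X ** gi z ** gv z = (X :: complex^'n^'n)"
  by (simp add: matrix_inv_cancel_assoc reg_inv)

lemma ham_eval_left_lie:
  assumes "cotangent W \<alpha>" "reg z" "z \<notin> W"
  shows "mat_eval (ham W \<alpha>) z ** gi z \<in> lie"
  unfolding ham_eval_left[OF assms(2,3)]
  by (intro lie_algebra_sum lie_algebra_mscale lie_algebra_diff Ad_lie reg_G assms cotangentD(2,3)[OF assms(1)])

lemma finite_cotangent: "cotangent W \<alpha> \<Longrightarrow> finite W"
  by (simp add: cotangent_def)

lemma analytic_gv: "reg p \<Longrightarrow> (\<lambda>z. gv z $ i $ j) analytic_on {p}"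
  by (intro analytic_mat_eval reg_not_pole)

lemma analytic_gi: "reg p \<Longrightarrow> (\<lambda>z. gi z $ i $ j) analytic_on {p}"
  by (intro analytic_matrix_inv analytic_gv reg_inv)

lemma ham_not_pole:
  assumes c: "cotangent W \<alpha>" and p: "reg p"
  shows "p \<notin> mat_poles (ham W \<alpha>)"
proof (cases "p \<in> W")
  case False
  then show ?thesis
    using ham_eval(1) reg_not_pole p by blast
next
  case True
  define N where "N u z = \<alpha> u ** gv z - gv z ** right \<alpha> u" for u z
  have N: "(\<lambda>z. N u z $ i $ j) analytic_on {p}" for u i j
    using analytic_matrix_mult[OF analytic_on_const analytic_gv[OF p], of "\<alpha> u"]
      analytic_matrix_mult[OF analytic_gv[OF p] analytic_on_const, of "right \<alpha> u"]
    by (simp add: N_def analytic_on_diff)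
  have N0: "N p p = 0"
    by (simp add: N_def mult_Ad_inv reg_G p)
  have "\<exists>F. F analytic_on {p} \<and> (\<forall>z. z \<noteq> p \<longrightarrow> F z = N p z $ i $ j / (p - z))" for i j
  proof -
    obtain F where "F analytic_on {p}"
      "\<And>z. z \<noteq> p \<Longrightarrow> F z = (N p z $ i $ j - N p p $ i $ j) / (p - z)"
      using analytic_difference_quotient[OF N] by blast
    then show ?thesis
      by (intro exI[of _ F]) (simp add: N0)
  qed
  then have "\<forall>i j. \<exists>F. F analytic_on {p} \<and> (\<forall>z. z \<noteq> p \<longrightarrow> F z = N p z $ i $ j / (p - z))"
    by blast
  then obtain F where F: "\<And>i j. F i j analytic_on {p}"
      "\<And>i j z. z \<noteq> p \<Longrightarrow> F i j z = N p z $ i $ j / (p - z)"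
    unfolding choice_iff by blast
  \<comment> \<open>Only the summand at \<open>p\<close> is singular. \<open>F\<close> continues it
    analytically; its value at \<open>p\<close>, which involves the derivative of g, is never
    computed.\<close>
  define Y where "Y z = (\<chi> i j. F i j z) + (\<Sum>u\<in>W - {p}. mscale (1 / (u - z)) (N u z))" for z
  have "(\<lambda>z. (\<Sum>u\<in>W - {p}. mscale (1 / (u - z)) (N u z)) $ i $ j) analytic_on {p}" for i j
    unfolding sum_component mscale_simps by (intro analytic_intros N) auto
  then have "(\<lambda>z. Y z $ i $ j) analytic_on {p}" for i j
    unfolding Y_def vector_add_component by (intro analytic_intros) (simp_all add: F)
  then have "(Y \<longlongrightarrow> Y p) (at p)"
    by (rule tendsto_mat_if_analytic)
  moreover have "\<forall>\<^sub>F z in at p. Y z = mat_eval (ham W \<alpha>) z"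
    using eventually_reg[of p] eventually_not_in_finite[OF finite_cotangent[OF c], of p]
  proof eventually_elim
    case (elim z)
    then have "z \<noteq> p" using True by auto
    then have "(\<chi> i j. F i j z) = mscale (1 / (p - z)) (N p z)"
      by (simp add: vec_eq_iff F)
    moreover have "mat_eval (ham W \<alpha>) z = (\<Sum>u\<in>W. mscale (1 / (u - z)) (N u z))"
      using ham_eval(2) elim reg_not_pole by (simp add: N_def)
    ultimately show ?case
      unfolding Y_def using True finite_cotangent[OF c] by (simp add: sum.remove)
  qed
  ultimately have "(mat_eval (ham W \<alpha>) \<longlongrightarrow> Y p) (at p)"
    by (rule Lim_transform_eventually)
  then show ?thesis
    by (rule mat_limit_imp_not_pole)
qed

lemma ham_lie_germ:
  assumes c: "cotangent W \<alpha>" and p: "reg p"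
  shows "lie_germ G (\<lambda>z. mat_eval (ham W \<alpha>) z ** gi z) p"
proof -
  have an: "(\<lambda>z. (mat_eval (ham W \<alpha>) z ** gi z) $ i $ j) analytic_on {q}" if "reg q" for q i j
    by (intro analytic_matrix_mult analytic_mat_eval ham_not_pole c that analytic_gi)
  have "mat_eval (ham W \<alpha>) q ** gi q \<in> lie" if q: "reg q" for q
  proof (rule Lim_in_closed_set[OF closed_lie_algebra])
    show "((\<lambda>z. mat_eval (ham W \<alpha>) z ** gi z) \<longlongrightarrow> mat_eval (ham W \<alpha>) q ** gi q) (at q)"
      by (rule tendsto_mat_if_analytic[OF an[OF q]])
    show "\<forall>\<^sub>F z in at q. mat_eval (ham W \<alpha>) z ** gi z \<in> lie"
      using eventually_reg[of q] eventually_not_in_finite[OF finite_cotangent[OF c], of q]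
      by eventually_elim (rule ham_eval_left_lie[OF c])
  qed simp
  then have "\<forall>\<^sub>F z in nhds p. mat_eval (ham W \<alpha>) z ** gi z \<in> lie"
    using eventually_reg_nhds[OF p] by (rule eventually_mono[rotated])
  then show ?thesis
    using an[OF p] by (simp add: lie_germ_def)
qed

lemma ham_in_T:
  assumes c: "cotangent W \<alpha>"
  shows "ham W \<alpha> \<in> T"
  unfolding tangent_mHiggs_def
proof (intro CollectI conjI allI)
  have split: "(\<Sum>u\<in>W. mscale (1 / (u - z)) (\<alpha> u ** gv z - gv z ** right \<alpha> u)) =
      (\<Sum>u\<in>W. mscale (1 / (u - z)) (\<alpha> u)) ** gv z + gv z ** (\<Sum>u\<in>W. mscale (- 1 / (u - z)) (right \<alpha> u))"
    for z
    by (simp add: matrix_sum_rdistrib matrix_sum_ldistrib mscale_matrix_mult_left mscale_matrix_mult_right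
        mscale_diff sum_subtractf sum_negf matrix_mult_uminus)
  fix p
  show "\<exists>XL XR. lie_germ G XL p \<and> lie_germ G XR p \<and>
      (\<forall>\<^sub>F z in at p. mat_eval (ham W \<alpha>) z = XL z ** gv z + gv z ** XR z)"
  proof (cases "p \<in> W")
    case True
    then have p: "reg p"
      using cotangentD c by blast
    \<comment> \<open>The kernel sums have a pole at \<open>p\<close>, but g is regular there, so
      the whole variation can be put into X^L, with X^R = 0.\<close>
    have "\<forall>\<^sub>F z in at p. mat_eval (ham W \<alpha>) z = mat_eval (ham W \<alpha>) z ** gi z ** gv z + gv z ** 0"
      using eventually_reg[of p] by eventually_elim (simp add: eval_left_mult)
    moreover have "lie_germ G (\<lambda>z. 0) p"
      by (simp add: lie_germ_def)
    ultimately show ?thesis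
      using ham_lie_germ[OF c p] by blast
  next
    case False
    have "lie_germ G (\<lambda>z. \<Sum>u\<in>W. mscale (1 / (u - z)) (\<alpha> u)) p"
      "lie_germ G (\<lambda>z. \<Sum>u\<in>W. mscale (- 1 / (u - z)) (right \<alpha> u)) p"
      using False by (intro lie_germ_sum analytic_intros cotangentD[OF c]; auto)+
    moreover have "\<forall>\<^sub>F z in at p. mat_eval (ham W \<alpha>) z =
        (\<Sum>u\<in>W. mscale (1 / (u - z)) (\<alpha> u)) ** gv z + gv z ** (\<Sum>u\<in>W. mscale (- 1 / (u - z)) (right \<alpha> u))"
      using eventually_reg[of p] eventually_not_in_finite[OF finite_cotangent[OF c], of p]
      by eventually_elim (simp only: split[symmetric] ham_eval(2) reg_not_pole not_False_eq_True)
    ultimately show ?thesis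
      by blast
  qed
next
  \<comment> \<open>With z = 1/w the kernel 1 / (u - z) becomes w / (u w - 1), which is analytic at
    w = 0 and vanishes there, as the framing demands.\<close>
  have split: "(\<Sum>u\<in>W. mscale (w / (u * w - 1)) (\<alpha> u ** M - M ** right \<alpha> u)) =
      (\<Sum>u\<in>W. mscale (w / (u * w - 1)) (\<alpha> u)) ** M + M ** (\<Sum>u\<in>W. mscale (- w / (u * w - 1)) (right \<alpha> u))"
    for w M
    by (simp add: matrix_sum_rdistrib matrix_sum_ldistrib mscale_matrix_mult_left mscale_matrix_mult_right
        mscale_diff sum_subtractf sum_negf matrix_mult_uminus)
  have "lie_germ G (\<lambda>w. \<Sum>u\<in>W. mscale (w / (u * w - 1)) (\<alpha> u)) 0"
    "lie_germ G (\<lambda>w. \<Sum>u\<in>W. mscale (- w / (u * w - 1)) (right \<alpha> u)) 0"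
    by (intro lie_germ_sum analytic_intros cotangentD[OF c]; auto)+
  moreover have "\<forall>\<^sub>F w in at 0. mat_eval (ham W \<alpha>) (1 / w) =
      (\<Sum>u\<in>W. mscale (w / (u * w - 1)) (\<alpha> u)) ** gv (1 / w) +
      gv (1 / w) ** (\<Sum>u\<in>W. mscale (- w / (u * w - 1)) (right \<alpha> u))"
  proof -
    have "\<forall>\<^sub>F z in at_infinity. reg z \<and> z \<notin> W"
      by (intro eventually_conj eventually_reg_at_infinity
          eventually_at_infinity_not_in_finite finite_cotangent[OF c])
    then have "\<forall>\<^sub>F w in at 0. reg (1 / w) \<and> 1 / w \<notin> W"
      by (simp add: at_to_infinity eventually_filtermap inverse_eq_divide)
    moreover have "\<forall>\<^sub>F w in at 0. w \<noteq> (0::complex)"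
      by (simp add: eventually_at_filter)
    ultimately show ?thesis
    proof eventually_elim
      case (elim w)
      then have "1 / (u - 1 / w) = w / (u * w - 1)" for u
        by (simp add: field_simps)
      then have "mat_eval (ham W \<alpha>) (1 / w) =
          (\<Sum>u\<in>W. mscale (w / (u * w - 1)) (\<alpha> u ** gv (1 / w) - gv (1 / w) ** right \<alpha> u))"
        using elim ham_eval(2)[of "1 / w" W \<alpha>] reg_not_pole by auto
      then show ?case
        by (simp only: split)
    qed
  qed
  ultimately show "\<exists>XL XR. lie_germ G XL 0 \<and> lie_germ G XR 0 \<and> XL 0 = 0 \<and> XR 0 = 0 \<and>
      (\<forall>\<^sub>F w in at 0. mat_eval (ham W \<alpha>) (1 / w) = XL w ** gv (1 / w) + gv (1 / w) ** XR w)"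
    by (intro exI[of _ "\<lambda>w. \<Sum>u\<in>W. mscale (w / (u * w - 1)) (\<alpha> u)"]
        exI[of _ "\<lambda>w. \<Sum>u\<in>W. mscale (- w / (u * w - 1)) (right \<alpha> u)"]) simp
qed

section \<open>Tangent vectors in local form\<close>

lemma T_local:
  assumes "\<delta> \<in> T"
  obtains XL XR where "lie_germ G XL p" "lie_germ G XR p"
    "\<forall>\<^sub>F z in at p. mat_eval \<delta> z = XL z ** gv z + gv z ** XR z"
  using assms unfolding tangent_mHiggs_def by blast

lemma T_infinity:
  assumes "\<delta> \<in> T"
  obtains XL XR where "lie_germ G XL 0" "lie_germ G XR 0" "XL 0 = 0" "XR 0 = 0"
    "\<forall>\<^sub>F w in at 0. mat_eval \<delta> (1 / w) = XL w ** gv (1 / w) + gv (1 / w) ** XR w"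
  using assms unfolding tangent_mHiggs_def by blast

lemma tendsto_gv: "reg p \<Longrightarrow> (gv \<longlongrightarrow> gv p) (at p)"
  by (rule tendsto_mat_if_analytic[OF analytic_gv])

text \<open>The local expression has a limit at \<open>p\<close>, which excludes a pole and
  determines the value. The last clause holds for every representing pair, so the value can be
  computed from whichever pair is at hand.\<close>

lemma T_regular:
  assumes "\<delta> \<in> T" and p: "reg p"
  shows "p \<notin> mat_poles \<delta>" "mat_eval \<delta> p ** gi p \<in> lie"
    and "lie_germ G XL p \<Longrightarrow> lie_germ G XR p \<Longrightarrow>
      \<forall>\<^sub>F z in at p. mat_eval \<delta> z = XL z ** gv z + gv z ** XR z \<Longrightarrow>
      mat_eval \<delta> p ** gi p = XL p + Ad (gv p) (XR p)"
proof -
  have *: "p \<notin> mat_poles \<delta> \<and> mat_eval \<delta> p ** gi p = XL p + Ad (gv p) (XR p)"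
    if "lie_germ G XL p" "lie_germ G XR p"
      "\<forall>\<^sub>F z in at p. mat_eval \<delta> z = XL z ** gv z + gv z ** XR z" for XL XR
  proof -
    have "((\<lambda>z. XL z ** gv z + gv z ** XR z) \<longlongrightarrow> XL p ** gv p + gv p ** XR p) (at p)"
      by (intro tendsto_intros lie_germ_tendsto[OF that(1)] lie_germ_tendsto[OF that(2)] tendsto_gv p)
    then have "(mat_eval \<delta> \<longlongrightarrow> XL p ** gv p + gv p ** XR p) (at p)"
      by (rule Lim_transform_eventually) (use that(3) in \<open>auto elim: eventually_mono\<close>)
    from mat_limit_imp_not_pole[OF this] show ?thesis
      by (simp add: matrix_add_rdistrib matrix_inv_cancel_assoc reg_inv p Ad_def)
  qed
  then show "lie_germ G XL p \<Longrightarrow> lie_germ G XR p \<Longrightarrow>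
      \<forall>\<^sub>F z in at p. mat_eval \<delta> z = XL z ** gv z + gv z ** XR z \<Longrightarrow>
      mat_eval \<delta> p ** gi p = XL p + Ad (gv p) (XR p)"
    by blast
  obtain XL XR where X: "lie_germ G XL p" "lie_germ G XR p"
    "\<forall>\<^sub>F z in at p. mat_eval \<delta> z = XL z ** gv z + gv z ** XR z"
    by (rule T_local[OF assms(1)])
  from *[OF this] show "p \<notin> mat_poles \<delta>" "mat_eval \<delta> p ** gi p \<in> lie"
    using X by (auto intro!: lie_algebra_add Ad_lie reg_G p dest: lie_germ_value)
qed

lemma tendsto_gv_inverse: "((\<lambda>w. gv (1 / w)) \<longlongrightarrow> mat 1) (at 0)"
  by (rule tendsto_at_infinity_inverse[OF g_lim])

text \<open>Both representatives vanish at infinity and g tends to 1, hence the variation tends to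
  0.\<close>

lemma T_subset_tangent_G1: "T \<subseteq> tangent_G1_rational G g"
proof
  fix \<delta> assume \<delta>: "\<delta> \<in> T"
  obtain XL XR where X: "lie_germ G XL 0" "lie_germ G XR 0" "XL 0 = 0" "XR 0 = 0"
    "\<forall>\<^sub>F w in at 0. mat_eval \<delta> (1 / w) = XL w ** gv (1 / w) + gv (1 / w) ** XR w"
    by (rule T_infinity[OF \<delta>])
  have "((\<lambda>w. XL w ** gv (1 / w) + gv (1 / w) ** XR w) \<longlongrightarrow> XL 0 ** mat 1 + mat 1 ** XR 0) (at 0)"
    by (intro tendsto_intros lie_germ_tendsto[OF X(1)] lie_germ_tendsto[OF X(2)] tendsto_gv_inverse)
  then have "((\<lambda>w. mat_eval \<delta> (1 / w)) \<longlongrightarrow> XL 0 ** mat 1 + mat 1 ** XR 0) (at 0)"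
    by (rule Lim_transform_eventually) (use X(5) in \<open>auto elim: eventually_mono\<close>)
  then have "(mat_eval \<delta> \<longlongrightarrow> 0) at_infinity"
    by (simp add: X at_to_infinity filterlim_filtermap inverse_eq_divide)
  then show "\<delta> \<in> tangent_G1_rational G g"
    using T_regular(2)[OF \<delta>] by (simp add: tangent_G1_rational_def)
qed

lemma T_comb:
  assumes "\<delta> \<in> T" "\<epsilon> \<in> T"
  shows "\<delta> + mscale (rat_const c) \<epsilon> \<in> T"
proof -
  have ev: "z \<notin> mat_poles \<delta> \<Longrightarrow> z \<notin> mat_poles \<epsilon> \<Longrightarrow>
      mat_eval (\<delta> + mscale (rat_const c) \<epsilon>) z = mat_eval \<delta> z + mscale c (mat_eval \<epsilon> z)" for z
    by (simp add: mat_eval_add mat_eval_mscale)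
  have alg: "(XL ** M + M ** XR) + mscale c (YL ** M + M ** YR) =
      (XL + mscale c YL) ** M + M ** (XR + mscale c YR)" for XL XR YL YR M :: "complex^'n^'n"
    by (simp add: matrix_add_rdistrib matrix_add_ldistrib mscale_add mscale_matrix_mult_left mscale_matrix_mult_right)
  have "finite (mat_poles \<delta> \<union> mat_poles \<epsilon>)"
    by (simp add: finite_mat_poles)
  note np = eventually_not_in_finite[OF this] eventually_at_infinity_not_in_finite[OF this]
  show ?thesis
    unfolding tangent_mHiggs_def
  proof (intro CollectI conjI allI)
    fix p
    obtain XL XR where X: "lie_germ G XL p" "lie_germ G XR p"
      "\<forall>\<^sub>F z in at p. mat_eval \<delta> z = XL z ** gv z + gv z ** XR z"
      by (rule T_local[OF assms(1)])
    obtain YL YR where Y: "lie_germ G YL p" "lie_germ G YR p"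
      "\<forall>\<^sub>F z in at p. mat_eval \<epsilon> z = YL z ** gv z + gv z ** YR z"
      by (rule T_local[OF assms(2)])
    have "\<forall>\<^sub>F z in at p. mat_eval (\<delta> + mscale (rat_const c) \<epsilon>) z =
        (XL z + mscale c (YL z)) ** gv z + gv z ** (XR z + mscale c (YR z))"
      using X(3) Y(3) np(1)[of p] by eventually_elim (simp add: ev alg)
    then show "\<exists>XL XR. lie_germ G XL p \<and> lie_germ G XR p \<and>
        (\<forall>\<^sub>F z in at p. mat_eval (\<delta> + mscale (rat_const c) \<epsilon>) z = XL z ** gv z + gv z ** XR z)"
      using lie_germ_comb[OF X(1) Y(1), of c] lie_germ_comb[OF X(2) Y(2), of c] by blast
  next
    obtain XL XR where X: "lie_germ G XL 0" "lie_germ G XR 0" "XL 0 = 0" "XR 0 = 0"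
      "\<forall>\<^sub>F w in at 0. mat_eval \<delta> (1 / w) = XL w ** gv (1 / w) + gv (1 / w) ** XR w"
      by (rule T_infinity[OF assms(1)])
    obtain YL YR where Y: "lie_germ G YL 0" "lie_germ G YR 0" "YL 0 = 0" "YR 0 = 0"
      "\<forall>\<^sub>F w in at 0. mat_eval \<epsilon> (1 / w) = YL w ** gv (1 / w) + gv (1 / w) ** YR w"
      by (rule T_infinity[OF assms(2)])
    have "\<forall>\<^sub>F w in at 0. 1 / w \<notin> mat_poles \<delta> \<union> mat_poles \<epsilon>"
      using np(2) by (simp add: at_to_infinity eventually_filtermap inverse_eq_divide)
    with X(5) Y(5) have "\<forall>\<^sub>F w in at 0. mat_eval (\<delta> + mscale (rat_const c) \<epsilon>) (1 / w) =
        (XL w + mscale c (YL w)) ** gv (1 / w) + gv (1 / w) ** (XR w + mscale c (YR w))"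
      by eventually_elim (simp add: ev alg)
    moreover have "XL 0 + mscale c (YL 0) = 0" "XR 0 + mscale c (YR 0) = 0"
      by (simp_all add: X Y)
    ultimately show "\<exists>XL XR. lie_germ G XL 0 \<and> lie_germ G XR 0 \<and> XL 0 = 0 \<and> XR 0 = 0 \<and>
        (\<forall>\<^sub>F w in at 0. mat_eval (\<delta> + mscale (rat_const c) \<epsilon>) (1 / w) = XL w ** gv (1 / w) + gv (1 / w) ** XR w)"
      using lie_germ_comb[OF X(1) Y(1), of c] lie_germ_comb[OF X(2) Y(2), of c] by blast
  qed
qed

end

section \<open>Residues and duality\<close>

context framed_map
begin

lemma infinite_reg_outside: "finite W \<Longrightarrow> infinite {z. reg z \<and> z \<notin> W}"
  by (intro infinite_if_eventually_at_infinity eventually_conj eventually_reg_at_infinity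
      eventually_at_infinity_not_in_finite)

definition cotangent_pairing ::
    "complex set \<Rightarrow> (complex \<Rightarrow> complex^'n^'n) \<Rightarrow> complex poly fract^'n^'n \<Rightarrow> complex" where
  "cotangent_pairing W \<alpha> \<delta> = (\<Sum>u\<in>W. \<kappa> (\<alpha> u) (mat_eval \<delta> u ** gi u))"

text \<open>Let A and B be the kernel sums of the left and right gradients. Vanishing of
  \<open>ham\<close> says A g = g B, so Ad of g^-1 takes A to B, an explicit sum with no reference
  to the poles of g. Later X and Y are the values of a local pair representing \<delta>.\<close>

lemma kappa_kernel_sum_eq:
  assumes c: "cotangent W \<alpha>" and 0: "ham W \<alpha> = 0" and z: "reg z" "z \<notin> W"
    and XY: "X \<in> lie" "Y \<in> lie"
  shows "\<kappa> (\<Sum>u\<in>W. mscale (1 / (u - z)) (\<alpha> u)) (X + Ad (gv z) Y) =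
    (\<Sum>u\<in>W. (\<kappa> (\<alpha> u) X + \<kappa> (right \<alpha> u) Y) / (u - z))"
proof -
  define A where "A = (\<Sum>u\<in>W. mscale (1 / (u - z)) (\<alpha> u))"
  define B where "B = (\<Sum>u\<in>W. mscale (1 / (u - z)) (right \<alpha> u))"
  have mem: "\<alpha> u \<in> lie" "right \<alpha> u \<in> lie" "mscale (1 / (u - z)) (\<alpha> u) \<in> lie"
    "mscale (1 / (u - z)) (right \<alpha> u) \<in> lie" if "u \<in> W" for u
    using cotangentD[OF c that] by (auto intro: lie_algebra_mscale)
  have AB: "A \<in> lie" "B \<in> lie"
    unfolding A_def B_def by (intro lie_algebra_sum mem; assumption)+
  have "(\<Sum>u\<in>W. mscale (1 / (u - z)) (\<alpha> u ** gv z - gv z ** right \<alpha> u)) = 0"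
    using ham_eval(2)[of z W \<alpha>] z reg_not_pole by (simp add: 0)
  then have "A ** gv z = gv z ** B"
    by (simp add: A_def B_def matrix_sum_rdistrib matrix_sum_ldistrib mscale_matrix_mult_left
        mscale_matrix_mult_right mscale_diff sum_subtractf)
  then have "Ad (gi z) A = B"
    using z(1) by (simp add: Ad_def matrix_inv_inv reg_G matrix_inv_cancel_assoc reg_inv
        matrix_mul_assoc[symmetric, of "gi z"])
  then have "\<kappa> A (X + Ad (gv z) Y) = \<kappa> A X + \<kappa> B Y"
    using XY AB z by (simp add: kappa_add Ad_lie reg_G kappa_Ad_right)
  also have "\<dots> = (\<Sum>u\<in>W. \<kappa> (\<alpha> u) X / (u - z)) + (\<Sum>u\<in>W. \<kappa> (right \<alpha> u) Y / (u - z))"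
    unfolding A_def B_def using XY by (simp add: kappa_sum_left mem kappa_mscale)
  finally show ?thesis
    by (simp add: A_def sum.distrib[symmetric] add_divide_distrib)
qed

text \<open>
  The residue theorem for the function \<open>\<kappa>(A(z), \<delta>(z) g(z)\<^sup>-\<^sup>1)\<close> with \<open>A(z) = (\<Sum>u\<in>W. \<alpha>(u) / (u - z))\<close>.
  At a point where \<open>\<delta> = X\<^sup>L g + g X\<^sup>R\<close> it equals \<open>\<kappa>(A, X\<^sup>L) + \<kappa>(Ad g\<^sup>-\<^sup>1 A, X\<^sup>R)\<close>, and \<open>Ad g\<^sup>-\<^sup>1 A\<close> has poles
  in \<open>W\<close> only because \<open>ham W \<alpha> = 0\<close>; so there is no contribution from the poles of \<open>g\<close>.
\<close>
lemma pairing_eq_0_if_ham_eq_0: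
  assumes c: "cotangent W \<alpha>" and 0: "ham W \<alpha> = 0" and \<delta>: "\<delta> \<in> T"
  shows "cotangent_pairing W \<alpha> \<delta> = 0"
proof -
  note fin = finite_cotangent[OF c]
  define cc where "cc u = \<kappa> (\<alpha> u) (mat_eval \<delta> u ** gi u)" for u
  \<comment> \<open>\<open>cc u\<close> is the coefficient of the principal part at
    \<open>u\<close>; after the subtraction all singularities are removable.\<close>
  define E where "E z = \<kappa> (\<Sum>u\<in>W. mscale (1 / (u - z)) (\<alpha> u)) (mat_eval \<delta> z ** gi z) -
      (\<Sum>u\<in>W. cc u / (u - z))" for z
  \<comment> \<open>The matrices \<open>K u\<close> and \<open>L u\<close> stand in for \<kappa>
    against the left and right gradients, so that E becomes a sum of analytic expressions.\<close>
  have "\<forall>u\<in>W. \<exists>K. \<forall>X\<in>lie. \<kappa> (\<alpha> u) X = frob K X"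
    using kappa_frob cotangentD(2)[OF c] by metis
  then obtain K where K: "\<And>u X. u \<in> W \<Longrightarrow> X \<in> lie \<Longrightarrow> \<kappa> (\<alpha> u) X = frob (K u) X"
    using bchoice[of W "\<lambda>u K. \<forall>X\<in>lie. \<kappa> (\<alpha> u) X = frob K X"] by blast
  have "\<forall>u\<in>W. \<exists>K. \<forall>X\<in>lie. \<kappa> (right \<alpha> u) X = frob K X"
    using kappa_frob cotangentD(3)[OF c] by metis
  then obtain L where L: "\<And>u X. u \<in> W \<Longrightarrow> X \<in> lie \<Longrightarrow> \<kappa> (right \<alpha> u) X = frob (L u) X"
    using bchoice[of W "\<lambda>u K. \<forall>X\<in>lie. \<kappa> (right \<alpha> u) X = frob K X"] by blast
  have E_eq: "E z = (\<Sum>u\<in>W. (frob (K u) X + frob (L u) Y - cc u) / (u - z))"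
    if "reg z" "z \<notin> W" "X \<in> lie" "Y \<in> lie" "mat_eval \<delta> z = X ** gv z + gv z ** Y" for z X Y
  proof -
    have "mat_eval \<delta> z ** gi z = X + Ad (gv z) Y"
      using that(1) by (simp add: that(5) matrix_add_rdistrib matrix_inv_cancel_assoc reg_inv Ad_def)
    then have "E z = (\<Sum>u\<in>W. (\<kappa> (\<alpha> u) X + \<kappa> (right \<alpha> u) Y) / (u - z)) - (\<Sum>u\<in>W. cc u / (u - z))"
      using kappa_kernel_sum_eq[OF c 0 that(1-4)] by (simp add: E_def)
    also have "\<dots> = (\<Sum>u\<in>W. (\<kappa> (\<alpha> u) X + \<kappa> (right \<alpha> u) Y - cc u) / (u - z))"
      by (simp add: sum_subtractf[symmetric] diff_divide_distrib)
    also have "\<dots> = (\<Sum>u\<in>W. (frob (K u) X + frob (L u) Y - cc u) / (u - z))"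
      using that by (intro sum.cong) (simp_all add: K L)
    finally show ?thesis .
  qed
  have ext: "\<exists>F. F analytic_on {p} \<and> (\<forall>\<^sub>F z in at p. E z = F z)" for p
  proof -
    obtain XL XR where X: "lie_germ G XL p" "lie_germ G XR p"
      "\<forall>\<^sub>F z in at p. mat_eval \<delta> z = XL z ** gv z + gv z ** XR z"
      by (rule T_local[OF \<delta>])
    define m where "m u z = frob (K u) (XL z) + frob (L u) (XR z) - cc u" for u z
    have an: "m u analytic_on {p}" for u
    proof -
      have "(\<lambda>z. frob (K u) (XL z)) analytic_on {p}" "(\<lambda>z. frob (L u) (XR z)) analytic_on {p}"
        using X(1,2) by (auto intro!: analytic_frob simp: lie_germ_def)
      then show ?thesis
        unfolding m_def by (intro analytic_intros)
    qed
    \<comment> \<open>The numerator at \<open>p\<close> vanishes because \<open>T_regular\<close>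
      expresses \<open>cc p\<close> through this very pair X^L, X^R.\<close>
    have m0: "m p p = 0" if "p \<in> W"
    proof -
      have p: "reg p"
        using cotangentD[OF c that] by simp
      note XL = lie_germ_value[OF X(1)] and XR = lie_germ_value[OF X(2)]
      have "\<kappa> (\<alpha> p) (Ad (gv p) (XR p)) = \<kappa> (right \<alpha> p) (XR p)"
        using p XR that cotangentD[OF c] by (intro kappa_Ad_right reg_G)
      then have "cc p = \<kappa> (\<alpha> p) (XL p) + \<kappa> (right \<alpha> p) (XR p)"
        unfolding cc_def T_regular(3)[OF \<delta> p X]
        using p XL XR cotangentD(2)[OF c that] by (simp add: kappa_add Ad_lie reg_G)
      then show ?thesis
        using that XL XR by (simp add: m_def K L)
    qed
    have "\<exists>F. F analytic_on {p} \<and> (\<forall>z. z \<noteq> p \<and> z \<noteq> u \<longrightarrow> F z = m u z / (u - z))" if "u \<in> W" for u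
    proof (cases "u = p")
      case True
      obtain F where "F analytic_on {p}" "\<And>z. z \<noteq> p \<Longrightarrow> F z = (m p z - m p p) / (p - z)"
        using analytic_difference_quotient[OF an] by blast
      then show ?thesis
        using m0 True that by (intro exI[of _ F]) simp
    next
      case False
      then have "(\<lambda>z. m u z / (u - z)) analytic_on {p}"
        using an by (intro analytic_intros) auto
      then show ?thesis by blast
    qed
    then obtain F where F: "\<And>u. u \<in> W \<Longrightarrow> F u analytic_on {p}"
      "\<And>u z. u \<in> W \<Longrightarrow> z \<noteq> p \<Longrightarrow> z \<noteq> u \<Longrightarrow> F u z = m u z / (u - z)"
      using bchoice[of W "\<lambda>u F. F analytic_on {p} \<and> (\<forall>z. z \<noteq> p \<and> z \<noteq> u \<longrightarrow> F z = m u z / (u - z))"]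
      by blast
    have "(\<lambda>z. \<Sum>u\<in>W. F u z) analytic_on {p}"
      using F(1) by (rule analytic_on_sum)
    moreover have "\<forall>\<^sub>F z in at p. E z = (\<Sum>u\<in>W. F u z)"
    proof -
      have "\<forall>\<^sub>F z in at p. XL z \<in> lie" "\<forall>\<^sub>F z in at p. XR z \<in> lie" "\<forall>\<^sub>F z in at p. z \<noteq> p"
        using X(1,2) by (auto simp: lie_germ_def eventually_at_filter elim: eventually_mono)
      then show ?thesis
        using X(3) eventually_reg[of p] eventually_not_in_finite[OF fin, of p]
      proof eventually_elim
        case (elim z)
        have "E z = (\<Sum>u\<in>W. m u z / (u - z))"
          unfolding m_def using elim by (intro E_eq)
        also have "\<dots> = (\<Sum>u\<in>W. F u z)"
          using elim by (intro sum.cong refl) (subst F(2); auto)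
        finally show ?case .
      qed
    qed
    ultimately show ?thesis by blast
  qed
  obtain XL XR where X: "lie_germ G XL 0" "lie_germ G XR 0" "XL 0 = 0" "XR 0 = 0"
    "\<forall>\<^sub>F w in at 0. mat_eval \<delta> (1 / w) = XL w ** gv (1 / w) + gv (1 / w) ** XR w"
    by (rule T_infinity[OF \<delta>])
  \<comment> \<open>One factor w is split off from E(1/w). At w = 0 the representatives vanish and
    the denominators are -1, so D tends to the sum of the \<open>cc u\<close>.\<close>
  define D where "D w = (\<Sum>u\<in>W. (frob (K u) (XL w) + frob (L u) (XR w) - cc u) / (u * w - 1))" for w
  have E_D: "\<forall>\<^sub>F w in at 0. E (1 / w) = w * D w"
  proof -
    have "\<forall>\<^sub>F z in at_infinity. reg z \<and> z \<notin> W"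
      by (intro eventually_conj eventually_reg_at_infinity eventually_at_infinity_not_in_finite fin)
    then have "\<forall>\<^sub>F w in at 0. reg (1 / w) \<and> 1 / w \<notin> W"
      by (simp add: at_to_infinity eventually_filtermap inverse_eq_divide)
    moreover have "\<forall>\<^sub>F w in at 0. XL w \<in> lie" "\<forall>\<^sub>F w in at 0. XR w \<in> lie" "\<forall>\<^sub>F w in at 0. w \<noteq> (0::complex)"
      using X(1,2) by (auto simp: lie_germ_def eventually_at_filter elim: eventually_mono)
    ultimately show ?thesis
      using X(5)
    proof eventually_elim
      case (elim w)
      have "a / (u - 1 / w) = w * (a / (u * w - 1))" for u a
        using elim by (simp add: field_simps)
      moreover have "E (1 / w) = (\<Sum>u\<in>W. (frob (K u) (XL w) + frob (L u) (XR w) - cc u) / (u - 1 / w))"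
        using elim by (intro E_eq) auto
      ultimately show ?case
        by (simp add: D_def sum_distrib_left)
    qed
  qed
  have D_lim: "(D \<longlongrightarrow> (\<Sum>u\<in>W. cc u)) (at 0)"
  proof -
    have XL: "(XL \<longlongrightarrow> 0) (at 0)" and XR: "(XR \<longlongrightarrow> 0) (at 0)"
      using lie_germ_tendsto[OF X(1)] lie_germ_tendsto[OF X(2)] by (simp_all add: X)
    have "(D \<longlongrightarrow> (\<Sum>u\<in>W. (frob (K u) 0 + frob (L u) 0 - cc u) / (u * 0 - 1))) (at 0)"
      unfolding D_def by (intro tendsto_intros tendsto_frob[OF XL] tendsto_frob[OF XR]) auto
    then show ?thesis by simp
  qed
  have "((\<lambda>w. E (1 / w)) \<longlongrightarrow> 0 * (\<Sum>u\<in>W. cc u)) (at 0)"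
    by (rule Lim_transform_eventually[OF tendsto_mult[OF tendsto_ident_at D_lim]])
      (use E_D in \<open>auto elim: eventually_mono\<close>)
  then have "(E \<longlongrightarrow> 0) at_infinity"
    by (simp add: at_to_infinity filterlim_filtermap inverse_eq_divide)
  note E0 = Liouville_punctured[OF ext this]
  \<comment> \<open>Otherwise E(1/w) = w D(w) would be nonzero for all small w other than 0,
    although E vanishes near every point of the plane.\<close>
  have "(\<Sum>u\<in>W. cc u) = 0"
  proof (rule ccontr)
    assume "(\<Sum>u\<in>W. cc u) \<noteq> 0"
    then have "\<forall>\<^sub>F w in at 0. D w \<noteq> 0"
      by (rule tendsto_imp_eventually_ne[OF D_lim])
    moreover have "\<forall>\<^sub>F w in at 0. w \<noteq> (0::complex)"
      by (simp add: eventually_at_filter)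
    ultimately have "\<forall>\<^sub>F w in at 0. E (1 / w) \<noteq> 0"
      using E_D by eventually_elim simp
    then have "\<forall>\<^sub>F z in at_infinity. E z \<noteq> 0"
      by (simp add: at_to_infinity eventually_filtermap inverse_eq_divide)
    then obtain b where b: "\<And>z. norm z \<ge> b \<Longrightarrow> E z \<noteq> 0"
      by (auto simp: eventually_at_infinity)
    define p :: complex where "p = of_real (\<bar>b\<bar> + 1)"
    have "open {y::complex. b < norm y}"
      by (intro open_Collect_less continuous_intros)
    moreover have "b < norm p"
      by (simp add: p_def)
    ultimately have "\<forall>\<^sub>F z in nhds p. b < norm z"
      using eventually_nhds_in_open[of "{y. b < norm y}" p] by simp
    then have "\<forall>\<^sub>F z in at p. b < norm z"
      by (auto simp: eventually_at_filter elim: eventually_mono)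
    with E0[of p] have "\<forall>\<^sub>F z in at p. False"
      by eventually_elim (use b in force)
    then show False by simp
  qed
  then show ?thesis
    by (simp add: cotangent_pairing_def cc_def)
qed

section \<open>Linearity, change of support and skew-symmetry\<close>

lemma ham_comb:
  assumes "finite W"
  shows "ham W (\<lambda>u. \<alpha> u + mscale c (\<beta> u)) = ham W \<alpha> + mscale (rat_const c) (ham W \<beta>)"
proof (rule mat_eqI_infinite[OF infinite_reg_outside[OF assms]])
  fix z assume "z \<in> {z. reg z \<and> z \<notin> W}"
  then have z: "z \<notin> mat_poles g" "z \<notin> W"
    using reg_not_pole by auto
  have "(\<alpha> u + mscale c (\<beta> u)) ** gv z - gv z ** Ad (gi u) (\<alpha> u + mscale c (\<beta> u)) =
      (\<alpha> u ** gv z - gv z ** right \<alpha> u) + mscale c (\<beta> u ** gv z - gv z ** right \<beta> u)" for u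
    by (simp add: Ad_add Ad_mscale matrix_add_rdistrib matrix_add_ldistrib mscale_matrix_mult_left
        mscale_matrix_mult_right mscale_diff)
  moreover have "mscale c (\<Sum>u\<in>W. f u) = (\<Sum>u\<in>W. mscale c (f u))" for f :: "complex \<Rightarrow> complex^'n^'n"
    by (simp add: vec_eq_iff sum_component sum_distrib_left)
  ultimately have "mat_eval (ham W (\<lambda>u. \<alpha> u + mscale c (\<beta> u))) z =
      mat_eval (ham W \<alpha>) z + mscale c (mat_eval (ham W \<beta>) z)"
    by (simp add: ham_eval(2)[OF z] mscale_add sum.distrib mult.commute)
  then show "mat_eval (ham W (\<lambda>u. \<alpha> u + mscale c (\<beta> u))) z =
      mat_eval (ham W \<alpha> + mscale (rat_const c) (ham W \<beta>)) z"
    by (simp add: mat_eval_add mat_eval_mscale ham_eval(1)[OF z])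
qed

text \<open>Extension by zero lets covectors with different supports be compared on a common
  one.\<close>

lemma ham_extend:
  assumes "finite W'" "W \<subseteq> W'"
  shows "ham W' (\<lambda>u. if u \<in> W then \<alpha> u else 0) = ham W \<alpha>"
proof -
  have "const_mat 0 = (0 :: complex poly fract^'n^'n)"
    by (simp add: const_mat_def vec_eq_iff rat_const_0)
  then show ?thesis
    unfolding ham_def using assms
    by (intro sum.mono_neutral_cong_right) (auto simp: Ad_def)
qed

lemma pairing_extend:
  assumes "cotangent W \<alpha>" "finite W'" "\<And>u. u \<in> W' \<Longrightarrow> reg u" "W \<subseteq> W'" "\<delta> \<in> T"
  shows "cotangent_pairing W' (\<lambda>u. if u \<in> W then \<alpha> u else 0) \<delta> = cotangent_pairing W \<alpha> \<delta>"
  unfolding cotangent_pairing_def using assms T_regular(2)[OF assms(5)]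
  by (intro sum.mono_neutral_cong_right) (auto simp: kappa_0)

lemma cotangent_comb:
  "cotangent W \<alpha> \<Longrightarrow> cotangent W \<beta> \<Longrightarrow> cotangent W (\<lambda>u. \<alpha> u + mscale c (\<beta> u))"
  by (auto simp: cotangent_def intro: lie_algebra_add lie_algebra_mscale)

lemma cotangent_extend:
  assumes "cotangent W \<alpha>" "finite W'" "\<And>u. u \<in> W' \<Longrightarrow> reg u"
  shows "cotangent W' (\<lambda>u. if u \<in> W then \<alpha> u else 0)"
  using assms by (auto simp: cotangent_def)

lemma pairing_comb_left:
  assumes "cotangent W \<alpha>" "cotangent W \<beta>" "\<delta> \<in> T"
  shows "cotangent_pairing W (\<lambda>u. \<alpha> u + mscale c (\<beta> u)) \<delta> =
    cotangent_pairing W \<alpha> \<delta> + c * cotangent_pairing W \<beta> \<delta>"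
proof -
  have "\<kappa> (\<alpha> u + mscale c (\<beta> u)) (mat_eval \<delta> u ** gi u) =
      \<kappa> (\<alpha> u) (mat_eval \<delta> u ** gi u) + c * \<kappa> (\<beta> u) (mat_eval \<delta> u ** gi u)" if "u \<in> W" for u
    using cotangentD[OF assms(1) that] cotangentD[OF assms(2) that] T_regular(2)[OF assms(3)]
    by (simp add: kappa_add kappa_mscale lie_algebra_mscale)
  then show ?thesis
    by (simp add: cotangent_pairing_def sum.distrib sum_distrib_left)
qed

lemma pairing_comb_right:
  assumes "cotangent W \<alpha>" "\<delta> \<in> T" "\<epsilon> \<in> T"
  shows "cotangent_pairing W \<alpha> (\<delta> + mscale (rat_const c) \<epsilon>) =
    cotangent_pairing W \<alpha> \<delta> + c * cotangent_pairing W \<alpha> \<epsilon>"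
proof -
  have "\<kappa> (\<alpha> u) (mat_eval (\<delta> + mscale (rat_const c) \<epsilon>) u ** gi u) =
      \<kappa> (\<alpha> u) (mat_eval \<delta> u ** gi u) + c * \<kappa> (\<alpha> u) (mat_eval \<epsilon> u ** gi u)" if "u \<in> W" for u
  proof -
    note u = cotangentD[OF assms(1) that]
    have "mat_eval (\<delta> + mscale (rat_const c) \<epsilon>) u ** gi u =
        mat_eval \<delta> u ** gi u + mscale c (mat_eval \<epsilon> u ** gi u)"
      using T_regular(1)[OF _ u(1)] assms(2,3)
      by (simp add: mat_eval_add mat_eval_mscale matrix_add_rdistrib mscale_matrix_mult_left)
    then show ?thesis
      using u T_regular(2)[OF _ u(1)] assms(2,3)
      by (simp add: kappa_add kappa_mscale lie_algebra_mscale)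
  qed
  then show ?thesis
    by (simp add: cotangent_pairing_def sum.distrib sum_distrib_left)
qed

text \<open>On the union of the supports the difference of the two covectors has Hamiltonian vector
  0, hence annihilates every tangent vector. This makes the symplectic form independent of the
  chosen covector.\<close>

lemma pairing_cong_ham:
  assumes c: "cotangent W \<alpha>" "cotangent W' \<beta>" and eq: "ham W \<alpha> = ham W' \<beta>" and \<delta>: "\<delta> \<in> T"
  shows "cotangent_pairing W \<alpha> \<delta> = cotangent_pairing W' \<beta> \<delta>"
proof -
  define V where "V = W \<union> W'"
  have V: "finite V" "\<And>u. u \<in> V \<Longrightarrow> reg u" "W \<subseteq> V" "W' \<subseteq> V"
    using c by (auto simp: V_def cotangent_def)
  define a where "a u = (if u \<in> W then \<alpha> u else 0)" for u
  define b where "b u = (if u \<in> W' then \<beta> u else 0)" for u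
  have ab: "cotangent V a" "cotangent V b"
    unfolding a_def b_def by (intro cotangent_extend c V; assumption)+
  have h: "ham V a = ham W \<alpha>" "ham V b = ham W' \<beta>"
    unfolding a_def b_def by (intro ham_extend V)+
  have p: "cotangent_pairing V a \<delta> = cotangent_pairing W \<alpha> \<delta>"
    "cotangent_pairing V b \<delta> = cotangent_pairing W' \<beta> \<delta>"
    unfolding a_def b_def by (intro pairing_extend c V \<delta>; assumption)+
  have "ham V (\<lambda>u. a u + mscale (-1) (b u)) = ham V a + mscale (rat_const (-1)) (ham V b)"
    by (rule ham_comb[OF V(1)])
  also have "rat_const (-1) = -1"
    by (simp add: rat_const_uminus rat_const_1)
  finally have "ham V (\<lambda>u. a u + mscale (-1) (b u)) = 0"
    using eq by (simp add: h)
  then have "cotangent_pairing V (\<lambda>u. a u + mscale (-1) (b u)) \<delta> = 0"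
    by (intro pairing_eq_0_if_ham_eq_0 cotangent_comb ab \<delta>)
  then show ?thesis
    unfolding pairing_comb_left[OF ab \<delta>] p by simp
qed

text \<open>Disjointness means that each Hamiltonian vector is evaluated only away from its own
  support, where both pairings are explicit double sums. Exchanging the roles changes the sign of 1
  / (u - v), and \<kappa> is symmetric.\<close>

lemma pairing_skew:
  assumes c: "cotangent W \<alpha>" "cotangent W' \<beta>" and disj: "W \<inter> W' = {}"
  shows "cotangent_pairing W \<alpha> (ham W' \<beta>) = - cotangent_pairing W' \<beta> (ham W \<alpha>)"
proof -
  \<comment> \<open>Stated for arbitrary data because it is applied again with the two covectors
    exchanged.\<close>
  have half: "cotangent_pairing W \<alpha> (ham W' \<beta>) =
      (\<Sum>v\<in>W. \<Sum>u\<in>W'. (\<kappa> (\<alpha> v) (\<beta> u) - \<kappa> (right \<alpha> v) (right \<beta> u)) / (u - v))"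
    if c: "cotangent W \<alpha>" "cotangent W' \<beta>" and disj: "W \<inter> W' = {}" for W W' \<alpha> \<beta>
  proof -
    have "\<kappa> (\<alpha> v) (mat_eval (ham W' \<beta>) v ** gi v) =
        (\<Sum>u\<in>W'. (\<kappa> (\<alpha> v) (\<beta> u) - \<kappa> (right \<alpha> v) (right \<beta> u)) / (u - v))" if v: "v \<in> W" for v
    proof -
      note vv = cotangentD[OF c(1) v]
      have mem: "\<beta> u - Ad (gv v) (right \<beta> u) \<in> lie" if "u \<in> W'" for u
        by (intro lie_algebra_diff Ad_lie[OF reg_G[OF vv(1)]] cotangentD[OF c(2) that])
      have "v \<notin> W'"
        using disj v by auto
      then have "\<kappa> (\<alpha> v) (mat_eval (ham W' \<beta>) v ** gi v) =
          (\<Sum>u\<in>W'. \<kappa> (\<alpha> v) (mscale (1 / (u - v)) (\<beta> u - Ad (gv v) (right \<beta> u))))"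
        unfolding ham_eval_left[OF vv(1) \<open>v \<notin> W'\<close>]
        by (intro kappa_sum_right lie_algebra_mscale mem vv)
      also have "\<dots> = (\<Sum>u\<in>W'. (\<kappa> (\<alpha> v) (\<beta> u) - \<kappa> (right \<alpha> v) (right \<beta> u)) / (u - v))"
      proof (intro sum.cong refl)
        fix u assume u: "u \<in> W'"
        note uu = cotangentD[OF c(2) u]
        show "\<kappa> (\<alpha> v) (mscale (1 / (u - v)) (\<beta> u - Ad (gv v) (right \<beta> u))) =
            (\<kappa> (\<alpha> v) (\<beta> u) - \<kappa> (right \<alpha> v) (right \<beta> u)) / (u - v)"
          using vv uu mem[OF u] by (simp add: kappa_mscale kappa_diff Ad_lie reg_G kappa_Ad_right)
      qed
      finally show ?thesis .
    qed
    then show ?thesis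
      by (simp add: cotangent_pairing_def)
  qed
  have "cotangent_pairing W' \<beta> (ham W \<alpha>) =
      (\<Sum>v\<in>W. \<Sum>u\<in>W'. (\<kappa> (\<beta> u) (\<alpha> v) - \<kappa> (right \<beta> u) (right \<alpha> v)) / (v - u))"
    using disj by (subst half[OF c(2,1)]) (auto intro: sum.swap)
  also have "\<dots> = (\<Sum>v\<in>W. \<Sum>u\<in>W'. - ((\<kappa> (\<alpha> v) (\<beta> u) - \<kappa> (right \<alpha> v) (right \<beta> u)) / (u - v)))"
  proof (intro sum.cong refl)
    fix v u assume "v \<in> W" "u \<in> W'"
    note vv = cotangentD[OF c(1) \<open>v \<in> W\<close>] and uu = cotangentD[OF c(2) \<open>u \<in> W'\<close>]
    have "\<kappa> (\<beta> u) (\<alpha> v) - \<kappa> (right \<beta> u) (right \<alpha> v) = \<kappa> (\<alpha> v) (\<beta> u) - \<kappa> (right \<alpha> v) (right \<beta> u)"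
      using kappa_sym[OF uu(2) vv(2)] kappa_sym[OF uu(3) vv(3)] by simp
    then show "(\<kappa> (\<beta> u) (\<alpha> v) - \<kappa> (right \<beta> u) (right \<alpha> v)) / (v - u) =
        - ((\<kappa> (\<alpha> v) (\<beta> u) - \<kappa> (right \<alpha> v) (right \<beta> u)) / (u - v))"
      by (metis minus_diff_eq divide_minus_right)
  qed
  finally show ?thesis
    by (simp add: half[OF c disj] sum_negf)
qed

section \<open>Finiteness and duality\<close>

definition zero_bound :: "nat \<Rightarrow> bool" where
  "zero_bound N \<longleftrightarrow>
     (\<forall>\<delta>\<in>T. \<forall>U. finite U \<and> N < card U \<and> (\<forall>u\<in>U. reg u \<and> mat_eval \<delta> u = 0) \<longrightarrow> \<delta> = 0)"

lemma zero_boundD: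
  assumes "zero_bound N" "\<delta> \<in> T" "finite U" "N < card U" "\<And>u. u \<in> U \<Longrightarrow> reg u"
    "\<And>u. u \<in> U \<Longrightarrow> mat_eval \<delta> u = 0"
  shows "\<delta> = 0"
  using assms unfolding zero_bound_def by blast

text \<open>
  The bound is the degree of a common denominator of \<open>g\<close>, which also clears the denominators of all
  tangent vectors.
\<close>
lemma zero_bound_exists: "\<exists>N. zero_bound N"
proof -
  define s where "s k l = snd (quot_of_fract (g $ k $ l))" for k l
  define R where "R k l = (\<Prod>kl\<in>UNIV - {(k, l)}. s (fst kl) (snd kl))" for k l
  define q where "q = (\<Prod>kl\<in>UNIV. s (fst kl) (snd kl))"
  define Q where "Q k l = fst (quot_of_fract (g $ k $ l)) * R k l" for k l
  have "s k l \<noteq> 0" for k l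
    by (simp add: s_def)
  then have q: "q \<noteq> 0"
    by (simp add: q_def)
  have q_split: "q = s k l * R k l" for k l
    unfolding q_def R_def by (subst prod.remove[of _ "(k, l)"]) auto
  have qg: "poly q z * rat_eval (g $ k $ l) z = poly (Q k l) z" if "reg z" for k l z
  proof -
    have "poly (s k l) z \<noteq> 0"
      using reg_not_pole[OF that] by (simp add: mat_poles_def s_def)
    then show ?thesis
      unfolding q_split[of k l] by (simp add: Q_def rat_eval_def s_def)
  qed
  show ?thesis
    unfolding zero_bound_def
  proof (intro exI[of _ "degree q"] ballI allI impI)
    fix \<delta> U assume \<delta>: "\<delta> \<in> T" and U: "finite U \<and> degree q < card U \<and> (\<forall>u\<in>U. reg u \<and> mat_eval \<delta> u = 0)"
    show "\<delta> = 0"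
      unfolding vec_eq_iff
    proof (intro allI)
      fix i j
      have "\<delta> $ i $ j = 0"
      proof (rule rat_eq_0_if_many_zeros[OF q])
        show "(rat_eval (\<delta> $ i $ j) \<longlongrightarrow> 0) at_infinity"
        proof -
          have "(mat_eval \<delta> \<longlongrightarrow> 0) at_infinity"
            using T_subset_tangent_G1 \<delta> by (auto simp: tangent_G1_rational_def)
          from tendsto_vec_nth[OF tendsto_vec_nth[OF this]] show ?thesis by simp
        qed
        show "\<not> is_pole_of (\<delta> $ i $ j) u \<and> rat_eval (\<delta> $ i $ j) u = 0" if "u \<in> U" for u
        proof -
          have "reg u" "mat_eval \<delta> u $ i $ j = 0"
            using U that by auto
          then show ?thesis
            using T_regular(1)[OF \<delta>] by (auto simp: mat_poles_iff)
        qed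
        show "\<exists>l. ((\<lambda>z. poly q z * rat_eval (\<delta> $ i $ j) z) \<longlongrightarrow> l) (at p)" for p
        proof -
          obtain XL XR where X: "lie_germ G XL p" "lie_germ G XR p"
            "\<forall>\<^sub>F z in at p. mat_eval \<delta> z = XL z ** gv z + gv z ** XR z"
            by (rule T_local[OF \<delta>])
          note XL = tendsto_vec_nth[OF tendsto_vec_nth[OF lie_germ_tendsto[OF X(1)]]]
            and XR = tendsto_vec_nth[OF tendsto_vec_nth[OF lie_germ_tendsto[OF X(2)]]]
          \<comment> \<open>Multiplication by \<open>q\<close> turns the entries of g into the
            polynomials \<open>Q\<close>, while X^L and X^R are analytic at \<open>p\<close>; so
            this has a limit even at a pole of g.\<close>
          define S where "S z = (\<Sum>k\<in>UNIV. XL z $ i $ k * poly (Q k j) z) + (\<Sum>k\<in>UNIV. poly (Q i k) z * XR z $ k $ j)" for z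
          have "(S \<longlongrightarrow> S p) (at p)"
            unfolding S_def by (intro tendsto_intros XL XR)
          moreover have "\<forall>\<^sub>F z in at p. S z = poly q z * rat_eval (\<delta> $ i $ j) z"
            using X(3) eventually_reg[of p]
          proof eventually_elim
            case (elim z)
            have "rat_eval (\<delta> $ i $ j) z = (XL z ** gv z + gv z ** XR z) $ i $ j"
              by (simp flip: elim(1))
            then have "poly q z * rat_eval (\<delta> $ i $ j) z =
                (\<Sum>k\<in>UNIV. XL z $ i $ k * (poly q z * rat_eval (g $ k $ j) z)) +
                (\<Sum>k\<in>UNIV. poly q z * rat_eval (g $ i $ k) z * XR z $ k $ j)"
              by (simp add: matrix_matrix_mult_def distrib_left sum_distrib_left ac_simps)
            then show ?case
              using elim(2) by (simp add: S_def qg)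
          qed
          ultimately have "((\<lambda>z. poly q z * rat_eval (\<delta> $ i $ j) z) \<longlongrightarrow> S p) (at p)"
            by (rule Lim_transform_eventually)
          then show ?thesis
            by (rule exI)
        qed
      qed (use U in auto)
      then show "\<delta> $ i $ j = 0 $ i $ j" by simp
    qed
  qed
qed

lemma eval_eq_0_if_left:
  assumes "\<delta> \<in> T" "reg u" "\<And>A. A \<in> lie \<Longrightarrow> \<kappa> A (mat_eval \<delta> u ** gi u) = 0"
  shows "mat_eval \<delta> u = 0"
proof -
  note m = T_regular(2)[OF assms(1,2)]
  have "mat_eval \<delta> u ** gi u = 0"
    using assms(3) kappa_sym[OF m] by (intro kappa_nondeg[OF m]) simp
  then have "mat_eval \<delta> u ** gi u ** gv u = 0"
    by simp
  then show ?thesis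
    by (simp only: eval_left_mult[OF assms(2)])
qed

lemma pairing_singleton: "cotangent_pairing {u} \<alpha> \<delta> = \<kappa> (\<alpha> u) (mat_eval \<delta> u ** gi u)"
  by (simp add: cotangent_pairing_def)

text \<open>
  Duality: the functional \<open>\<alpha> \<mapsto> cotangent_pairing U' \<alpha> \<delta>\<close> vanishes on the kernel of \<open>ham U'\<close>, and by
  skew-symmetry that kernel is cut out by the functionals given by the Hamiltonian vectors supported
  on \<open>U\<close>.  Taking \<open>U\<close> and \<open>U'\<close> disjoint avoids derivatives of \<open>g\<close>.
\<close>
lemma T_eq_ham:
  assumes N: "zero_bound N"
    and U: "finite U" "N < card U" "\<And>u. u \<in> U \<Longrightarrow> reg u"
    and U': "finite U'" "N < card U'" "\<And>u. u \<in> U' \<Longrightarrow> reg u"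
    and disj: "U \<inter> U' = {}" and \<delta>: "\<delta> \<in> T"
  shows "\<exists>\<gamma>. cotangent U \<gamma> \<and> ham U \<gamma> = \<delta>"
proof -
  obtain Bs where Bs: "finite Bs" "Bs \<subseteq> lie" "\<And>X. X \<in> lie \<Longrightarrow> (\<And>b. b \<in> Bs \<Longrightarrow> \<kappa> b X = 0) \<Longrightarrow> X = 0"
    using kappa_separates_finite by blast
  define S where "S = {\<alpha>. cotangent U' \<alpha>}"
  \<comment> \<open>Finitely many functionals that read off the values on \<open>U\<close> of the
    Hamiltonian vector of \<alpha>. Their common kernel is the kernel of \<open>ham U'\<close>,
    since \<open>U\<close> has more than \<open>N\<close> points.\<close>
  define f where "f ub \<alpha> = \<kappa> (snd ub) (mat_eval (ham U' \<alpha>) (fst ub) ** gi (fst ub))" for ub \<alpha>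
  have "\<exists>a. \<forall>\<alpha>\<in>S. cotangent_pairing U' \<alpha> \<delta> = (\<Sum>ub\<in>U \<times> Bs. a ub * f ub \<alpha>)"
  proof (rule functional_combination)
    show "finite (U \<times> Bs)"
      using U Bs by simp
  next
    fix \<alpha> \<beta> c assume ab: "\<alpha> \<in> S" "\<beta> \<in> S"
    then have c: "cotangent U' \<alpha>" "cotangent U' \<beta>"
      by (simp_all add: S_def)
    show "\<exists>z\<in>S. cotangent_pairing U' z \<delta> = cotangent_pairing U' \<alpha> \<delta> + c * cotangent_pairing U' \<beta> \<delta> \<and>
        (\<forall>ub\<in>U \<times> Bs. f ub z = f ub \<alpha> + c * f ub \<beta>)"
    proof (intro bexI[of _ "\<lambda>u. \<alpha> u + mscale c (\<beta> u)"] conjI ballI)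
      show "cotangent_pairing U' (\<lambda>u. \<alpha> u + mscale c (\<beta> u)) \<delta> =
          cotangent_pairing U' \<alpha> \<delta> + c * cotangent_pairing U' \<beta> \<delta>"
        by (rule pairing_comb_left[OF c \<delta>])
      fix ub assume "ub \<in> U \<times> Bs"
      then have s: "cotangent {fst ub} (\<lambda>_. snd ub)"
        using U(3) Bs(2) by (auto simp: cotangent_def)
      show "f ub (\<lambda>u. \<alpha> u + mscale c (\<beta> u)) = f ub \<alpha> + c * f ub \<beta>"
        using pairing_comb_right[OF s ham_in_T[OF c(1)] ham_in_T[OF c(2)], of c]
        by (simp add: f_def pairing_singleton ham_comb[OF U'(1)])
    qed (use c in \<open>simp add: S_def cotangent_comb\<close>)
  next
    fix \<alpha> assume \<alpha>: "\<alpha> \<in> S" and 0: "\<And>ub. ub \<in> U \<times> Bs \<Longrightarrow> f ub \<alpha> = 0"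
    then have c: "cotangent U' \<alpha>"
      by (simp add: S_def)
    note hT = ham_in_T[OF c]
    have "ham U' \<alpha> = 0"
    proof (rule zero_boundD[OF N hT U])
      fix u assume u: "u \<in> U"
      have "mat_eval (ham U' \<alpha>) u ** gi u = 0"
        using 0[of "(u, b)" for b] u T_regular(2)[OF hT U(3)[OF u]] by (intro Bs(3)) (auto simp: f_def)
      then show "mat_eval (ham U' \<alpha>) u = 0"
        using T_regular(2)[OF hT U(3)[OF u]] by (intro eval_eq_0_if_left[OF hT U(3)[OF u]]) (simp add: kappa_0)
    qed
    then show "cotangent_pairing U' \<alpha> \<delta> = 0"
      by (intro pairing_eq_0_if_ham_eq_0 c \<delta>)
  qed
  then obtain a where a: "\<And>\<alpha>. cotangent U' \<alpha> \<Longrightarrow> cotangent_pairing U' \<alpha> \<delta> = (\<Sum>ub\<in>U \<times> Bs. a ub * f ub \<alpha>)"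
    by (auto simp: S_def)
  \<comment> \<open>The covector on \<open>U\<close> assembled from the coefficients; the sign
    compensates the one in \<open>pairing_skew\<close>.\<close>
  define \<gamma> where "\<gamma> u = (\<Sum>b\<in>Bs. mscale (- a (u, b)) b)" for u
  have mem: "mscale (- a (u, b)) b \<in> lie" if "b \<in> Bs" for u b
    using Bs(2) that by (auto intro!: lie_algebra_uminus lie_algebra_mscale)
  then have \<gamma>: "cotangent U \<gamma>"
    using U by (auto simp: cotangent_def \<gamma>_def intro!: lie_algebra_sum)
  note hT = ham_in_T[OF \<gamma>]
  have pair: "cotangent_pairing U' \<alpha> (ham U \<gamma>) = cotangent_pairing U' \<alpha> \<delta>" if c: "cotangent U' \<alpha>" for \<alpha>
  proof -
    have "cotangent_pairing U' \<alpha> (ham U \<gamma>) = - cotangent_pairing U \<gamma> (ham U' \<alpha>)"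
      using disj by (intro pairing_skew c \<gamma>) auto
    also have "\<dots> = - (\<Sum>u\<in>U. \<Sum>b\<in>Bs. - a (u, b) * f (u, b) \<alpha>)"
    proof -
      have "\<kappa> (\<gamma> u) (mat_eval (ham U' \<alpha>) u ** gi u) = (\<Sum>b\<in>Bs. - a (u, b) * f (u, b) \<alpha>)" if u: "u \<in> U" for u
      proof -
        note m = T_regular(2)[OF ham_in_T[OF c] U(3)[OF u]]
        have k: "\<kappa> (mscale (- a (u, b)) b) (mat_eval (ham U' \<alpha>) u ** gi u) = - a (u, b) * f (u, b) \<alpha>"
          if "b \<in> Bs" for b
        proof -
          have "b \<in> lie"
            using that Bs(2) by blast
          then show ?thesis
            unfolding f_def fst_conv snd_conv by (rule kappa_mscale(1)[OF _ m])
        qed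
        have "\<kappa> (\<gamma> u) (mat_eval (ham U' \<alpha>) u ** gi u) =
            (\<Sum>b\<in>Bs. \<kappa> (mscale (- a (u, b)) b) (mat_eval (ham U' \<alpha>) u ** gi u))"
          unfolding \<gamma>_def by (rule kappa_sum_left[OF mem m])
        also have "\<dots> = (\<Sum>b\<in>Bs. - a (u, b) * f (u, b) \<alpha>)"
          by (intro sum.cong refl k)
        finally show ?thesis .
      qed
      then show ?thesis
        by (simp add: cotangent_pairing_def)
    qed
    also have "\<dots> = (\<Sum>ub\<in>U \<times> Bs. a ub * f ub \<alpha>)"
      by (simp add: sum_negf sum.cartesian_product case_prod_beta)
    finally show ?thesis
      using a[OF c] by simp
  qed
  \<comment> \<open>The difference pairs to 0 with every covector on \<open>U'\<close>, so it
    vanishes at more than \<open>N\<close> points.\<close>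
  have T_diff: "\<delta> + mscale (rat_const (-1)) (ham U \<gamma>) \<in> T"
    by (rule T_comb[OF \<delta> hT])
  have "\<delta> + mscale (rat_const (-1)) (ham U \<gamma>) = 0"
  proof (rule zero_boundD[OF N T_diff U'])
    fix u assume u: "u \<in> U'"
    show "mat_eval (\<delta> + mscale (rat_const (-1)) (ham U \<gamma>)) u = 0"
    proof (rule eval_eq_0_if_left[OF T_diff U'(3)[OF u]])
      fix A assume A: "A \<in> lie"
      have s: "cotangent {u} (\<lambda>_. A)"
        using A U'(3)[OF u] by (simp add: cotangent_def)
      \<comment> \<open>A covector at the single point \<open>u\<close>, extended by zero because
        \<open>pair\<close> speaks of covectors on all of \<open>U'\<close>.\<close>
      have e: "cotangent U' (\<lambda>v. if v \<in> {u} then A else 0)"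
        by (rule cotangent_extend[OF s U'(1,3)])
      have P: "cotangent_pairing {u} (\<lambda>_. A) \<epsilon> = cotangent_pairing U' (\<lambda>v. if v \<in> {u} then A else 0) \<epsilon>"
        if "\<epsilon> \<in> T" for \<epsilon>
        using u by (intro pairing_extend[symmetric] s U' that) auto
      have "cotangent_pairing {u} (\<lambda>_. A) (ham U \<gamma>) = cotangent_pairing {u} (\<lambda>_. A) \<delta>"
        unfolding P[OF hT] P[OF \<delta>] by (rule pair[OF e])
      then show "\<kappa> A (mat_eval (\<delta> + mscale (rat_const (-1)) (ham U \<gamma>)) u ** gi u) = 0"
        using pairing_comb_right[OF s \<delta> hT, of "-1"] by (simp add: pairing_singleton)
    qed
  qed
  then have "\<delta> = ham U \<gamma>"
    by (simp add: rat_const_uminus rat_const_1)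
  then show ?thesis
    using \<gamma> by blast
qed

section \<open>Observables and their Hamiltonian vectors\<close>

definition obs_gradient :: "'n observable \<Rightarrow> complex \<Rightarrow> complex^'n^'n" where
  "obs_gradient f u = grad_left G \<kappa> (snd f u) (gv u)"

lemma cotangent_obs_gradient: "f \<in> observables G g \<Longrightarrow> cotangent (fst f) (obs_gradient f)"
  by (auto simp: observables_def cotangent_def obs_gradient_def intro!: grad_left reg_G)

text \<open>Left gradients can be prescribed point by point. The conclusion compares Hamiltonian
  vectors instead of gradients, because off \<open>W\<close> the gradients of \<open>f\<close> may
  differ from \<alpha>.\<close>

lemma observable_exists:
  assumes "cotangent W \<alpha>"
  obtains f where "f \<in> observables G g" "fst f = W" "ham W (obs_gradient f) = ham W \<alpha>"
proof -
  have "\<exists>\<phi>. \<phi> \<in> regular_functions \<and> grad_left G \<kappa> \<phi> (gv u) = \<alpha> u" if "u \<in> W" for u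
    using grad_left_surj[OF cotangentD(2)[OF assms that] reg_G[OF cotangentD(1)[OF assms that]]] by blast
  then obtain \<phi> where \<phi>: "\<And>u. u \<in> W \<Longrightarrow> \<phi> u \<in> regular_functions \<and> grad_left G \<kappa> (\<phi> u) (gv u) = \<alpha> u"
    using bchoice[of W "\<lambda>u \<phi>. \<phi> \<in> regular_functions \<and> grad_left G \<kappa> \<phi> (gv u) = \<alpha> u"] by blast
  have "(W, \<phi>) \<in> observables G g"
    using assms \<phi> by (auto simp: observables_def cotangent_def)
  moreover have "ham W (obs_gradient (W, \<phi>)) = ham W \<alpha>"
    unfolding ham_def by (intro sum.cong refl) (simp add: obs_gradient_def \<phi>)
  ultimately show ?thesis
    using that[of "(W, \<phi>)"] by simp
qed

text \<open>The bracket formula is \<open>pairing_skew\<close> against a covector concentrated at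
  the test point \<open>v\<close>. Uniqueness follows by testing with matrix entries at infinitely
  many \<open>v\<close>.\<close>

lemma hamiltonian_vector_iff:
  assumes f: "f \<in> observables G g"
  shows "hamiltonian_vector G \<kappa> g f X \<longleftrightarrow> X = ham (fst f) (obs_gradient f)"
proof -
  note c = cotangent_obs_gradient[OF f]
  have reg_fun: "snd f u \<in> regular_functions" if "u \<in> fst f" for u
    using f that by (auto simp: observables_def)
  have deriv: "fun_deriv \<psi> (gv v) (mat_eval (ham (fst f) (obs_gradient f)) v) =
      (\<Sum>u\<in>fst f. sklyanin_bracket G \<kappa> g (snd f u) u \<psi> v)"
    if \<psi>: "\<psi> \<in> regular_functions" and v: "reg v" "v \<notin> fst f" for \<psi> v
  proof -
    \<comment> \<open>The left gradient of the test function, regarded as a covector at the single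
      point \<open>v\<close>.\<close>
    define L where "L = grad_left G \<kappa> \<psi> (gv v)"
    have L: "L \<in> lie" "Ad (gi v) L \<in> lie"
      using grad_left(1)[OF \<psi> reg_G[OF v(1)]] v by (auto simp: L_def intro: Ad_lie inv_G reg_G)
    define H where "H = mat_eval (ham (fst f) (obs_gradient f)) v ** gi v"
    have H: "H \<in> lie"
      unfolding H_def by (rule ham_eval_left_lie[OF c v])
    have "fun_deriv \<psi> (gv v) (mat_eval (ham (fst f) (obs_gradient f)) v) = fun_deriv \<psi> (gv v) (H ** gv v)"
      using v by (simp add: H_def eval_left_mult)
    also have "\<dots> = \<kappa> L H"
      unfolding L_def by (rule grad_left(2)[OF \<psi> reg_G[OF v(1)] H, symmetric])
    also have "\<dots> = cotangent_pairing {v} (\<lambda>_. L) (ham (fst f) (obs_gradient f))"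
      by (simp add: pairing_singleton H_def)
    \<comment> \<open>Moving the Hamiltonian vector to the test covector leaves a sum over the
      support of \<open>f\<close>, which can be compared with the brackets term by term.\<close>
    also have "\<dots> = - cotangent_pairing (fst f) (obs_gradient f) (ham {v} (\<lambda>_. L))"
      using v L by (intro pairing_skew c) (auto simp: cotangent_def)
    also have "\<dots> = (\<Sum>u\<in>fst f. sklyanin_bracket G \<kappa> g (snd f u) u \<psi> v)"
      unfolding cotangent_pairing_def sum_negf[symmetric]
    proof (intro sum.cong refl)
      fix u assume u: "u \<in> fst f"
      note uu = cotangentD[OF c u]
      have AdL: "Ad (gv u) (Ad (gi v) L) \<in> lie"
        by (intro Ad_lie[OF reg_G[OF uu(1)]] L)
      have "mat_eval (ham {v} (\<lambda>_. L)) u ** gi u = mscale (1 / (v - u)) (L - Ad (gv u) (Ad (gi v) L))"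
        using ham_eval_left[OF uu(1), of "{v}" "\<lambda>_. L"] u v by auto
      then have "\<kappa> (obs_gradient f u) (mat_eval (ham {v} (\<lambda>_. L)) u ** gi u) =
          1 / (v - u) * (\<kappa> (obs_gradient f u) L - \<kappa> (right (obs_gradient f) u) (Ad (gi v) L))"
        using uu L AdL by (simp add: kappa_mscale kappa_diff lie_algebra_diff kappa_Ad_right reg_G)
      moreover have "- (1 / (v - u) * x) = x / (u - v)" for x
      proof -
        have "x / (u - v) = x / - (v - u)"
          by simp
        also have "\<dots> = - (1 / (v - u) * x)"
          by (simp only: divide_minus_right) simp
        finally show ?thesis ..
      qed
      moreover have "grad_right G \<kappa> (snd f u) (gv u) = right (obs_gradient f) u"
        "grad_right G \<kappa> \<psi> (gv v) = Ad (gi v) L"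
        by (simp_all add: grad_right reg_fun[OF u] \<psi> reg_G uu v obs_gradient_def L_def)
      ultimately show "- \<kappa> (obs_gradient f u) (mat_eval (ham {v} (\<lambda>_. L)) u ** gi u) =
          sklyanin_bracket G \<kappa> g (snd f u) u \<psi> v"
        by (simp only: sklyanin_bracket_def) (simp add: obs_gradient_def L_def)
    qed
    finally show ?thesis .
  qed
  show ?thesis
  proof
    assume "X = ham (fst f) (obs_gradient f)"
    then show "hamiltonian_vector G \<kappa> g f X"
      using ham_in_T[OF c] T_subset_tangent_G1 deriv by (auto simp: hamiltonian_vector_def)
  next
    assume X: "hamiltonian_vector G \<kappa> g f X"
    show "X = ham (fst f) (obs_gradient f)"
    proof (rule mat_eqI_infinite)
      show "infinite {z. reg z \<and> z \<notin> fst f \<union> mat_poles X}"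
        by (intro infinite_reg_outside) (simp add: finite_cotangent[OF c] finite_mat_poles)
      fix v assume v: "v \<in> {z. reg z \<and> z \<notin> fst f \<union> mat_poles X}"
      \<comment> \<open>The entry functions are regular, and their derivatives recover the whole
        matrix \<open>V\<close>.\<close>
      have entry: "fun_deriv (\<lambda>A. A $ i $ j) (gv v) V = V $ i $ j" for i j and V :: "complex^'n^'n"
        by (simp add: fun_deriv_eq_frob[OF dir_derivs_entry] frob_unit)
      have "mat_eval X v $ i $ j = mat_eval (ham (fst f) (obs_gradient f)) v $ i $ j" for i j
      proof -
        have "(\<lambda>A :: complex^'n^'n. A $ i $ j) \<in> regular_functions"
          by (intro polyfun_regular polyfun_entry)
        then have "fun_deriv (\<lambda>A. A $ i $ j) (gv v) (mat_eval X v) =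
            fun_deriv (\<lambda>A. A $ i $ j) (gv v) (mat_eval (ham (fst f) (obs_gradient f)) v)"
          using X v deriv unfolding hamiltonian_vector_def by auto
        then show ?thesis
          by (simp only: entry)
      qed
      then show "mat_eval X v = mat_eval (ham (fst f) (obs_gradient f)) v"
        unfolding vec_eq_iff by blast
    qed
  qed
qed

lemma differential_eq_pairing:
  assumes f: "f \<in> observables G g" and Y: "Y \<in> T"
  shows "differential g f Y = cotangent_pairing (fst f) (obs_gradient f) Y"
  unfolding differential_def cotangent_pairing_def
proof (intro sum.cong refl)
  fix u assume u: "u \<in> fst f"
  then have r: "reg u" "snd f u \<in> regular_functions"
    using f by (auto simp: observables_def)
  have "\<kappa> (obs_gradient f u) (mat_eval Y u ** gi u) = fun_deriv (snd f u) (gv u) (mat_eval Y u ** gi u ** gv u)"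
    unfolding obs_gradient_def by (rule grad_left(2)[OF r(2) reg_G[OF r(1)] T_regular(2)[OF Y r(1)]])
  then show "fun_deriv (snd f u) (gv u) (mat_eval Y u) = \<kappa> (obs_gradient f u) (mat_eval Y u ** gi u)"
    using r(1) by (simp add: eval_left_mult)
qed

lemma obtain_two_supports:
  obtains U U' where "finite U" "N < card U" "\<forall>u\<in>U. reg u"
    "finite U'" "N < card U'" "\<forall>u\<in>U'. reg u" "U \<inter> U' = {}"
proof -
  obtain U where U: "finite U" "card U = Suc N" "U \<subseteq> {z. reg z \<and> z \<notin> {}}"
    using infinite_arbitrarily_large[OF infinite_reg_outside[of "{}"]] by auto
  obtain U' where U': "finite U'" "card U' = Suc N" "U' \<subseteq> {z. reg z \<and> z \<notin> U}"
    using infinite_arbitrarily_large[OF infinite_reg_outside[OF U(1)]] by blast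
  show ?thesis
    by (rule that[of U U']) (use U U' in auto)
qed

theorem symplectic_leaf_at:
  "(\<forall>f\<in>observables G g. \<exists>!X. hamiltonian_vector G \<kappa> g f X) \<and>
   T = poisson_image G \<kappa> g \<and>
   (\<exists>\<sigma>. symplectic_form_on T \<sigma> \<and>
      (\<forall>f\<in>observables G g. \<forall>X. hamiltonian_vector G \<kappa> g f X \<longrightarrow> (\<forall>Y\<in>T. \<sigma> Y X = differential g f Y)))"
proof (intro conjI)
  show "\<forall>f\<in>observables G g. \<exists>!X. hamiltonian_vector G \<kappa> g f X"
    by (simp add: hamiltonian_vector_iff)
  obtain N where N: "zero_bound N"
    using zero_bound_exists by blast
  obtain U U' where supports: "finite U" "N < card U" "\<forall>u\<in>U. reg u"
    "finite U'" "N < card U'" "\<forall>u\<in>U'. reg u" and disj: "U \<inter> U' = {}"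
    by (rule obtain_two_supports[of N])
  then have U: "finite U" "N < card U" "\<And>u. u \<in> U \<Longrightarrow> reg u"
    and U': "finite U'" "N < card U'" "\<And>u. u \<in> U' \<Longrightarrow> reg u"
    by simp_all
  have onU: "\<exists>\<gamma>. cotangent U \<gamma> \<and> ham U \<gamma> = \<delta>" if "\<delta> \<in> T" for \<delta>
    using T_eq_ham[OF N U(1,2) _ U'(1,2) _ disj that] U(3) U'(3) by blast
  have onU': "\<exists>\<gamma>. cotangent U' \<gamma> \<and> ham U' \<gamma> = \<delta>" if "\<delta> \<in> T" for \<delta>
    using T_eq_ham[OF N U'(1,2) _ U(1,2) _ _ that] disj U(3) U'(3) by blast
  show "T = poisson_image G \<kappa> g"
  proof (intro equalityI subsetI)
    fix \<delta> assume "\<delta> \<in> T"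
    then obtain \<alpha> where \<alpha>: "cotangent U \<alpha>" "ham U \<alpha> = \<delta>"
      using onU by blast
    obtain f where f: "f \<in> observables G g" "fst f = U" "ham U (obs_gradient f) = ham U \<alpha>"
      by (rule observable_exists[OF \<alpha>(1)])
    then have "hamiltonian_vector G \<kappa> g f \<delta>"
      using \<alpha>(2) by (simp add: hamiltonian_vector_iff)
    then show "\<delta> \<in> poisson_image G \<kappa> g"
      using f(1) by (auto simp: poisson_image_def)
  next
    fix \<delta> assume "\<delta> \<in> poisson_image G \<kappa> g"
    then obtain f where f: "f \<in> observables G g" "hamiltonian_vector G \<kappa> g f \<delta>"
      by (auto simp: poisson_image_def)
    then have "\<delta> = ham (fst f) (obs_gradient f)"
      by (simp add: hamiltonian_vector_iff)
    then show "\<delta> \<in> T"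
      using ham_in_T[OF cotangent_obs_gradient[OF f(1)]] by simp
  qed
  \<comment> \<open>An arbitrary covector on \<open>U\<close> with Hamiltonian vector
    \<open>X\<close>. By \<open>pairing_cong_ham\<close> the choice does not affect the form, and
    \<sigma> may be computed from covectors with any support.\<close>
  define lift where "lift X = (SOME \<alpha>. cotangent U \<alpha> \<and> ham U \<alpha> = X)" for X
  have lift: "cotangent U (lift X)" "ham U (lift X) = X" if "X \<in> T" for X
    using someI_ex[OF onU[OF that]] by (simp_all add: lift_def)
  define \<sigma> where "\<sigma> Y X = cotangent_pairing U (lift X) Y" for Y X
  have \<sigma>: "\<sigma> Y (ham W \<alpha>) = cotangent_pairing W \<alpha> Y" if "Y \<in> T" "cotangent W \<alpha>" for Y W \<alpha>
    unfolding \<sigma>_def using lift[OF ham_in_T[OF that(2)]] that by (intro pairing_cong_ham)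
  have "symplectic_form_on T \<sigma>"
    unfolding symplectic_form_on_def bilinear_form_on_def nondegenerate_on_def
  proof (intro conjI ballI allI impI)
    have comb_left: "\<sigma> (x + mscale (rat_const c) y) z = \<sigma> x z + c * \<sigma> y z"
      if "x \<in> T" "y \<in> T" "z \<in> T" for x y z c
      unfolding \<sigma>_def using that lift by (intro pairing_comb_right)
    have comb_right: "\<sigma> z (x + mscale (rat_const c) y) = \<sigma> z x + c * \<sigma> z y"
      if "x \<in> T" "y \<in> T" "z \<in> T" for x y z c
    proof -
      note x = lift[OF that(1)] and y = lift[OF that(2)]
      have "\<sigma> z (ham U (\<lambda>u. lift x u + mscale c (lift y u))) = \<sigma> z (ham U (lift x)) + c * \<sigma> z (ham U (lift y))"
        using that x(1) y(1) by (simp add: \<sigma> cotangent_comb pairing_comb_left)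
      then show ?thesis
        by (simp add: ham_comb[OF U(1)] x y)
    qed
    have T0: "0 \<in> T"
      using ham_in_T[of "{}" "\<lambda>_. 0"] by (simp add: cotangent_def ham_def)
    \<comment> \<open>From 0 = 0 + (-1) 0, as for functionals above.\<close>
    have zero: "\<sigma> 0 z = 0" "\<sigma> z 0 = 0" if "z \<in> T" for z
      using comb_left[OF T0 T0 that, of "-1"] comb_right[OF T0 T0 that, of "-1"] by simp_all
    fix x y assume x: "x \<in> T" and y: "y \<in> T"
    show "\<sigma> (mscale (rat_const c) x) y = c * \<sigma> x y" "\<sigma> x (mscale (rat_const c) y) = c * \<sigma> x y" for c
      using comb_left[OF T0 x y, of c] comb_right[OF T0 y x, of c] zero x y by simp_all
    fix z assume z: "z \<in> T"
    show "\<sigma> (x + y) z = \<sigma> x z + \<sigma> y z" "\<sigma> z (x + y) = \<sigma> z x + \<sigma> z y"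
      using comb_left[OF x y z, of 1] comb_right[OF x y z, of 1] by (simp_all add: rat_const_1)
  next
    fix x assume x: "x \<in> T"
    \<comment> \<open>A second covector for \<open>x\<close>, on \<open>U'\<close>: skew-symmetry is
      available for disjoint supports, and comparing the two gives \<sigma> x x = - \<sigma> x
      x.\<close>
    obtain \<alpha> where \<alpha>: "cotangent U' \<alpha>" "ham U' \<alpha> = x"
      using onU'[OF x] by blast
    have "\<sigma> x x = cotangent_pairing U' \<alpha> (ham U (lift x))"
      using \<sigma>[OF x \<alpha>(1)] lift[OF x] \<alpha> by simp
    also have "\<dots> = - cotangent_pairing U (lift x) (ham U' \<alpha>)"
      using disj by (intro pairing_skew \<alpha> lift x) auto
    also have "\<dots> = - \<sigma> x x"
      by (simp add: \<sigma>_def \<alpha>)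
    finally show "\<sigma> x x = 0"
      by simp
  next
    fix x assume x: "x \<in> T" and 0: "\<forall>y\<in>T. \<sigma> x y = 0"
    show "x = 0"
    \<comment> \<open>Hamiltonian vectors of covectors at a single point \<open>u\<close> test the
      value of \<open>x\<close> at \<open>u\<close>; more than \<open>N\<close> such points
      suffice.\<close>
    proof (rule zero_boundD[OF N x U])
      fix u assume u: "u \<in> U"
      show "mat_eval x u = 0"
      proof (rule eval_eq_0_if_left[OF x U(3)[OF u]])
        fix A assume "A \<in> lie"
        then have s: "cotangent {u} (\<lambda>_. A)"
          using U(3)[OF u] by (simp add: cotangent_def)
        have "\<sigma> x (ham {u} (\<lambda>_. A)) = 0"
          using 0 ham_in_T[OF s] by blast
        then show "\<kappa> A (mat_eval x u ** gi u) = 0"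
          using \<sigma>[OF x s] by (simp add: pairing_singleton)
      qed
    qed
  qed
  moreover have "\<sigma> Y X = differential g f Y"
    if "f \<in> observables G g" "hamiltonian_vector G \<kappa> g f X" "Y \<in> T" for f X Y
    using that by (simp add: hamiltonian_vector_iff \<sigma> cotangent_obs_gradient differential_eq_pairing)
  ultimately show "\<exists>\<sigma>. symplectic_form_on T \<sigma> \<and>
      (\<forall>f\<in>observables G g. \<forall>X. hamiltonian_vector G \<kappa> g f X \<longrightarrow> (\<forall>Y\<in>T. \<sigma> Y X = differential g f Y))"
    by blast
qed

lemma r_infinity_in_G1_series: "r_infinity g \<in> G1_series G"
proof -
  \<comment> \<open>The framing supplies the value 1 at w = 0.\<close>
  define M where "M w = (if w = 0 then mat 1 else gv (1 / w))" for w
  have M: "(\<lambda>w. M w $ i $ j) has_fps_expansion r_infinity g $ i $ j" for i j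
  proof -
    have "(rat_eval (g $ i $ j) \<longlongrightarrow> mat 1 $ i $ j) at_infinity"
      using tendsto_vec_nth[OF tendsto_vec_nth[OF g_lim]] by simp
    moreover have "M w $ i $ j = (if w = 0 then mat 1 $ i $ j else rat_eval (g $ i $ j) (1 / w))" for w
      by (simp add: M_def)
    ultimately show ?thesis
      using infinity_expansion by (simp add: r_infinity_nth)
  qed
  have "\<forall>\<^sub>F w in at 0. reg (1 / w)"
    using eventually_reg_at_infinity by (simp add: at_to_infinity eventually_filtermap inverse_eq_divide)
  then have "\<forall>\<^sub>F w in nhds 0. M w \<in> G"
    unfolding eventually_at_filter by eventually_elim (auto simp: M_def one_G reg_G)
  from expansion_in_G_series[OF M this] have "r_infinity g \<in> G_series G" .
  moreover have "fps_nth (r_infinity g $ i $ j) 0 = mat 1 $ i $ j" for i j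
    using has_fps_expansion_imp_0_eq_fps_nth_0[OF M[of i j]] by (simp add: M_def)
  ultimately show ?thesis
    by (simp add: G1_series_def vec_eq_iff)
qed

end

section \<open>From a single map g to the whole moduli space\<close>

lemma mHiggs_fr_subset:
  assumes "finite D"
  shows "mHiggs_fr G D \<omega> \<subseteq> G1_rational G"
proof
  fix g assume g: "g \<in> mHiggs_fr G D \<omega>"
  then have "{z. \<not> regular_at G g z} \<subseteq> D"
    by (auto simp: mHiggs_fr_def)
  then show "g \<in> G1_rational G"
    using g assms finite_subset by (auto simp: mHiggs_fr_def G1_rational_def)
qed

theorem theorem4p22:
  fixes G T B :: "(complex^'n::finite^'n) set"
    and \<kappa> :: "complex^'n^'n \<Rightarrow> complex^'n^'n \<Rightarrow> complex"
    and D :: "complex set"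
    and \<omega> :: "complex \<Rightarrow> complex \<Rightarrow> complex^'n^'n"
  assumes "reductive_group G"
    and "invariant_pairing G \<kappa>"
    and "maximal_torus G T" and "borel_subgroup G B" and "T \<subseteq> B"
    and "finite D"
    and "\<forall>z\<in>D. dominant_coweight G T B (\<omega> z)"
  shows "mHiggs_fr G D \<omega> \<subseteq> G1_rational G \<and>
    r_infinity ` mHiggs_fr G D \<omega> \<subseteq> G1_series G \<and>
    inj_on r_infinity (mHiggs_fr G D \<omega>) \<and>
    (\<forall>g\<in>mHiggs_fr G D \<omega>.
       (\<forall>f\<in>observables G g. \<exists>!X. hamiltonian_vector G \<kappa> g f X) \<and>
       tangent_mHiggs G g = poisson_image G \<kappa> g \<and>
       (\<exists>\<sigma>. symplectic_form_on (tangent_mHiggs G g) \<sigma> \<and>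
          (\<forall>f\<in>observables G g. \<forall>X. hamiltonian_vector G \<kappa> g f X \<longrightarrow>
             (\<forall>Y\<in>tangent_mHiggs G g. \<sigma> Y X = differential g f Y))))"
proof -
  note sub = mHiggs_fr_subset[OF assms(6), of G \<omega>]
  have framed: "framed_map G \<kappa> g" if "g \<in> mHiggs_fr G D \<omega>" for g
    using assms(1,2) sub that
    by (auto simp: framed_map_def invariant_group_def framed_map_axioms_def reductive_group_def)
  have "r_infinity ` mHiggs_fr G D \<omega> \<subseteq> G1_series G"
    using framed_map.r_infinity_in_G1_series[OF framed] by blast
  moreover have "inj_on r_infinity (mHiggs_fr G D \<omega>)"
    by (rule inj_onI) (auto simp: mHiggs_fr_def intro: r_infinity_eq_imp_eq)
  ultimately show ?thesis
    by (intro conjI[OF sub] conjI ballI framed_map.symplectic_leaf_at[OF framed])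
qed

end
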